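(* Let $S$ be a Damek--Ricci space and assume that $U\in C^\infty(S\times S)$ satisfies $$\Delta_x\,U(x,y)=\Delta_y\,U(x,y)\qquad\text{for all }x,y\in S.$$ Then $$\int_{S(x,r)}dx'\int_{S(y,s)}dy'\;U(x',y')=\int_{S(x,s)}dx'\int_{S(y,r)}dy'\;U(x',y')$$ for every $x,y\in S$ and $r,s>0$.
   Context: Damek--Ricci space: let $m\ge0$ be an even integer and $k\ge1$ an integer, and let $[\cdot,\cdot]:\mathbb{R}^m\times\mathbb{R}^m\to\mathbb{R}^k$ be a skew-symmetric bilinear map of Heisenberg type, i.e. for every $Y\in\mathbb{R}^k$ the endomorphism $J_Y$ of $\mathbb{R}^m$ defined by $\langle J_YX,X'\rangle=\langle Y,[X,X']\rangle$ satisfies $J_Y^2=-|Y|^2\,\mathrm{Id}$ (the degenerate case $m=0$ gives real hyperbolic space). $S=\mathbb{R}^m\times\mathbb{R}^k\times\mathbb{R}$ is the Lie group with multiplication $$(X,Y,z)\cdot(X',Y',z')=\bigl(X+e^{z/2}X',\;Y+e^{z}Y'+\tfrac12e^{z/2}[X,X'],\;z+z'\bigr),$$ identity $e=(0,0,0)$, equipped with the left-invariant Riemannian metric which at $e$ is the standard Euclidean inner product $\langle X,X'\rangle+\langle Y,Y'\rangle+zz'$. Notation: $\Delta$ is the Laplace--Beltrami operator of $S$ (a subscript $x$ or $y$ indicates the variable in which it acts), $S(x,r)$ is the geodesic sphere of center $x$ and radius $r$, and integrals over spheres are with respect to the Riemannian surface measure. *)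

theory Defs
  imports "HOL-Analysis.Analysis" "HOL-Combinatorics.Permutations"
begin

section \<open>Smooth maps\<close>

text \<open>Intended for open \<open>S\<close>: all iterated directional derivatives exist, are Frechet
  differentiable and continuous on \<open>S\<close>.\<close>

fun C_k_on :: "nat \<Rightarrow> ('a::real_normed_vector \<Rightarrow> 'b::real_normed_vector) \<Rightarrow> 'a set \<Rightarrow> bool" where
  "C_k_on 0 f S \<longleftrightarrow> continuous_on S f"
| "C_k_on (Suc k) f S \<longleftrightarrow>
     (\<forall>x\<in>S. f differentiable (at x)) \<and> (\<forall>v. C_k_on k (\<lambda>x. frechet_derivative f (at x) v) S)"

definition smooth_on :: "'a::real_normed_vector set \<Rightarrow> ('a \<Rightarrow> 'b::real_normed_vector) \<Rightarrow> bool" where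
  "smooth_on S f \<longleftrightarrow> (\<forall>k. C_k_on k f S)"


section \<open>Riemannian metrics in one global chart\<close>

text \<open>A metric on a Euclidean space, viewed as a manifold with one global chart, is given by
  its values \<open>g p u w\<close> for a point \<open>p\<close> and tangent vectors \<open>u\<close>, \<open>w\<close> at \<open>p\<close>.\<close>

type_synonym 'e metric_tensor = "'e \<Rightarrow> 'e \<Rightarrow> 'e \<Rightarrow> real"

text \<open>The Leibniz formula of \<^const>\<open>det\<close>, for a matrix whose rows and columns are indexed
  by \<^const>\<open>Basis\<close> instead of a type.\<close>

definition det_Basis :: "('a::euclidean_space \<Rightarrow> 'a \<Rightarrow> real) \<Rightarrow> real" where
  "det_Basis h = (\<Sum>\<pi> | \<pi> permutes Basis. of_int (sign \<pi>) * (\<Prod>i\<in>Basis. h i (\<pi> i)))"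

text \<open>The entry $g^{bc}$ of the inverse of the Gram matrix of \<open>g p\<close>: it is the component along
  \<open>c\<close> of the vector representing the covector \<open>b \<bullet> _\<close> with respect to \<open>g p\<close>.\<close>

definition inverse_metric :: "'e::euclidean_space metric_tensor \<Rightarrow> 'e \<Rightarrow> 'e \<Rightarrow> 'e \<Rightarrow> real" where
  "inverse_metric g p b c = (THE v. \<forall>w. g p v w = b \<bullet> w) \<bullet> c"

definition volume_density :: "'e::euclidean_space metric_tensor \<Rightarrow> 'e \<Rightarrow> real" where
  "volume_density g p = sqrt (det_Basis (g p))"

definition laplace_beltrami ::
  "'e::euclidean_space metric_tensor \<Rightarrow> ('e \<Rightarrow> 'b::real_normed_vector) \<Rightarrow> 'e \<Rightarrow> 'b" where
  "laplace_beltrami g f p =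
     (1 / volume_density g p) *\<^sub>R
     (\<Sum>b\<in>Basis. frechet_derivative
        (\<lambda>q. volume_density g q *\<^sub>R
              (\<Sum>c\<in>Basis. inverse_metric g q b c *\<^sub>R frechet_derivative f (at q) c))
        (at p) b)"

text \<open>The infimum of the lengths of piecewise $C^1$ curves. Asking for \<open>has_integral\<close> is
  essential: \<^const>\<open>piecewise_C1_differentiable_on\<close> does not bound the derivative near the
  exceptional points, and the total \<^const>\<open>integral\<close> would assign length \<open>0\<close> to curves of
  infinite length.\<close>

definition riemannian_dist :: "'e::euclidean_space metric_tensor \<Rightarrow> 'e \<Rightarrow> 'e \<Rightarrow> real" where
  "riemannian_dist g p q =
     Inf {L. \<exists>\<gamma>. \<gamma> piecewise_C1_differentiable_on {0..1} \<and> pathstart \<gamma> = p \<and> pathfinish \<gamma> = q \<and>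
               ((\<lambda>t. sqrt (g (\<gamma> t) (vector_derivative \<gamma> (at t)) (vector_derivative \<gamma> (at t))))
                  has_integral L) {0..1}}"

definition geodesic_sphere :: "'e::euclidean_space metric_tensor \<Rightarrow> 'e \<Rightarrow> real \<Rightarrow> 'e set" where
  "geodesic_sphere g x r = {p. riemannian_dist g x p = r}"

text \<open>Hypersurfaces of \<^typ>\<open>'a \<times> real\<close> are parametrised by open subsets of \<^typ>\<open>'a\<close>, which has
  the right dimension.\<close>

definition local_parametrization ::
  "('a::euclidean_space \<times> real) set \<Rightarrow> 'a set \<Rightarrow> ('a \<Rightarrow> 'a \<times> real) \<Rightarrow> bool" where
  "local_parametrization M W \<phi> \<longleftrightarrow>
     open W \<and> smooth_on W \<phi> \<and> (\<forall>w\<in>W. inj (frechet_derivative \<phi> (at w))) \<and>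
     openin (top_of_set M) (\<phi> ` W) \<and> (\<exists>\<psi>. homeomorphism W (\<phi> ` W) \<phi> \<psi>)"

text \<open>The Borel measure on \<open>M\<close> whose density in every local parametrisation is the square root
  of the Gram determinant of the induced metric. It is unique when \<open>M\<close> is an embedded smooth
  hypersurface, and is only meaningful in this case.\<close>

definition surface_measure ::
  "('a::euclidean_space \<times> real) metric_tensor \<Rightarrow> ('a \<times> real) set \<Rightarrow> ('a \<times> real) measure" where
  "surface_measure g M =
     (THE \<mu>. sets \<mu> = sets (restrict_space borel M) \<and>
        (\<forall>W \<phi>. local_parametrization M W \<phi> \<longrightarrow>
          (\<forall>A\<in>sets borel. A \<subseteq> W \<longrightarrow>
             emeasure \<mu> (\<phi> ` A) =
               (\<integral>\<^sup>+ w\<in>A. ennreal (sqrt (det_Basis (\<lambda>i j.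
                   g (\<phi> w) (frechet_derivative \<phi> (at w) i) (frechet_derivative \<phi> (at w) j))))
                 \<partial>lborel))))"

definition sphere_integral ::
  "('a::euclidean_space \<times> real) metric_tensor \<Rightarrow> 'a \<times> real \<Rightarrow> real \<Rightarrow>
     ('a \<times> real \<Rightarrow> 'b::{banach, second_countable_topology}) \<Rightarrow> 'b" where
  "sphere_integral g x r f = (\<integral>p. f p \<partial>surface_measure g (geodesic_sphere g x r))"


section \<open>Damek--Ricci spaces\<close>

text \<open>The product of $R^m$ and $R^k$ is a Euclidean space \<^typ>\<open>'a\<close> of dimension $m+k$ whose
  standard orthonormal basis is split into a set \<open>B\<close> with $m$ elements, spanning $R^m$, and
  \<open>Basis - B\<close> with $k$ elements, spanning $R^k$. (A separate type for $R^m$ would exclude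
  $m = 0$.)\<close>

definition X_part :: "'a::euclidean_space set \<Rightarrow> 'a \<Rightarrow> 'a" where
  "X_part B v = (\<Sum>b\<in>B. (v \<bullet> b) *\<^sub>R b)"

definition Y_part :: "'a::euclidean_space set \<Rightarrow> 'a \<Rightarrow> 'a" where
  "Y_part B v = (\<Sum>b\<in>Basis - B. (v \<bullet> b) *\<^sub>R b)"

text \<open>Only the restriction of \<open>br\<close> to $R^m \times R^m$ matters. Every bilinear map on
  $R^m \times R^m$ and every endomorphism of $R^m$ extends to all of \<^typ>\<open>'a\<close>, so that global
  (bi)linearity is no restriction.\<close>

definition heisenberg_type :: "'a::euclidean_space set \<Rightarrow> ('a \<Rightarrow> 'a \<Rightarrow> 'a) \<Rightarrow> bool" where
  "heisenberg_type B br \<longleftrightarrow>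
     bilinear br \<and>
     (\<forall>X\<in>span B. \<forall>X'\<in>span B. br X X' \<in> span (Basis - B) \<and> br X' X = - br X X') \<and>
     (\<forall>Y\<in>span (Basis - B). \<exists>J. linear J \<and> J ` span B \<subseteq> span B \<and>
        (\<forall>X\<in>span B. \<forall>X'\<in>span B. J X \<bullet> X' = Y \<bullet> br X X') \<and>
        (\<forall>X\<in>span B. J (J X) = - ((norm Y)\<^sup>2 *\<^sub>R X)))"

definition damek_ricci :: "'a::euclidean_space set \<Rightarrow> ('a \<Rightarrow> 'a \<Rightarrow> 'a) \<Rightarrow> bool" where
  "damek_ricci B br \<longleftrightarrow>
     B \<subseteq> Basis \<and> even (card B) \<and> card (Basis - B) \<ge> 1 \<and> heisenberg_type B br"

definition dr_mult ::
  "'a::euclidean_space set \<Rightarrow> ('a \<Rightarrow> 'a \<Rightarrow> 'a) \<Rightarrow> 'a \<times> real \<Rightarrow> 'a \<times> real \<Rightarrow> 'a \<times> real" where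
  "dr_mult B br p q =
     (let X = X_part B (fst p); Y = Y_part B (fst p); z = snd p;
          X' = X_part B (fst q); Y' = Y_part B (fst q); z' = snd q
      in ((X + exp (z / 2) *\<^sub>R X') +
          (Y + exp z *\<^sub>R Y' + (exp (z / 2) / 2) *\<^sub>R br X X'),
          z + z'))"

text \<open>The left-invariant metric which at the identity \<open>0\<close> is the standard inner product.\<close>

definition dr_metric ::
  "'a::euclidean_space set \<Rightarrow> ('a \<Rightarrow> 'a \<Rightarrow> 'a) \<Rightarrow> ('a \<times> real) metric_tensor" where
  "dr_metric B br p u w =
     (let D = frechet_derivative (dr_mult B br p) (at 0) in inv D u \<bullet> inv D w)"

end

(*
  Let V(r,s) be the mean of U over S(x,r) x S(y,s), with respect to polar coordinates. A
  Damek-Ricci space has a ball model in which the density A(r) of geodesic spheres depends on the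
  radius only, so averaging over a sphere turns the Laplacian into its radial part
  f'' + (A'/A) f'. Hence V satisfies
    V_rr + A'(r)/A(r) V_r = V_ss + A'(s)/A(s) V_s.
  W(r,s) = V(r,s) - V(s,r) solves the same equation and vanishes on the diagonal. An energy
  estimate on the triangle 0 < s < r, using A >= 0 and A' >= 0, gives W = 0.

  The radial part of the Laplacian is found without Riemannian geometry: integrating the
  divergence of h(d(x,.)) grad f, for radial cut-off functions h, in polar coordinates
  gives (A N')' = A L for the spherical means N of f and L of its Laplacian.
*)
theory Submission
  imports Defs
begin

section \<open>Calculus of smooth maps\<close>

text \<open>A Damek--Ricci space is in general not symmetric: the isometries fixing a point need not
  act transitively on the spheres around it, so spherical means cannot be treated as averages over a
  group. What survives is that the volume density around every point is radial. The ball model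
  showing this is the Cayley transform onto a Siegel domain. The identity J_Y^2 = -|Y|^2 makes (1 -
  z) + J_Y a multiple of an isometry of the X-space, and this is what makes the Riemannian Jacobian
  depend on |v| only; left translations then move the centre to any point. Through the Gauss lemma
  the same model gives explicit formulas for the distance, defined as an infimum of lengths, and for
  the surface measure, defined by a definite description.

  The coefficient A'/A of the wave equation blows up at radius 0, and the diagonal is
  characteristic. Weighting the energy by A(s) absorbs the singularity at s = 0; on the diagonal the
  boundary term is a multiple of (W_r + W_s)^2, which vanishes because W does.\<close>

lemma linear_Basis_expansion:
  assumes "linear f"
  shows "f w = (\<Sum>b\<in>Basis. (w \<bullet> b) *\<^sub>R f b)"
proof -
  have "f w = f (\<Sum>b\<in>Basis. (w \<bullet> b) *\<^sub>R b)"
    by (simp add: euclidean_representation)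
  then show ?thesis
    by (simp add: linear_sum[OF assms] linear_cmul[OF assms])
qed

lemma frechet_derivative_cong_open:
  assumes "open S" "x \<in> S" "\<And>y. y \<in> S \<Longrightarrow> f y = g y"
  shows "frechet_derivative f (at x) = frechet_derivative g (at x)"
proof -
  have "(f has_derivative D) (at x) \<longleftrightarrow> (g has_derivative D) (at x)" for D
    using assms has_derivative_transform_within_open[of f D x UNIV S g]
      has_derivative_transform_within_open[of g D x UNIV S f] by auto
  then show ?thesis
    unfolding frechet_derivative_def by simp
qed

lemma differentiable_cong_open:
  assumes "open S" "x \<in> S" "\<And>y. y \<in> S \<Longrightarrow> f y = g y" "f differentiable (at x)"
  shows "g differentiable (at x)"
  using assms has_derivative_transform_within_open[of f _ x UNIV S g]
  unfolding differentiable_def by blast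

lemma C_k_on_cong:
  assumes "open S" "\<And>y. y \<in> S \<Longrightarrow> f y = g y" "C_k_on k f S"
  shows "C_k_on k g S"
  using assms(2,3)
proof (induction k arbitrary: f g)
  case 0
  then show ?case by (auto intro: continuous_on_eq)
next
  case (Suc k)
  have "C_k_on k (\<lambda>x. frechet_derivative g (at x) v) S" for v
    by (rule Suc.IH[of "\<lambda>x. frechet_derivative f (at x) v"])
      (use Suc.prems frechet_derivative_cong_open[OF assms(1), of _ f g] in auto)
  moreover have "g differentiable (at x)" if "x \<in> S" for x
    using Suc.prems differentiable_cong_open[OF assms(1) that, of f g] that by auto
  ultimately show ?case by simp
qed

lemma C_k_on_subset: "C_k_on k f S \<Longrightarrow> T \<subseteq> S \<Longrightarrow> C_k_on k f T"
  by (induction k arbitrary: f) (auto intro: continuous_on_subset)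

lemma C_k_on_SucD: "C_k_on (Suc k) f S \<Longrightarrow> C_k_on k f S"
proof (induction k arbitrary: f)
  case 0
  then show ?case
    by (auto intro!: continuous_at_imp_continuous_on differentiable_imp_continuous_within)
next
  case (Suc k)
  then show ?case
    by (metis C_k_on.simps(2))
qed

text \<open>Derivatives are unique, so on an open set any formula \<open>f'\<close> for the
  derivative may replace the chosen \<open>frechet_derivative\<close>. The closure properties below
  are inductions through this rule.\<close>

lemma C_k_on_SucI:
  assumes "open S" "\<And>x. x \<in> S \<Longrightarrow> (f has_derivative f' x) (at x)"
    "\<And>v. C_k_on k (\<lambda>x. f' x v) S"
  shows "C_k_on (Suc k) f S"
proof -
  have "f' x = frechet_derivative f (at x)" if "x \<in> S" for x
    by (rule frechet_derivative_at[OF assms(2)[OF that]])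
  then have "C_k_on k (\<lambda>x. frechet_derivative f (at x) v) S" for v
    using C_k_on_cong[OF assms(1) _ assms(3)[of v], of "\<lambda>x. frechet_derivative f (at x) v"] by simp
  then show ?thesis
    using assms(2) by (auto simp: differentiable_def)
qed

lemma C_k_on_has_derivative:
  assumes "C_k_on (Suc k) f S" "x \<in> S"
  shows "(f has_derivative frechet_derivative f (at x)) (at x)"
  using assms by (simp add: frechet_derivative_works)

lemma C_k_on_const: "open S \<Longrightarrow> C_k_on k (\<lambda>x. c) S"
proof (induction k arbitrary: c)
  case (Suc k)
  show ?case
    by (rule C_k_on_SucI[where f' = "\<lambda>x v. 0"]) (use Suc in auto)
qed auto

lemma C_k_on_bounded_linear:
  assumes "open S" "bounded_linear f"
  shows "C_k_on k f S"
proof (cases k)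
  case 0
  then show ?thesis using assms by (simp add: linear_continuous_on)
next
  case (Suc j)
  show ?thesis unfolding Suc
    by (rule C_k_on_SucI[where f' = "\<lambda>x. f"])
      (use assms in \<open>auto intro: C_k_on_const bounded_linear_imp_has_derivative\<close>)
qed

lemma C_k_on_add:
  assumes "open S" "C_k_on k f S" "C_k_on k g S"
  shows "C_k_on k (\<lambda>x. f x + g x) S"
  using assms(2,3)
proof (induction k arbitrary: f g)
  case 0
  then show ?case by (auto intro: continuous_on_add)
next
  case (Suc k)
  show ?case
    by (rule C_k_on_SucI[where f' = "\<lambda>x v. frechet_derivative f (at x) v + frechet_derivative g (at x) v"])
      (use Suc assms(1) in \<open>auto intro!: has_derivative_add C_k_on_has_derivative\<close>)
qed

lemma C_k_on_bounded_linear_compose: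
  assumes "open S" "bounded_linear L" "C_k_on k f S"
  shows "C_k_on k (\<lambda>x. L (f x)) S"
  using assms(3)
proof (induction k arbitrary: f)
  case 0
  then show ?case using assms by (auto intro: bounded_linear.continuous_on)
next
  case (Suc k)
  show ?case
    by (rule C_k_on_SucI[where f' = "\<lambda>x v. L (frechet_derivative f (at x) v)"])
      (use Suc assms in \<open>auto intro!: bounded_linear.has_derivative[OF assms(2)] C_k_on_has_derivative\<close>)
qed

text \<open>The product rule mixes differentiated and undifferentiated factors, so the induction
  hypothesis at order \<open>k\<close> is also applied to \<open>f\<close> and \<open>g\<close>
  themselves; \<open>C_k_on_SucD\<close> provides for this.\<close>

lemma C_k_on_bilinear:
  assumes "open S" "bounded_bilinear prd" "C_k_on k f S" "C_k_on k g S"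
  shows "C_k_on k (\<lambda>x. prd (f x) (g x)) S"
  using assms(3,4)
proof (induction k arbitrary: f g)
  case 0
  then show ?case using assms by (auto intro: bounded_bilinear.continuous_on)
next
  case (Suc k)
  have fg: "C_k_on k f S" "C_k_on k g S"
    using Suc.prems C_k_on_SucD by blast+
  show ?case
  proof (rule C_k_on_SucI[where f' = "\<lambda>x v. prd (f x) (frechet_derivative g (at x) v) + prd (frechet_derivative f (at x) v) (g x)"])
    show "((\<lambda>x. prd (f x) (g x)) has_derivative (\<lambda>v. prd (f x) (frechet_derivative g (at x) v) + prd (frechet_derivative f (at x) v) (g x))) (at x)"
      if "x \<in> S" for x
      using that Suc.prems by (intro bounded_bilinear.FDERIV[OF assms(2)] C_k_on_has_derivative)
  next
    fix v
    show "C_k_on k (\<lambda>x. prd (f x) (frechet_derivative g (at x) v) + prd (frechet_derivative f (at x) v) (g x)) S"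
      using Suc fg by (intro C_k_on_add assms Suc.IH) auto
  qed (rule assms)
qed

lemma C_k_on_sum:
  assumes "open S" "\<And>i. i \<in> I \<Longrightarrow> C_k_on k (f i) S"
  shows "C_k_on k (\<lambda>x. \<Sum>i\<in>I. f i x) S"
  using assms(2)
  by (induction I rule: infinite_finite_induct) (auto intro: C_k_on_const C_k_on_add assms(1))

text \<open>\<open>C_k_on\<close> controls \<open>frechet_derivative f (at x) v\<close> for fixed
  \<open>v\<close> only, while the chain rule evaluates the derivative of \<open>f\<close> in the
  moving direction \<open>frechet_derivative g (at x) v\<close>. Expanding this direction in the
  standard basis leaves fixed directions with differentiable coefficients; hence the Euclidean
  codomain of \<open>g\<close>.\<close>

lemma C_k_on_compose:
  fixes g :: "'a::real_normed_vector \<Rightarrow> 'b::euclidean_space"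
  assumes "open S" "open T" "C_k_on k g S" "C_k_on k f T" "g ` S \<subseteq> T"
  shows "C_k_on k (\<lambda>x. f (g x)) S"
  using assms(3,4)
proof (induction k arbitrary: f)
  case 0
  then show ?case using assms(5) by (auto intro: continuous_on_compose2)
next
  case (Suc k)
  let ?f' = "\<lambda>x v. \<Sum>b\<in>Basis. (frechet_derivative g (at x) v \<bullet> b) *\<^sub>R frechet_derivative f (at (g x)) b"
  have gk: "C_k_on k g S"
    using Suc.prems C_k_on_SucD by blast
  show ?case
  proof (rule C_k_on_SucI[where f' = ?f'])
    show "((\<lambda>x. f (g x)) has_derivative ?f' x) (at x)" if "x \<in> S" for x
    proof -
      have fg: "(f has_derivative frechet_derivative f (at (g x))) (at (g x))"
        using Suc.prems assms(5) that by (intro C_k_on_has_derivative) auto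
      show ?thesis
        by (rule has_derivative_eq_rhs[OF has_derivative_compose[OF C_k_on_has_derivative[OF Suc.prems(1) that] fg]],
            rule ext, rule linear_Basis_expansion[OF has_derivative_linear[OF fg]])
    qed
    fix v
    have "C_k_on k (\<lambda>x. frechet_derivative g (at x) v \<bullet> b) S" for b
      by (rule C_k_on_bounded_linear_compose[OF assms(1) bounded_linear_inner_left]) (use Suc.prems in simp)
    moreover have "C_k_on k (\<lambda>x. frechet_derivative f (at (g x)) b) S" for b
      by (rule Suc.IH[OF gk]) (use Suc.prems in simp)
    ultimately show "C_k_on k (\<lambda>x. ?f' x v) S"
      by (intro C_k_on_sum[OF assms(1)] C_k_on_bilinear[OF assms(1) bounded_bilinear_scaleR])
  qed (rule assms)
qed

lemma C_k_on_real_SucI: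
  fixes f :: "real \<Rightarrow> real"
  assumes "open S" "\<And>x. x \<in> S \<Longrightarrow> (f has_real_derivative f' x) (at x)" "C_k_on k f' S"
  shows "C_k_on (Suc k) f S"
  by (rule C_k_on_SucI[where f' = "\<lambda>x v. f' x * v"])
    (use assms in \<open>auto simp: has_field_derivative_def intro: C_k_on_bounded_linear_compose[OF _ bounded_linear_mult_left]\<close>)

lemma smooth_on_imp_continuous_on: "smooth_on S f \<Longrightarrow> continuous_on S f"
  unfolding smooth_on_def using C_k_on.simps(1) by blast

lemma smooth_on_has_derivative:
  assumes "smooth_on S f" "x \<in> S"
  shows "(f has_derivative frechet_derivative f (at x)) (at x)"
  using assms C_k_on_has_derivative[of 0] unfolding smooth_on_def by blast

lemma smooth_on_frechet_derivative:
  "smooth_on S f \<Longrightarrow> smooth_on S (\<lambda>x. frechet_derivative f (at x) v)"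
  unfolding smooth_on_def using C_k_on.simps(2) by blast

lemma smooth_on_const: "open S \<Longrightarrow> smooth_on S (\<lambda>x. c)"
  by (simp add: smooth_on_def C_k_on_const)

lemma smooth_on_bounded_linear: "open S \<Longrightarrow> bounded_linear f \<Longrightarrow> smooth_on S f"
  by (simp add: smooth_on_def C_k_on_bounded_linear)

lemma smooth_on_ident: "open S \<Longrightarrow> smooth_on S (\<lambda>x. x)"
  by (simp add: smooth_on_bounded_linear)

lemma smooth_on_bounded_linear_compose:
  "open S \<Longrightarrow> bounded_linear L \<Longrightarrow> smooth_on S f \<Longrightarrow> smooth_on S (\<lambda>x. L (f x))"
  by (simp add: smooth_on_def C_k_on_bounded_linear_compose)

lemma smooth_on_bilinear:
  "open S \<Longrightarrow> bounded_bilinear prd \<Longrightarrow> smooth_on S f \<Longrightarrow> smooth_on S g \<Longrightarrow>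
    smooth_on S (\<lambda>x. prd (f x) (g x))"
  by (simp add: smooth_on_def C_k_on_bilinear)

lemma smooth_on_add:
  "open S \<Longrightarrow> smooth_on S f \<Longrightarrow> smooth_on S g \<Longrightarrow> smooth_on S (\<lambda>x. f x + g x)"
  by (simp add: smooth_on_def C_k_on_add)

lemma smooth_on_sum:
  "open S \<Longrightarrow> (\<And>i. i \<in> I \<Longrightarrow> smooth_on S (f i)) \<Longrightarrow> smooth_on S (\<lambda>x. \<Sum>i\<in>I. f i x)"
  by (simp add: smooth_on_def C_k_on_sum)

lemma smooth_on_compose:
  fixes g :: "'a::real_normed_vector \<Rightarrow> 'b::euclidean_space"
  shows "open S \<Longrightarrow> open T \<Longrightarrow> smooth_on S g \<Longrightarrow> smooth_on T f \<Longrightarrow> g ` S \<subseteq> T \<Longrightarrow>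
    smooth_on S (\<lambda>x. f (g x))"
  unfolding smooth_on_def using C_k_on_compose by blast

lemma smooth_on_minus: "open S \<Longrightarrow> smooth_on S f \<Longrightarrow> smooth_on S (\<lambda>x. - f x)"
  by (rule smooth_on_bounded_linear_compose[OF _ bounded_linear_minus[OF bounded_linear_ident]])

lemma smooth_on_diff:
  "open S \<Longrightarrow> smooth_on S f \<Longrightarrow> smooth_on S g \<Longrightarrow> smooth_on S (\<lambda>x. f x - g x)"
  using smooth_on_add[of S f "\<lambda>x. - g x"] by (simp add: smooth_on_minus)

lemmas smooth_on_scaleR = smooth_on_bilinear[OF _ bounded_bilinear_scaleR]
lemmas smooth_on_inner = smooth_on_bilinear[OF _ bounded_bilinear_inner]
lemmas smooth_on_fst = smooth_on_bounded_linear_compose[OF _ bounded_linear_fst]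
lemmas smooth_on_snd = smooth_on_bounded_linear_compose[OF _ bounded_linear_snd]

lemma smooth_on_mult:
  fixes f g :: "'a::real_normed_vector \<Rightarrow> real"
  shows "open S \<Longrightarrow> smooth_on S f \<Longrightarrow> smooth_on S g \<Longrightarrow> smooth_on S (\<lambda>x. f x * g x)"
  by (rule smooth_on_bilinear[OF _ bounded_bilinear_mult])

lemma smooth_on_power:
  fixes f :: "'a::real_normed_vector \<Rightarrow> real"
  shows "open S \<Longrightarrow> smooth_on S f \<Longrightarrow> smooth_on S (\<lambda>x. f x ^ n)"
  by (induction n) (auto intro: smooth_on_const smooth_on_mult)

lemma smooth_on_Pair:
  assumes "open S" "smooth_on S f" "smooth_on S g"
  shows "smooth_on S (\<lambda>x. (f x, g x))"
proof -
  have "bounded_linear (\<lambda>x::'b. (x, 0::'c))" "bounded_linear (\<lambda>x::'c. (0::'b, x))"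
    by (auto intro!: bounded_linear_Pair bounded_linear_ident bounded_linear_zero)
  from this[THEN smooth_on_bounded_linear_compose[OF assms(1)]] assms
  have "smooth_on S (\<lambda>x. (f x, 0) + (0, g x))"
    by (intro smooth_on_add) auto
  then show ?thesis by simp
qed

lemma smooth_on_exp_real: "smooth_on UNIV (exp :: real \<Rightarrow> real)"
proof -
  have "C_k_on k (exp :: real \<Rightarrow> real) UNIV" for k
  proof (induction k)
    case (Suc k)
    then show ?case
      by (rule C_k_on_real_SucI[rotated 2]) (auto intro: DERIV_exp)
  qed (auto intro: continuous_intros)
  then show ?thesis by (simp add: smooth_on_def)
qed

text \<open>The derivative is a polynomial in the function itself, so differentiability passes from
  each order to the next. The same pattern serves \<open>exp\<close> and
  \<open>tanh\<close>.\<close>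

lemma smooth_on_inverse_real: "smooth_on (- {0}) (inverse :: real \<Rightarrow> real)"
proof -
  have op: "open (- {0::real})" by auto
  have "C_k_on k (inverse :: real \<Rightarrow> real) (- {0})" for k
  proof (induction k)
    case (Suc k)
    have "C_k_on k (\<lambda>x::real. - (inverse x * inverse x)) (- {0})"
      by (intro C_k_on_bounded_linear_compose[OF op bounded_linear_minus[OF bounded_linear_ident]]
          C_k_on_bilinear[OF op bounded_bilinear_mult] Suc)
    then show ?case
      by (rule C_k_on_real_SucI[OF op, rotated]) (auto intro!: derivative_eq_intros simp: field_simps power2_eq_square)
  qed (auto intro!: continuous_intros)
  then show ?thesis by (simp add: smooth_on_def)
qed

lemma smooth_on_ln_real: "smooth_on {0<..} (ln :: real \<Rightarrow> real)"
proof -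
  have "C_k_on k (ln :: real \<Rightarrow> real) {0<..}" for k
  proof (cases k)
    case (Suc j)
    have "C_k_on j (inverse :: real \<Rightarrow> real) {0<..}"
      using smooth_on_inverse_real by (auto simp: smooth_on_def intro: C_k_on_subset)
    then show ?thesis unfolding Suc
      by (rule C_k_on_real_SucI[rotated 2]) (auto intro!: derivative_eq_intros simp: field_simps)
  qed (auto intro!: continuous_intros)
  then show ?thesis by (simp add: smooth_on_def)
qed

lemma smooth_on_exp: "open S \<Longrightarrow> smooth_on S f \<Longrightarrow> smooth_on S (\<lambda>x. exp (f x :: real))"
  by (rule smooth_on_compose[OF _ open_UNIV _ smooth_on_exp_real]) auto

lemma smooth_on_ln:
  "open S \<Longrightarrow> smooth_on S f \<Longrightarrow> (\<And>x. x \<in> S \<Longrightarrow> f x > 0) \<Longrightarrow> smooth_on S (\<lambda>x. ln (f x :: real))"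
  by (rule smooth_on_compose[OF _ open_greaterThan _ smooth_on_ln_real]) auto

lemma smooth_on_divide:
  fixes f g :: "'a::real_normed_vector \<Rightarrow> real"
  assumes "open S" "smooth_on S f" "smooth_on S g" "\<And>x. x \<in> S \<Longrightarrow> g x \<noteq> 0"
  shows "smooth_on S (\<lambda>x. f x / g x)"
  unfolding divide_inverse
  by (intro smooth_on_mult assms smooth_on_compose[OF assms(1) _ _ smooth_on_inverse_real, of g])
    (use assms in auto)

lemma smooth_on_tanh_real: "smooth_on UNIV (tanh :: real \<Rightarrow> real)"
proof -
  have "C_k_on k (tanh :: real \<Rightarrow> real) UNIV" for k
  proof (induction k)
    case (Suc k)
    have "C_k_on k (\<lambda>x::real. 1 + - (tanh x * tanh x)) UNIV"
      by (intro C_k_on_add C_k_on_const open_UNIV C_k_on_bounded_linear_compose[OF _ bounded_linear_minus[OF bounded_linear_ident]]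
          C_k_on_bilinear[OF _ bounded_bilinear_mult] Suc)
    then show ?case
      by (rule C_k_on_real_SucI[rotated 2]) (auto intro!: derivative_eq_intros simp: power2_eq_square)
  qed (auto intro!: continuous_intros)
  then show ?thesis by (simp add: smooth_on_def)
qed

lemma smooth_on_tanh: "open S \<Longrightarrow> smooth_on S f \<Longrightarrow> smooth_on S (\<lambda>x. tanh (f x :: real))"
  by (rule smooth_on_compose[OF _ open_UNIV _ smooth_on_tanh_real]) auto

lemmas smooth_intros = smooth_on_const smooth_on_ident smooth_on_add smooth_on_diff smooth_on_minus
  smooth_on_scaleR smooth_on_inner smooth_on_fst smooth_on_snd smooth_on_mult smooth_on_power
  smooth_on_Pair smooth_on_exp smooth_on_ln smooth_on_divide smooth_on_tanh smooth_on_sum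
  smooth_on_frechet_derivative

section \<open>Determinants and change of variables on Euclidean spaces\<close>

text \<open>The Leibniz sum over an arbitrary index set, so that a determinant over the basis of a
  product space can be reindexed and split along \<open>insert\<close>.\<close>

definition det_on :: "'b set \<Rightarrow> ('b \<Rightarrow> 'b \<Rightarrow> real) \<Rightarrow> real" where
  "det_on S h = (\<Sum>\<pi> | \<pi> permutes S. of_int (sign \<pi>) * (\<Prod>i\<in>S. h i (\<pi> i)))"

lemma det_Basis_eq_det_on: "det_Basis h = det_on Basis h"
  by (simp add: det_Basis_def det_on_def)

lemma det_on_image:
  assumes inj: "inj_on f A" and fin: "finite A"
  shows "det_on (f ` A) h = det_on A (\<lambda>i j. h (f i) (f j))"
proof -
  let ?B = "f ` A"
  have bij: "bij_betw f A ?B"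
    using inj by (simp add: bij_betw_def)
  let ?T = "\<lambda>\<pi> x. if x \<in> ?B then f (\<pi> (inv_into A f x)) else x"
  have T: "?T p = map_permutation A f p" for p
    by (auto simp: map_permutation_def restrict_id_def fun_eq_iff)
  have "det_on ?B h = (\<Sum>p | p permutes A. of_int (sign (?T p)) * (\<Prod>i\<in>?B. h i (?T p i)))"
    unfolding det_on_def by (rule sum.reindex_bij_betw[OF bij_betw_permutations[OF bij], symmetric])
  also have "\<dots> = (\<Sum>p | p permutes A. of_int (sign p) * (\<Prod>i\<in>A. h (f i) (f (p i))))"
  proof (rule sum.cong)
    fix p assume "p \<in> {p. p permutes A}"
    then have p: "p permutes A" by simp
    have "sign (?T p) = sign p"
      unfolding T sign_def using evenperm_map_permutation[OF inj p fin] by simp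
    moreover have "(\<Prod>i\<in>?B. h i (?T p i)) = (\<Prod>i\<in>A. h (f i) (?T p (f i)))"
      by (simp add: prod.reindex[OF inj])
    moreover have "?T p (f i) = f (p i)" if "i \<in> A" for i
      using that inj by simp
    ultimately show "of_int (sign (?T p)) * (\<Prod>i\<in>?B. h i (?T p i)) =
        of_int (sign p) * (\<Prod>i\<in>A. h (f i) (f (p i)))"
      by simp
  qed simp
  finally show ?thesis
    unfolding det_on_def .
qed

text \<open>A permutation of \<open>insert a S\<close> is a transposition of \<open>a\<close> with
  some \<open>b\<close> composed with a permutation of \<open>S\<close>. If
  \<open>b \<noteq> a\<close>, its product contains the factor \<open>h a b = 0\<close>.\<close>

lemma det_on_insert:
  assumes "finite S" "a \<notin> S" "\<And>i. i \<in> S \<Longrightarrow> h a i = 0"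
  shows "det_on (insert a S) h = h a a * det_on S h"
proof -
  let ?F = "\<lambda>p. of_int (sign p) * (\<Prod>i\<in>insert a S. h i (p i))"
  have zero: "?F (Transposition.transpose a b \<circ> q) = 0" if "b \<in> S" "q permutes S" for b q
  proof -
    have "(Transposition.transpose a b \<circ> q) a = b"
      using that assms(2) by (simp add: permutes_not_in)
    then show ?thesis
      using assms that by simp
  qed
  have "det_on (insert a S) h = (\<Sum>b\<in>insert a S. \<Sum>q | q permutes S. ?F (Transposition.transpose a b \<circ> q))"
    unfolding det_on_def by (rule sum_over_permutations_insert[OF assms(1,2)])
  also have "\<dots> = (\<Sum>q | q permutes S. ?F q)"
    using assms(1,2) zero by (simp add: sum.neutral)
  also have "\<dots> = (\<Sum>q | q permutes S. h a a * (of_int (sign q) * (\<Prod>i\<in>S. h i (q i))))"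
    using assms(1,2) by (intro sum.cong) (auto simp: permutes_not_in)
  finally show ?thesis
    by (simp add: det_on_def sum_distrib_left)
qed

lemma det_Basis_prod_real:
  fixes h :: "'a::euclidean_space \<times> real \<Rightarrow> 'a \<times> real \<Rightarrow> real"
  assumes "\<And>b. b \<in> Basis \<Longrightarrow> h (0, 1) (b, 0) = 0"
  shows "det_Basis h = h (0, 1) (0, 1) * det_Basis (\<lambda>b c. h (b, 0) (c, 0))"
proof -
  let ?f = "\<lambda>u::'a. (u, 0::real)"
  have B: "(Basis :: ('a \<times> real) set) = insert (0, 1) (?f ` Basis)"
    by (auto simp: Basis_prod_def)
  have "inj_on ?f Basis" by (auto simp: inj_on_def)
  moreover have "(0, 1) \<notin> ?f ` Basis" by auto
  ultimately show ?thesis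
    unfolding det_Basis_eq_det_on B using assms
    by (subst det_on_insert) (auto simp: det_on_image)
qed

text \<open>The library has determinants and the change of variables formula for \<open>real ^ 'n\<close> only.
  The standard basis of a Euclidean space, turned into a type, makes them available for it.\<close>

typedef (overloaded) 'a basis_index = "Basis :: 'a::euclidean_space set"
  by (simp add: ex_in_conv)

lemma range_Rep_basis_index: "range (Rep_basis_index :: 'a::euclidean_space basis_index \<Rightarrow> 'a) = Basis"
  by (rule type_definition.Rep_range[OF type_definition_basis_index])

lemma inj_Rep_basis_index: "inj (Rep_basis_index :: 'a::euclidean_space basis_index \<Rightarrow> 'a)"
  by (simp add: inj_on_def Rep_basis_index_inject)

instance basis_index :: (euclidean_space) finite
proof
  show "finite (UNIV :: 'a basis_index set)"
    by (rule finite_imageD[OF _ inj_Rep_basis_index]) (simp add: range_Rep_basis_index)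
qed

text \<open>The order on the index type is arbitrary; it only supplies the sort that the change of
  variables theorem for \<open>real ^ 'n\<close> asks of its index type.\<close>

definition basis_index_code :: "'a::euclidean_space basis_index \<Rightarrow> nat" where
  "basis_index_code = (SOME f. inj f)"

lemma inj_basis_index_code: "inj (basis_index_code :: 'a::euclidean_space basis_index \<Rightarrow> nat)"
proof -
  have "\<exists>f :: 'a basis_index \<Rightarrow> nat. inj f"
    using finite_imp_inj_to_nat_seg[of "UNIV :: 'a basis_index set"] by auto
  then show ?thesis
    unfolding basis_index_code_def by (rule someI_ex)
qed

instantiation basis_index :: (euclidean_space) wellorder
begin

definition less_eq_basis_index :: "'a basis_index \<Rightarrow> 'a basis_index \<Rightarrow> bool" where
  "less_eq_basis_index i j \<longleftrightarrow> basis_index_code i \<le> basis_index_code j"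

definition less_basis_index :: "'a basis_index \<Rightarrow> 'a basis_index \<Rightarrow> bool" where
  "less_basis_index i j \<longleftrightarrow> basis_index_code i < basis_index_code j"

instance
proof
  fix P :: "'a basis_index \<Rightarrow> bool" and i
  assume *: "\<And>i. (\<And>j. j < i \<Longrightarrow> P j) \<Longrightarrow> P i"
  show "P i"
    by (induction i rule: measure_induct_rule[of basis_index_code])
      (use * in \<open>auto simp: less_basis_index_def\<close>)
qed (auto simp: less_eq_basis_index_def less_basis_index_def dest: injD[OF inj_basis_index_code])

end

lemma det_Basis_eq_det:
  fixes h :: "'a::euclidean_space \<Rightarrow> 'a \<Rightarrow> real"
  shows "det_Basis h = det (\<chi> i j. h (Rep_basis_index i) (Rep_basis_index j))"
proof -
  have "det_Basis h = det_on (Rep_basis_index ` (UNIV :: 'a basis_index set)) h"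
    by (simp add: det_Basis_eq_det_on range_Rep_basis_index)
  also have "\<dots> = det_on UNIV (\<lambda>i j :: 'a basis_index. h (Rep_basis_index i) (Rep_basis_index j))"
    by (rule det_on_image) (simp_all add: inj_Rep_basis_index)
  finally show ?thesis
    by (simp add: det_def det_on_def)
qed

section \<open>Determinants of endomorphisms of a Euclidean space\<close>

definition det_lin :: "('a::euclidean_space \<Rightarrow> 'a) \<Rightarrow> real" where
  "det_lin f = det_Basis (\<lambda>i j. f j \<bullet> i)"

lemma sum_basis_index: "(\<Sum>k\<in>UNIV. F (Rep_basis_index k)) = (\<Sum>b\<in>(Basis::'a::euclidean_space set). F b)"
  by (simp add: sum.reindex[OF inj_Rep_basis_index, symmetric, unfolded o_def] range_Rep_basis_index)

lemma det_lin_compose: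
  fixes f g :: "'a::euclidean_space \<Rightarrow> 'a"
  assumes "linear f"
  shows "det_lin (\<lambda>x. f (g x)) = det_lin f * det_lin g"
proof -
  let ?M = "\<lambda>f::'a\<Rightarrow>'a. \<chi> i j. f (Rep_basis_index j) \<bullet> Rep_basis_index i"
  have fw: "f w \<bullet> i = (\<Sum>k\<in>UNIV. (f (Rep_basis_index k) \<bullet> i) * (w \<bullet> Rep_basis_index k))" for w i
    using sum_basis_index[of "\<lambda>b. (f b \<bullet> i) * (w \<bullet> b)"]
    by (subst linear_Basis_expansion[OF assms]) (simp add: inner_sum_left mult.commute)
  have "?M (\<lambda>x. f (g x)) = ?M f ** ?M g"
    by (simp add: vec_eq_iff matrix_matrix_mult_def) (intro allI fw)
  then show ?thesis
    by (simp add: det_lin_def det_Basis_eq_det det_mul)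
qed

text \<open>The Gram matrix is the transposed matrix of \<open>f\<close> times the matrix of
  \<open>f\<close>. This is how determinants of metrics become squares of
  \<open>det_lin\<close>.\<close>

lemma det_Basis_Gram:
  fixes f :: "'a::euclidean_space \<Rightarrow> 'a"
  shows "det_Basis (\<lambda>i j. f i \<bullet> f j) = (det_lin f)\<^sup>2"
proof -
  let ?M = "\<chi> i j. f (Rep_basis_index j) \<bullet> Rep_basis_index i"
  have "f i \<bullet> f j = (\<Sum>k\<in>UNIV. (f i \<bullet> Rep_basis_index k) * (f j \<bullet> Rep_basis_index k))" for i j
    using sum_basis_index[of "\<lambda>b. (f i \<bullet> b) * (f j \<bullet> b)"] euclidean_inner[of "f i" "f j"] by simp
  then have "(\<chi> i j. f (Rep_basis_index i) \<bullet> f (Rep_basis_index j)) = transpose ?M ** ?M"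
    by (simp add: vec_eq_iff matrix_matrix_mult_def transpose_def)
  then show ?thesis
    by (simp add: det_lin_def det_Basis_eq_det det_mul power2_eq_square)
qed

lemma det_lin_diag:
  fixes c :: "'a::euclidean_space \<Rightarrow> real"
  assumes "\<And>b. b \<in> Basis \<Longrightarrow> f b = c b *\<^sub>R b"
  shows "det_lin f = (\<Prod>b\<in>Basis. c b)"
proof -
  have R: "Rep_basis_index i \<in> (Basis :: 'a set)" for i
    using Rep_basis_index by blast
  have "det_lin f = (\<Prod>i\<in>UNIV. c (Rep_basis_index i))"
    unfolding det_lin_def det_Basis_eq_det
    by (subst det_diagonal)
      (auto simp: assms R inner_Basis Rep_basis_index_inject)
  also have "\<dots> = (\<Prod>b\<in>Basis. c b)"
    by (simp add: prod.reindex[OF inj_Rep_basis_index, symmetric, unfolded o_def] range_Rep_basis_index)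
  finally show ?thesis .
qed

lemma det_lin_ident: "det_lin (\<lambda>x. x) = 1"
  by (subst det_lin_diag[where c = "\<lambda>_. 1"]) auto

text \<open>By polarization both maps have the same Gram matrix, whose determinant is the square of
  either \<open>det_lin\<close>.\<close>

lemma abs_det_lin_norm_eq:
  assumes "linear f" "linear g" "\<And>u. norm (f u) = norm (g u)"
  shows "\<bar>det_lin f\<bar> = \<bar>det_lin g\<bar>"
proof -
  have "f u \<bullet> f v = g u \<bullet> g v" for u v
    using assms(3)[of "u + v"] assms(3)[of u] assms(3)[of v]
    by (simp add: dot_norm linear_add[OF assms(1)] linear_add[OF assms(2)])
  then have "(det_lin f)\<^sup>2 = (det_lin g)\<^sup>2"
    unfolding det_Basis_Gram[symmetric] by simp
  then show ?thesis
    by (simp add: power2_eq_iff abs_eq_iff)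
qed

text \<open>Conjugation by \<open>S\<close> replaces \<open>L + N\<close> by \<open>L - N\<close>, and
  \<open>(L + N) \<circ> K \<circ> (L - N) = L\<close>.\<close>

lemma abs_det_lin_triangular:
  assumes lin: "linear S" "linear L" "linear N" "linear K"
    and S: "\<And>u. S (S u) = u" "\<And>u. S (L (S u)) = L u" "\<And>u. S (N (S u)) = - N u"
    and K: "\<And>u. K (L u) = u" "\<And>u. L (K u) = u" and N: "\<And>u. N (K (N u)) = 0"
  shows "\<bar>det_lin (\<lambda>u. L u + N u)\<bar> = \<bar>det_lin L\<bar>"
proof -
  let ?A = "\<lambda>u. L u + N u" and ?B = "\<lambda>u. L u - N u"
  have A: "linear ?A" and B: "linear ?B"
    using lin by (auto intro: linear_compose_add linear_compose_sub)
  have SS: "det_lin S * det_lin S = 1"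
    using det_lin_compose[OF lin(1), of S] by (simp add: S det_lin_ident)
  have "?B = (\<lambda>u. S (?A (S u)))"
    by (simp add: fun_eq_iff linear_add[OF lin(1)] S)
  then have "det_lin ?B = det_lin S * (det_lin ?A * det_lin S)"
    using det_lin_compose[OF lin(1), of "\<lambda>u. ?A (S u)"] det_lin_compose[OF A, of S] by simp
  then have BA: "det_lin ?B = det_lin ?A"
    using SS by (metis mult.assoc mult.commute mult_1)
  have "(\<lambda>u. ?A (K (?B u))) = L"
    by (simp add: fun_eq_iff linear_diff[OF lin(4)] linear_diff[OF lin(2)] linear_diff[OF lin(3)] K N)
  then have "det_lin ?A * (det_lin K * det_lin ?B) = det_lin L"
    using det_lin_compose[OF A, of "\<lambda>u. K (?B u)"] det_lin_compose[OF lin(4), of ?B] by simp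
  moreover have "det_lin L * det_lin K = 1"
    using det_lin_compose[OF lin(2), of K] by (simp add: K det_lin_ident)
  ultimately have "(det_lin ?A)\<^sup>2 = (det_lin L)\<^sup>2"
    unfolding BA power2_eq_square by (metis mult.assoc mult.commute mult_1)
  then show ?thesis
    by (simp add: power2_eq_iff abs_eq_iff)
qed

lemma continuous_on_det_Basis:
  assumes "\<And>i j. i \<in> Basis \<Longrightarrow> j \<in> Basis \<Longrightarrow> continuous_on S (\<lambda>x. h x i j)"
  shows "continuous_on S (\<lambda>x. det_Basis (h x))"
  unfolding det_Basis_def
  by (intro continuous_intros assms) (auto simp: permutes_in_image)

lemma continuous_on_det_lin:
  assumes "\<And>b. b \<in> Basis \<Longrightarrow> continuous_on S (\<lambda>x. f x b)"
  shows "continuous_on S (\<lambda>x. det_lin (f x))"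
  unfolding det_lin_def by (intro continuous_on_det_Basis continuous_intros assms)

section \<open>Lebesgue measure and change of variables on Euclidean spaces\<close>

definition to_vec :: "'a::euclidean_space \<Rightarrow> real ^ 'a basis_index" where
  "to_vec x = (\<chi> i. x \<bullet> Rep_basis_index i)"

definition from_vec :: "real ^ 'a basis_index \<Rightarrow> 'a::euclidean_space" where
  "from_vec v = (\<Sum>i\<in>UNIV. v $ i *\<^sub>R Rep_basis_index i)"

lemma inner_Rep_basis_index:
  "Rep_basis_index i \<bullet> (Rep_basis_index j :: 'a::euclidean_space) = (if i = j then 1 else 0)"
  using Rep_basis_index[of i] Rep_basis_index[of j] by (simp add: inner_Basis Rep_basis_index_inject)

lemma to_vec_from_vec [simp]: "to_vec (from_vec v) = v"
  by (simp add: to_vec_def from_vec_def vec_eq_iff inner_sum_left inner_Rep_basis_index if_distrib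
      cong: if_cong)

lemma from_vec_to_vec [simp]: "from_vec (to_vec x) = x"
  by (simp add: to_vec_def from_vec_def sum_basis_index[where F = "\<lambda>b. (x \<bullet> b) *\<^sub>R b"]
      euclidean_representation)

lemma bounded_linear_to_vec: "bounded_linear to_vec"
  unfolding to_vec_def
  by (rule linear_conv_bounded_linear[THEN iffD1], rule linearI)
    (simp_all add: vec_eq_iff inner_add_left)

lemma bounded_linear_from_vec: "bounded_linear (from_vec :: real ^ 'a basis_index \<Rightarrow> 'a::euclidean_space)"
  unfolding from_vec_def
  by (rule linear_conv_bounded_linear[THEN iffD1], rule linearI)
    (simp_all add: scaleR_add_left sum.distrib scaleR_sum_right)

lemma measurable_to_vec [measurable]: "to_vec \<in> borel_measurable borel"
  by (intro borel_measurable_continuous_onI linear_continuous_on bounded_linear_to_vec)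

lemma measurable_from_vec [measurable]: "from_vec \<in> borel_measurable borel"
  by (intro borel_measurable_continuous_onI linear_continuous_on bounded_linear_from_vec)

text \<open>Coordinates carry boxes to boxes of the same volume, and boxes determine Lebesgue
  measure.\<close>

lemma distr_to_vec: "distr lborel borel (to_vec :: 'a::euclidean_space \<Rightarrow> _) = lborel"
proof (rule lborel_eqI[symmetric])
  fix l u :: "real ^ 'a basis_index"
  assume le: "\<And>b. b \<in> Basis \<Longrightarrow> l \<bullet> b \<le> u \<bullet> b"
  have le': "l $ i \<le> u $ i" for i
    using le[of "axis i 1"] by (simp add: axis_in_Basis_iff inner_axis)
  have comp: "from_vec v \<bullet> Rep_basis_index i = v $ i" for v :: "real ^ 'a basis_index" and i
    using to_vec_from_vec[of v] by (simp add: to_vec_def vec_eq_iff)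
  have ball: "(\<forall>b\<in>Basis. P b) \<longleftrightarrow> (\<forall>i. P (Rep_basis_index i))" for P :: "'a \<Rightarrow> bool"
    by (simp add: range_Rep_basis_index[symmetric])
  have "to_vec -` box l u = box (from_vec l) (from_vec u :: 'a)"
    by (auto simp: mem_box_cart mem_box ball comp) (auto simp: to_vec_def)
  moreover have "\<And>b. b \<in> Basis \<Longrightarrow> from_vec l \<bullet> b \<le> (from_vec u :: 'a) \<bullet> b"
    using le' ball[of "\<lambda>b. from_vec l \<bullet> b \<le> from_vec u \<bullet> b"] comp by simp
  ultimately have "emeasure (distr lborel borel to_vec) (box l u) = ennreal (\<Prod>b\<in>(Basis::'a set). (from_vec u - from_vec l) \<bullet> b)"
    by (simp add: emeasure_distr)
  also have "(\<Prod>b\<in>(Basis::'a set). (from_vec u - from_vec l) \<bullet> b) = (\<Prod>i\<in>UNIV. (u - l) $ i)"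
    unfolding range_Rep_basis_index[symmetric]
    by (simp add: prod.reindex[OF inj_Rep_basis_index] inner_diff_left comp)
  also have "\<dots> = (\<Prod>b\<in>Basis. (u - l) \<bullet> b)"
    by (simp add: Basis_vec_def UNION_singleton_eq_range prod.reindex inj_on_def axis_eq_axis inner_axis)
  finally show "emeasure (distr lborel borel (to_vec :: 'a \<Rightarrow> _)) (box l u) = ennreal (\<Prod>b\<in>Basis. (u - l) \<bullet> b)" .
qed simp

text \<open>Transport along \<open>to_vec\<close> of the area formula for injective differentiable
  maps on \<open>real ^ 'n\<close>. That formula concerns the real-valued \<open>measure\<close>;
  hence the finiteness of the image.\<close>

lemma emeasure_image_eq_nn_integral_finite:
  fixes g :: "'a::euclidean_space \<Rightarrow> 'a"
  assumes S: "S \<in> sets borel" and gS: "g ` S \<in> sets borel"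
    and g: "\<And>x. x \<in> S \<Longrightarrow> (g has_derivative g' x) (at x within S)"
    and inj: "inj_on g S" and fin: "emeasure lborel (g ` S) < \<infinity>"
    and meas: "(\<lambda>x. ennreal \<bar>det_lin (g' x)\<bar> * indicator S x) \<in> borel_measurable borel"
  shows "emeasure lborel (g ` S) = (\<integral>\<^sup>+x\<in>S. ennreal \<bar>det_lin (g' x)\<bar> \<partial>lborel)"
proof -
  define S' where "S' = to_vec ` S"
  define G where "G = to_vec \<circ> g \<circ> (from_vec :: _ \<Rightarrow> 'a)"
  define G' where "G' v = to_vec \<circ> g' (from_vec v) \<circ> (from_vec :: _ \<Rightarrow> 'a)" for v
  have img: "to_vec ` A = from_vec -` A" for A :: "'a set"
    by (auto simp: image_iff) (metis to_vec_from_vec)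
  have vol: "to_vec ` A \<in> sets borel" "emeasure lborel (to_vec ` A) = emeasure lborel A"
    if A: "A \<in> sets borel" for A :: "'a set"
  proof -
    show m: "to_vec ` A \<in> sets borel"
      unfolding img using measurable_sets[OF measurable_from_vec A] by simp
    have "to_vec -` (to_vec ` A) = A"
      by (auto simp: image_iff) (metis from_vec_to_vec)
    with m show "emeasure lborel (to_vec ` A) = emeasure lborel A"
      by (subst distr_to_vec[symmetric]) (simp add: emeasure_distr)
  qed
  have S'b: "S' \<in> sets borel"
    unfolding S'_def by (rule vol(1)[OF S])
  have GS': "G ` S' = to_vec ` (g ` S)"
    by (simp add: G_def S'_def image_image)
  have der: "(G has_derivative G' v) (at v within S')" if v: "v \<in> S'" for v
  proof -
    have fS: "from_vec ` S' = S"
      by (simp add: S'_def image_image)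
    then have "from_vec v \<in> S" using v by blast
    then have "(g has_derivative g' (from_vec v)) (at (from_vec v) within from_vec ` S')"
      using g fS by simp
    then show ?thesis unfolding G_def G'_def
      by (intro diff_chain_within bounded_linear_imp_has_derivative
          bounded_linear_from_vec bounded_linear_to_vec) auto
  qed
  have injG: "inj_on G S'"
    using inj by (auto simp: inj_on_def G_def S'_def) (metis from_vec_to_vec)
  have det: "det (matrix (G' v)) = det_lin (g' (from_vec v))" for v
  proof -
    have ax: "from_vec (axis j 1) = (Rep_basis_index j :: 'a)" for j
      by (simp add: from_vec_def axis_def if_distrib[where f = "\<lambda>c. c *\<^sub>R _"] cong: if_cong)
    show ?thesis
      unfolding det_lin_def det_Basis_eq_det matrix_def G'_def by (simp add: ax) (simp add: to_vec_def)
  qed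
  have GSb: "G ` S' \<in> sets borel" and em: "emeasure lborel (G ` S') = emeasure lborel (g ` S)"
    unfolding GS' using vol[OF gS] by auto
  have "G ` S' \<in> lmeasurable"
    using GSb em fin by (intro fmeasurableI) auto
  then have "((\<lambda>v. \<bar>det (matrix (G' v))\<bar>) has_integral measure lebesgue (G ` S')) S'"
    using has_measure_differentiable_image[OF _ der injG, of "measure lebesgue (G ` S')"] S'b by auto
  then have "(\<integral>\<^sup>+v. ennreal \<bar>det (matrix (G' v))\<bar> * indicator S' v \<partial>lborel) = ennreal (measure lebesgue (G ` S'))"
    by (rule nn_integral_has_integral_lebesgue'[rotated]) auto
  also have "\<dots> = emeasure lborel (g ` S)"
    using em fin GSb by (simp add: measure_def)
  also have "(\<integral>\<^sup>+v. ennreal \<bar>det (matrix (G' v))\<bar> * indicator S' v \<partial>lborel) =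
      (\<integral>\<^sup>+v. (\<lambda>x. ennreal \<bar>det_lin (g' x)\<bar> * indicator S x) (from_vec v) \<partial>distr lborel borel to_vec)"
    unfolding distr_to_vec S'_def img by (intro nn_integral_cong) (simp add: det indicator_def)
  also have "\<dots> = (\<integral>\<^sup>+x. ennreal \<bar>det_lin (g' x)\<bar> * indicator S x \<partial>lborel)"
    by (subst nn_integral_distr) (use meas in auto)
  finally show ?thesis by simp
qed

text \<open>The domain is exhausted by the sets where \<open>norm (g x) \<le> n\<close>. Truncating
  in the image makes the image measures finite, and monotone convergence removes the bound.\<close>

lemma emeasure_image_eq_nn_integral:
  fixes g :: "'a::euclidean_space \<Rightarrow> 'a"
  assumes S: "S \<in> sets borel" and gS: "\<And>A. A \<in> sets borel \<Longrightarrow> A \<subseteq> S \<Longrightarrow> g ` A \<in> sets borel"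
    and g: "\<And>x. x \<in> S \<Longrightarrow> (g has_derivative g' x) (at x within S)"
    and inj: "inj_on g S"
    and meas: "(\<lambda>x. ennreal \<bar>det_lin (g' x)\<bar> * indicator S x) \<in> borel_measurable borel"
  shows "emeasure lborel (g ` S) = (\<integral>\<^sup>+x\<in>S. ennreal \<bar>det_lin (g' x)\<bar> \<partial>lborel)"
proof -
  define T where "T n = {x\<in>S. norm (g x) \<le> real n}" for n
  have cont: "continuous_on S g"
    using g has_derivative_continuous continuous_on_eq_continuous_within by blast
  have T: "T n \<in> sets borel" "T n \<subseteq> S" for n
  proof -
    have "{x. norm x \<le> real n} \<in> sets (borel :: 'a measure)" by measurable
    then have "g -` {x. norm x \<le> real n} \<inter> S \<in> sets (restrict_space borel S)"
      using measurable_sets[OF borel_measurable_continuous_on_restrict[OF cont], of "{x. norm x \<le> real n}"]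
      by (simp add: space_restrict_space)
    moreover have "g -` {x. norm x \<le> real n} \<inter> S = T n"
      by (auto simp: T_def)
    ultimately show "T n \<in> sets borel"
      using S by (simp add: sets_restrict_space_iff)
  qed (auto simp: T_def)
  have U: "(\<Union>n. T n) = S"
    by (auto simp: T_def real_arch_simple)
  have incT: "incseq T"
    by (auto simp: incseq_def T_def)
  let ?h = "\<lambda>x. ennreal \<bar>det_lin (g' x)\<bar>"
  have ind: "?h x * indicator (T n) x = ?h x * indicator S x * indicator (T n) x" for x n
    using T(2)[of n] by (auto simp: indicator_def)
  have mT: "(\<lambda>x. ?h x * indicator (T n) x) \<in> borel_measurable borel" for n
    unfolding ind by (rule borel_measurable_times_ennreal[OF meas]) (use T(1)[of n] in auto)
  have e: "emeasure lborel (g ` T n) = (\<integral>\<^sup>+x\<in>T n. ?h x \<partial>lborel)" for n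
  proof (rule emeasure_image_eq_nn_integral_finite[OF T(1) gS[OF T]])
    show "(g has_derivative g' x) (at x within T n)" if "x \<in> T n" for x
      using that T(2) g has_derivative_subset by blast
    show "inj_on g (T n)" using inj T(2) inj_on_subset by blast
    have "g ` T n \<subseteq> cball 0 (real n)" by (auto simp: T_def)
    from emeasure_mono[OF this, of lborel] show "emeasure lborel (g ` T n) < \<infinity>"
      using emeasure_lborel_cball_finite[of "0::'a" "real n"] by (simp add: le_less_trans)
  qed (use mT in auto)
  have "emeasure lborel (g ` S) = (SUP n. emeasure lborel (g ` T n))"
    unfolding U[symmetric] image_UN
    by (rule SUP_emeasure_incseq[symmetric]) (use gS[OF T] incT in \<open>auto simp: incseq_def image_mono\<close>)
  also have "\<dots> = (SUP n. \<integral>\<^sup>+x\<in>T n. ?h x \<partial>lborel)"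
    by (simp add: e)
  also have "\<dots> = (\<integral>\<^sup>+x. (SUP n. ?h x * indicator (T n) x) \<partial>lborel)"
  proof (rule nn_integral_monotone_convergence_SUP[symmetric])
    show "incseq (\<lambda>n x. ?h x * indicator (T n) x)"
      using incT by (auto simp: incseq_def le_fun_def indicator_def)
  qed (use mT in auto)
  also have "\<dots> = (\<integral>\<^sup>+x\<in>S. ?h x \<partial>lborel)"
  proof (intro nn_integral_cong)
    fix x
    have "(SUP n. indicator (T n) x :: ennreal) = indicator S x"
    proof (rule antisym)
      show "(SUP n. indicator (T n) x :: ennreal) \<le> indicator S x"
        using T(2) by (intro SUP_least) (auto simp: indicator_def)
      show "indicator S x \<le> (SUP n. indicator (T n) x :: ennreal)"
      proof (cases "x \<in> S")
        case True
        then obtain n where "x \<in> T n" using U by blast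
        then show ?thesis
          by (intro SUP_upper2[of n]) (auto simp: indicator_def)
      qed simp
    qed
    then show "(SUP n. ?h x * indicator (T n) x) = ?h x * indicator S x"
      by (simp add: SUP_mult_left_ennreal[symmetric])
  qed
  finally show ?thesis .
qed

text \<open>By the area formula \<open>lborel\<close> is the image under \<open>g\<close> of the
  measure on \<open>S\<close> whose density is the absolute Jacobian. For signed functions,
  integrability and value then come from the rules for image measures and densities.\<close>

lemma lborel_integral_change_of_variables:
  fixes g :: "'a::euclidean_space \<Rightarrow> 'a" and k :: "'a \<Rightarrow> real"
  assumes S: "open S" and homeo: "homeomorphism S UNIV g f"
    and g: "\<And>x. x \<in> S \<Longrightarrow> (g has_derivative g' x) (at x)"
    and cont: "\<And>b. b \<in> Basis \<Longrightarrow> continuous_on S (\<lambda>x. g' x b)"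
    and k: "k \<in> borel_measurable borel"
  shows "integrable lborel k \<longleftrightarrow> integrable lborel (\<lambda>x. indicator S x *\<^sub>R (\<bar>det_lin (g' x)\<bar> * k (g x)))" (is ?I)
    and "(\<integral>x. k x \<partial>lborel) = (\<integral>x. indicator S x *\<^sub>R (\<bar>det_lin (g' x)\<bar> * k (g x)) \<partial>lborel)"
proof -
  have Sb: "S \<in> sets borel" using S by simp
  have cg: "continuous_on S g" and cf: "continuous_on UNIV f" and gf: "g ` S = UNIV" "\<And>x. x \<in> S \<Longrightarrow> f (g x) = x" "\<And>y. g (f y) = y" "\<And>y. f y \<in> S"
    using homeo by (auto simp: homeomorphism_def)
  have inj: "inj_on g S"
    by (rule inj_on_inverseI[of _ f]) (use gf in auto)
  have fm: "f \<in> borel_measurable borel"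
    by (rule borel_measurable_continuous_onI[OF cf])
  have cd: "continuous_on S (\<lambda>x. \<bar>det_lin (g' x)\<bar>)"
    by (intro continuous_on_rabs continuous_on_det_lin cont)
  define h where "h = (\<lambda>x. ennreal \<bar>det_lin (g' x)\<bar> * indicator S x)"
  have hm: "h \<in> borel_measurable borel"
  proof -
    have "(\<lambda>x. indicator S x *\<^sub>R \<bar>det_lin (g' x)\<bar>) \<in> borel_measurable borel"
      by (rule borel_measurable_continuous_on_indicator[OF Sb cd])
    then have "(\<lambda>x. ennreal (indicator S x *\<^sub>R \<bar>det_lin (g' x)\<bar>)) \<in> borel_measurable borel"
      by measurable
    then show ?thesis
      unfolding h_def by (rule subst[where P = "\<lambda>f. f \<in> _", rotated]) (auto simp: indicator_def)
  qed
  let ?N = "restrict_space lborel S"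
  let ?M = "density ?N (\<lambda>x. ennreal \<bar>det_lin (g' x)\<bar>)"
  have gm: "g \<in> measurable ?N borel"
    using borel_measurable_continuous_on_restrict[OF cg]
    by (simp add: measurable_def space_restrict_space sets_restrict_space)
  have dm: "(\<lambda>x. \<bar>det_lin (g' x)\<bar>) \<in> borel_measurable ?N"
    using borel_measurable_continuous_on_restrict[OF cd]
    by (simp add: measurable_def space_restrict_space sets_restrict_space)
  have lb: "lborel = distr ?M borel g"
  proof (rule measure_eqI)
    fix A :: "'a set" assume "A \<in> sets lborel"
    then have A: "A \<in> sets borel" by simp
    define T where "T = g -` A \<inter> S"
    have T: "T \<subseteq> S" "T \<in> sets borel"
      using measurable_sets[OF borel_measurable_continuous_on_restrict[OF cg] A] Sb
      by (auto simp: T_def space_restrict_space sets_restrict_space_iff)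
    have gT: "g ` T = A"
    proof (intro equalityI subsetI)
      fix y assume "y \<in> A"
      then show "y \<in> g ` T"
        by (intro image_eqI[of _ _ "f y"]) (use gf in \<open>auto simp: T_def\<close>)
    qed (auto simp: T_def)
    have img: "g ` B \<in> sets borel" if "B \<in> sets borel" "B \<subseteq> S" for B
    proof -
      have "g ` B = f -` B"
        using gf that(2) by (auto simp: image_iff) (metis)
      then show ?thesis using measurable_sets[OF fm that(1)] by simp
    qed
    have "emeasure lborel A = (\<integral>\<^sup>+x\<in>T. ennreal \<bar>det_lin (g' x)\<bar> \<partial>lborel)"
      unfolding gT[symmetric]
    proof (rule emeasure_image_eq_nn_integral[OF T(2)])
      show "inj_on g T" using inj T(1) inj_on_subset by blast
      have "(\<lambda>x. ennreal \<bar>det_lin (g' x)\<bar> * indicator T x) = (\<lambda>x. h x * indicator T x)"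
        using T(1) by (auto simp: h_def indicator_def fun_eq_iff)
      then show "(\<lambda>x. ennreal \<bar>det_lin (g' x)\<bar> * indicator T x) \<in> borel_measurable borel"
        using hm T(2) by simp
      show "g ` B \<in> sets borel" if "B \<in> sets borel" "B \<subseteq> T" for B
        using img[of B] that T(1) by blast
      show "(g has_derivative g' x) (at x within T)" if "x \<in> T" for x
        by (rule has_derivative_at_withinI, rule g) (use that T(1) in blast)
    qed
    also have "\<dots> = (\<integral>\<^sup>+x. ennreal \<bar>det_lin (g' x)\<bar> * indicator T x \<partial>?N)"
      using Sb T(1) by (subst nn_integral_restrict_space) (auto intro!: nn_integral_cong simp: indicator_def)
    also have "\<dots> = emeasure ?M T"
      using dm T Sb by (subst emeasure_density) (auto simp: sets_restrict_space_iff)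
    also have "\<dots> = emeasure (distr ?M borel g) A"
      using gm A by (subst emeasure_distr) (auto simp: T_def space_restrict_space)
    finally show "emeasure lborel A = emeasure (distr ?M borel g) A" .
  qed simp
  have km: "(\<lambda>x. k (g x)) \<in> borel_measurable ?N"
    using gm k by (rule measurable_compose)
  have "integrable lborel k \<longleftrightarrow> integrable ?M (\<lambda>x. k (g x))"
    by (subst lb, rule integrable_distr_eq) (use gm k in auto)
  also have "\<dots> \<longleftrightarrow> integrable ?N (\<lambda>x. \<bar>det_lin (g' x)\<bar> *\<^sub>R k (g x))"
    by (rule integrable_density) (use km dm in auto)
  also have "\<dots> \<longleftrightarrow> integrable lborel (\<lambda>x. indicator S x *\<^sub>R (\<bar>det_lin (g' x)\<bar> * k (g x)))"
    using Sb by (subst integrable_restrict_space) (auto simp: set_integrable_def)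
  finally show ?I .
  have "(\<integral>x. k x \<partial>lborel) = (\<integral>x. k (g x) \<partial>?M)"
    by (subst lb, rule integral_distr) (use gm k in auto)
  also have "\<dots> = (\<integral>x. \<bar>det_lin (g' x)\<bar> *\<^sub>R k (g x) \<partial>?N)"
    by (rule integral_density) (use km dm in auto)
  also have "\<dots> = (\<integral>x. indicator S x *\<^sub>R (\<bar>det_lin (g' x)\<bar> * k (g x)) \<partial>lborel)"
    using Sb by (subst integral_restrict_space) (auto simp: set_lebesgue_integral_def)
  finally show "(\<integral>x. k x \<partial>lborel) = (\<integral>x. indicator S x *\<^sub>R (\<bar>det_lin (g' x)\<bar> * k (g x)) \<partial>lborel)" .
qed

section \<open>Integrals depending on parameters\<close>

text \<open>Covers the measure on the unit sphere and Lebesgue measure on a ball, the two cases in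
  which an integral is differentiated in a parameter.\<close>

locale compact_finite_measure = finite_measure M for M :: "'z::euclidean_space measure" +
  assumes compact_space: "compact (space M)"
    and sets_eq_restrict: "sets M = sets (restrict_space borel (space M))"
begin

lemma borel_measurable_continuous:
  fixes f :: "'z \<Rightarrow> 'b::topological_space"
  assumes "continuous_on (space M) f"
  shows "f \<in> borel_measurable M"
  using borel_measurable_continuous_on_restrict[OF assms] sets_eq_restrict measurable_cong_sets by blast

lemma integrable_continuous:
  fixes f :: "'z \<Rightarrow> 'b::{banach, second_countable_topology}"
  assumes "continuous_on (space M) f"
  shows "integrable M f"
proof -
  have "compact (f ` space M)"
    by (rule compact_continuous_image[OF assms compact_space])
  then obtain B where "\<And>x. x \<in> space M \<Longrightarrow> norm (f x) \<le> B"
    using compact_imp_bounded bounded_iff by (metis imageI)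
  then show ?thesis
    by (intro integrable_const_bound[of _ B] borel_measurable_continuous[OF assms]) auto
qed

lemma norm_integral_le:
  fixes f :: "'z \<Rightarrow> real"
  assumes "continuous_on (space M) f" "\<And>z. z \<in> space M \<Longrightarrow> \<bar>f z\<bar> \<le> e"
  shows "\<bar>\<integral>z. f z \<partial>M\<bar> \<le> e * measure M (space M)"
proof -
  have "norm (\<integral>z. f z \<partial>M) \<le> (\<integral>z. norm (f z) \<partial>M)"
    by (rule integral_norm_bound)
  also have "\<dots> \<le> (\<integral>z. e \<partial>M)"
    using assms by (intro integral_mono integrable_norm integrable_continuous) auto
  finally show ?thesis by (simp add: mult.commute)
qed

lemma continuous_on_integral:
  fixes f :: "'p::topological_space \<Rightarrow> 'z \<Rightarrow> real"
  assumes "continuous_on (T \<times> space M) (\<lambda>(p, z). f p z)"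
  shows "continuous_on T (\<lambda>p. \<integral>z. f p z \<partial>M)"
  unfolding continuous_on_def
proof (intro ballI tendstoI)
  fix p0 and e :: real
  assume p0: "p0 \<in> T" and e: "e > 0"
  \<comment> \<open>The summand 1 keeps the quotient meaningful for a null measure.\<close>
  define e' where "e' = e / (measure M (space M) + 1)"
  have pos: "measure M (space M) + 1 > 0" by (simp add: add_nonneg_pos)
  then have e': "e' > 0" using e by (simp add: e'_def)
  have slice: "continuous_on (space M) (f p)" if "p \<in> T" for p
  proof -
    have "continuous_on (space M) (\<lambda>z. case (p, z) of (p, z) \<Rightarrow> f p z)"
      by (rule continuous_on_compose2[OF assms continuous_on_Pair[OF continuous_on_const continuous_on_id]])
        (use that in auto)
    then show ?thesis by simp
  qed
  obtain X0 where X0: "p0 \<in> X0" "open X0"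
    "\<forall>p\<in>X0 \<inter> T. \<forall>z\<in>space M. dist (f p z) (f p0 z) \<le> e'"
    using continuous_on_prod_compactE[OF assms compact_space p0 e'] by auto
  have "dist (\<integral>z. f p z \<partial>M) (\<integral>z. f p0 z \<partial>M) < e" if "p \<in> X0" "p \<in> T" for p
  proof -
    have "\<bar>\<integral>z. f p z - f p0 z \<partial>M\<bar> \<le> e' * measure M (space M)"
      using X0 that slice p0 by (intro norm_integral_le continuous_on_diff) (auto simp: dist_real_def)
    also have "\<dots> < e' * (measure M (space M) + 1)"
      using e' by simp
    also have "\<dots> = e"
      using pos by (simp add: e'_def)
    finally show ?thesis
      using slice that p0 by (simp add: dist_real_def integrable_continuous)
  qed
  then show "\<forall>\<^sub>F p in at p0 within T. dist (\<integral>z. f p z \<partial>M) (\<integral>z. f p0 z \<partial>M) < e"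
    using X0(1,2) by (auto simp: eventually_at_topological)
qed

text \<open>The function \<open>f s z - s * f' t z\<close> of \<open>s\<close> has derivative
  \<open>f' s z - f' t z\<close>, which compactness makes small uniformly in \<open>z\<close> for
  \<open>s\<close> near \<open>t\<close>. The mean value inequality thus bounds the error of the
  linear approximation uniformly, before integration.\<close>

lemma has_real_derivative_integral:
  fixes f f' :: "real \<Rightarrow> 'z \<Rightarrow> real"
  assumes f: "\<And>t. continuous_on (space M) (f t)"
    and f': "continuous_on (UNIV \<times> space M) (\<lambda>(t, z). f' t z)"
    and d: "\<And>t z. z \<in> space M \<Longrightarrow> ((\<lambda>t. f t z) has_real_derivative f' t z) (at t)"
  shows "((\<lambda>t. \<integral>z. f t z \<partial>M) has_real_derivative (\<integral>z. f' t z \<partial>M)) (at t)"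
proof -
  let ?m = "measure M (space M)"
  have slice: "continuous_on (space M) (f' t)" for t
  proof -
    have "continuous_on (space M) (\<lambda>z. case (t, z) of (t, z) \<Rightarrow> f' t z)"
      by (rule continuous_on_compose2[OF f' continuous_on_Pair[OF continuous_on_const continuous_on_id]]) auto
    then show ?thesis by simp
  qed
  have "\<exists>\<delta>>0. \<forall>s. \<bar>s - t\<bar> < \<delta> \<longrightarrow>
      \<bar>(\<integral>z. f s z \<partial>M) - (\<integral>z. f t z \<partial>M) - (s - t) * (\<integral>z. f' t z \<partial>M)\<bar> \<le> e * \<bar>s - t\<bar>" if "e > 0" for e
  proof -
    define e' where "e' = e / (?m + 1)"
    have pos: "?m + 1 > 0" by (simp add: add_nonneg_pos)
    then have e': "e' > 0" using that by (simp add: e'_def)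
    obtain X0 where X0: "t \<in> X0" "open X0"
      "\<forall>s\<in>X0 \<inter> UNIV. \<forall>z\<in>space M. dist (f' s z) (f' t z) \<le> e'"
      using continuous_on_prod_compactE[OF f' compact_space UNIV_I e', of t] by auto
    then obtain \<delta> where \<delta>: "\<delta> > 0" "ball t \<delta> \<subseteq> X0"
      using open_contains_ball by blast
    have "\<bar>(\<integral>z. f s z \<partial>M) - (\<integral>z. f t z \<partial>M) - (s - t) * (\<integral>z. f' t z \<partial>M)\<bar> \<le> e * \<bar>s - t\<bar>"
      if s: "\<bar>s - t\<bar> < \<delta>" for s
    proof -
      have "\<bar>f s z - f t z - (s - t) * f' t z\<bar> \<le> e' * \<bar>s - t\<bar>" if z: "z \<in> space M" for z
      proof -
        have "norm ((\<lambda>s. f s z - s * f' t z) s - (\<lambda>s. f s z - s * f' t z) t) \<le> e' * norm (s - t)"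
        proof (rule field_differentiable_bound[where S = "ball t \<delta>" and f' = "\<lambda>s. f' s z - f' t z"])
          show "((\<lambda>s. f s z - s * f' t z) has_field_derivative f' u z - f' t z) (at u within ball t \<delta>)" for u
            by (rule has_field_derivative_at_within) (auto intro!: derivative_eq_intros d z)
          show "norm (f' u z - f' t z) \<le> e'" if "u \<in> ball t \<delta>" for u
            using X0(3) \<delta>(2) that z by (auto simp: dist_real_def)
        qed (use s \<delta> in \<open>auto simp: dist_real_def\<close>)
        then show ?thesis by (simp add: algebra_simps)
      qed
      then have "\<bar>\<integral>z. f s z - f t z - (s - t) * f' t z \<partial>M\<bar> \<le> e' * \<bar>s - t\<bar> * ?m"
        by (intro norm_integral_le continuous_intros f slice)
      also have "\<dots> \<le> e' * \<bar>s - t\<bar> * (?m + 1)"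
        using e' by (intro mult_left_mono) auto
      also have "\<dots> = e * \<bar>s - t\<bar>"
        using pos by (simp add: e'_def)
      finally show ?thesis
        by (simp add: integrable_continuous f slice)
    qed
    with \<delta>(1) show ?thesis by blast
  qed
  then show ?thesis
    unfolding has_field_derivative_def has_derivative_at_alt
    by (auto simp: bounded_linear_mult_right real_norm_def mult.commute)
qed

end

text \<open>Joint measurability comes from extending \<open>f\<close> by zero off the compact
  product, integrability from its boundedness there.\<close>

lemma Fubini_continuous:
  fixes f :: "'y::euclidean_space \<Rightarrow> 'z::euclidean_space \<Rightarrow> real"
  assumes "compact_finite_measure M" "compact_finite_measure N"
    and f: "continuous_on (space M \<times> space N) (\<lambda>(y, z). f y z)"
  shows "(\<integral>y. \<integral>z. f y z \<partial>N \<partial>M) = (\<integral>z. \<integral>y. f y z \<partial>M \<partial>N)"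
proof -
  interpret M: compact_finite_measure M by fact
  interpret N: compact_finite_measure N by fact
  interpret P: pair_sigma_finite M N ..
  have cl: "closed (space M \<times> space N)"
    using M.compact_space N.compact_space compact_Times compact_imp_closed by blast
  have "(\<lambda>x. indicator (space M \<times> space N) x *\<^sub>R (case x of (y, z) \<Rightarrow> f y z)) \<in> borel_measurable borel"
    by (rule borel_measurable_continuous_on_indicator[OF _ f]) (use cl in auto)
  moreover have "(\<lambda>x. (fst x, snd x)) \<in> measurable (M \<Otimes>\<^sub>M N) (borel :: ('y \<times> 'z) measure)"
  proof -
    have "(\<lambda>y. y) \<in> measurable M borel" "(\<lambda>z. z) \<in> measurable N borel"
      by (auto intro: M.borel_measurable_continuous N.borel_measurable_continuous)
    then show ?thesis
      unfolding borel_prod[symmetric] by (intro measurable_Pair) (auto intro: measurable_compose)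
  qed
  ultimately have "(\<lambda>x. indicator (space M \<times> space N) (fst x, snd x) *\<^sub>R (case (fst x, snd x) of (y, z) \<Rightarrow> f y z))
      \<in> borel_measurable (M \<Otimes>\<^sub>M N)"
    by (rule measurable_compose[rotated])
  then have meas: "(\<lambda>(y, z). f y z) \<in> borel_measurable (M \<Otimes>\<^sub>M N)"
    by (rule measurable_cong[THEN iffD1, rotated]) (auto simp: space_pair_measure indicator_def)
  have "compact ((\<lambda>(y, z). f y z) ` (space M \<times> space N))"
    by (intro compact_continuous_image[OF f] compact_Times M.compact_space N.compact_space)
  then obtain B where B: "\<And>x. x \<in> space M \<times> space N \<Longrightarrow> norm (case x of (y, z) \<Rightarrow> f y z) \<le> B"
    using compact_imp_bounded bounded_iff by (metis imageI)
  interpret PF: finite_measure "M \<Otimes>\<^sub>M N"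
    by (rule finite_measure_pair_measure) unfold_locales
  have "integrable (M \<Otimes>\<^sub>M N) (\<lambda>(y, z). f y z)"
    by (rule PF.integrable_const_bound[of _ B]) (use B meas in \<open>auto simp: space_pair_measure\<close>)
  then show ?thesis
    by (rule P.Fubini_integral[symmetric])
qed

text \<open>Translation invariance makes the integral of \<open>G (p + t *\<^sub>R b)\<close>
  independent of \<open>t\<close>, and its derivative at 0 is the integral of
  \<open>G' p b\<close>.\<close>

lemma integral_directional_derivative_eq_0:
  fixes G :: "'e::euclidean_space \<Rightarrow> real"
  assumes G: "\<And>p. (G has_derivative G' p) (at p)" and cont: "continuous_on UNIV (\<lambda>p. G' p b)"
    and supp: "\<And>p. norm p > r \<Longrightarrow> G p = 0"
  shows "(\<integral>p. G' p b \<partial>lborel) = 0"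
proof -
  have contG: "continuous_on UNIV G"
    using G has_derivative_continuous by (intro continuous_at_imp_continuous_on) blast
  \<comment> \<open>For \<open>|t| < 1\<close> the translate of \<open>G\<close> by
    \<open>t *\<^sub>R b\<close> still vanishes outside this radius, so all integrals can be taken
    over one compact ball.\<close>
  define R where "R = \<bar>r\<bar> + norm b"
  let ?C = "cball (0::'e) R"
  let ?M = "restrict_space lborel ?C"
  interpret M: compact_finite_measure ?M
  proof (intro compact_finite_measure.intro finite_measureI compact_finite_measure_axioms.intro)
    show "emeasure ?M (space ?M) \<noteq> \<infinity>"
      using emeasure_lborel_cball_finite[of "0::'e" R] by (simp add: emeasure_restrict_space space_restrict_space)
  qed (auto simp: space_restrict_space sets_restrict_space)
  have outside: "G p = 0" if "norm p > \<bar>r\<bar>" for p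
    using supp that by simp
  have eq: "(\<integral>p. F p \<partial>lborel) = (\<integral>p. F p \<partial>?M)" if "\<And>p. norm p > R \<Longrightarrow> F p = 0" for F :: "'e \<Rightarrow> real"
  proof -
    have "(\<integral>p. F p \<partial>?M) = (\<integral>p. indicator ?C p *\<^sub>R F p \<partial>lborel)"
      by (subst integral_restrict_space) (auto simp: set_lebesgue_integral_def)
    also have "\<dots> = (\<integral>p. F p \<partial>lborel)"
      by (intro Bochner_Integration.integral_cong) (use that in \<open>auto simp: indicator_def not_le\<close>)
    finally show ?thesis by simp
  qed
  have "((\<lambda>t. \<integral>p. G (p + t *\<^sub>R b) \<partial>?M) has_real_derivative (\<integral>p. G' (p + 0 *\<^sub>R b) b \<partial>?M)) (at 0)"
  proof (rule M.has_real_derivative_integral)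
    show "continuous_on (space ?M) (\<lambda>p. G (p + t *\<^sub>R b))" for t
      by (intro continuous_on_compose2[OF contG] continuous_intros) auto
    show "continuous_on (UNIV \<times> space ?M) (\<lambda>(t, p). G' (p + t *\<^sub>R b) b)"
      unfolding split_beta by (intro continuous_on_compose2[OF cont] continuous_intros) auto
    show "((\<lambda>t. G (p + t *\<^sub>R b)) has_real_derivative G' (p + t *\<^sub>R b) b) (at t)" for p t
    proof -
      have lin: "linear (G' (p + t *\<^sub>R b))"
        using G has_derivative_linear by blast
      have "((\<lambda>t. p + t *\<^sub>R b) has_derivative (\<lambda>h. h *\<^sub>R b)) (at t)"
        by (auto intro!: derivative_eq_intros)
      from has_derivative_compose[OF this G] show ?thesis
        by (auto simp: has_field_derivative_def linear_cmul[OF lin] mult.commute elim!: has_derivative_eq_rhs)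
    qed
  qed
  moreover have "((\<lambda>t. \<integral>p. G (p + t *\<^sub>R b) \<partial>?M) has_real_derivative 0) (at 0)"
  proof (rule has_field_derivative_transform_within_open[where f = "\<lambda>_. \<integral>p. G p \<partial>lborel" and S = "ball 0 1"])
    fix t :: real assume t: "t \<in> ball 0 1"
    have "(\<integral>p. G (p + t *\<^sub>R b) \<partial>lborel) = (\<integral>p. G p \<partial>lborel)"
    proof -
      have "(\<integral>p. G p \<partial>lborel) = (\<integral>p. G p \<partial>distr lborel borel ((+) (t *\<^sub>R b)))"
        by (simp only: lborel_distr_plus)
      also have "\<dots> = (\<integral>p. G (t *\<^sub>R b + p) \<partial>lborel)"
        by (rule integral_distr) (use borel_measurable_continuous_onI[OF contG] in auto)
      finally show ?thesis by (simp add: add.commute)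
    qed
    moreover have "G (p + t *\<^sub>R b) = 0" if "norm p > R" for p
    proof (rule outside)
      have "norm (t *\<^sub>R b) \<le> norm b"
        using t by (simp add: mult_left_le_one_le)
      moreover have "norm p \<le> norm (p + t *\<^sub>R b) + norm (t *\<^sub>R b)"
        using norm_triangle_ineq4[of "p + t *\<^sub>R b" "t *\<^sub>R b"] by simp
      ultimately show "\<bar>r\<bar> < norm (p + t *\<^sub>R b)"
        using that by (simp add: R_def)
    qed
    ultimately show "(\<integral>p. G p \<partial>lborel) = (\<integral>p. G (p + t *\<^sub>R b) \<partial>?M)"
      using eq[of "\<lambda>p. G (p + t *\<^sub>R b)"] by simp
  qed auto
  ultimately have "(\<integral>p. G' p b \<partial>?M) = 0"
    using DERIV_unique by fastforce
  moreover have "G' p b = 0" if "norm p > R" for p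
  proof -
    have "norm p > \<bar>r\<bar>" using that by (auto simp: R_def intro: le_less_trans[rotated])
    then have "(G has_derivative (\<lambda>_. 0)) (at p)"
      by (intro has_derivative_transform_within_open[of "\<lambda>_. 0" _ p UNIV "- cball 0 \<bar>r\<bar>" G])
        (auto simp: outside)
    then have "G' p = (\<lambda>_. 0)" by (rule has_derivative_unique[OF G])
    then show ?thesis by simp
  qed
  ultimately show ?thesis using eq[of "\<lambda>p. G' p b"] by simp
qed

section \<open>Polar coordinates\<close>

text \<open>Surface measure of the Euclidean unit sphere as a cone measure: a set receives the
  dimension times the volume of the cone over it in the unit ball.\<close>

definition sphere_measure :: "'e::euclidean_space measure" where
  "sphere_measure = distr
     (density (restrict_space lborel (cball 0 1 - {0})) (\<lambda>_. ennreal (real DIM('e))))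
     (restrict_space borel (sphere 0 1)) sgn"

lemma sgn_measurable_punctured_cball:
  "sgn \<in> measurable (restrict_space lborel (cball 0 1 - {0})) (restrict_space borel (sphere (0::'e::euclidean_space) 1))"
proof -
  have "sgn \<in> restrict_space lborel (cball 0 1 - {0::'e}) \<rightarrow>\<^sub>M borel"
    by (rule measurable_restrict_space1) (simp add: sgn_div_norm[abs_def])
  then show ?thesis
    by (intro measurable_restrict_space2) (auto simp: space_restrict_space norm_sgn)
qed

lemma space_sphere_measure [simp]: "space (sphere_measure :: 'e::euclidean_space measure) = sphere 0 1"
  by (simp add: sphere_measure_def space_restrict_space)

lemma sets_sphere_measure: "sets (sphere_measure :: 'e::euclidean_space measure) = sets (restrict_space borel (sphere 0 1))"
  by (simp add: sphere_measure_def)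

lemma emeasure_sphere_measure:
  assumes "A \<in> sets borel"
  shows "emeasure (sphere_measure :: 'e::euclidean_space measure) (A \<inter> sphere 0 1) =
    ennreal (real DIM('e)) * emeasure lborel {v \<in> cball 0 1 - {0}. sgn v \<in> A}"
proof -
  have sm: "(sgn :: 'e \<Rightarrow> 'e) \<in> borel_measurable borel"
    by (simp add: sgn_div_norm[abs_def])
  let ?T = "{v \<in> cball 0 1 - {0}. sgn v \<in> A}"
  have T: "?T \<in> sets borel"
  proof -
    have "?T = (cball 0 1 - {0}) \<inter> (sgn -` A \<inter> space borel)" by auto
    then show ?thesis using measurable_sets[OF sm assms] by simp
  qed
  have AS: "A \<inter> sphere 0 1 \<in> sets (restrict_space borel (sphere (0::'e) 1))"
    using assms by (simp add: sets_restrict_space_iff)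
  have "emeasure (sphere_measure :: 'e measure) (A \<inter> sphere 0 1) =
      emeasure (density (restrict_space lborel (cball 0 1 - {0})) (\<lambda>_. ennreal (real DIM('e)))) ?T"
    unfolding sphere_measure_def
    by (subst emeasure_distr)
      (use AS sgn_measurable_punctured_cball[where 'e = 'e] in
        \<open>auto simp: space_restrict_space norm_sgn intro!: arg_cong2[where f = emeasure]\<close>)
  also have "\<dots> = ennreal (real DIM('e)) * emeasure (restrict_space lborel (cball 0 1 - {0})) ?T"
    using T by (subst emeasure_density_const) (auto simp: sets_restrict_space_iff)
  also have "emeasure (restrict_space lborel (cball 0 1 - {0})) ?T = emeasure lborel ?T"
    using T by (subst emeasure_restrict_space) auto
  finally show ?thesis .
qed

interpretation sphere_measure: compact_finite_measure "sphere_measure :: 'e::euclidean_space measure"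
proof (intro compact_finite_measure.intro finite_measureI compact_finite_measure_axioms.intro)
  have "{v \<in> cball 0 1 - {0}. sgn v \<in> UNIV} \<subseteq> cball (0::'e) 1" by auto
  from emeasure_mono[OF this, of lborel]
  have "emeasure lborel {v \<in> cball 0 1 - {0}. sgn v \<in> (UNIV :: 'e set)} < \<infinity>"
    using emeasure_lborel_cball_finite[of "0::'e" 1] by (simp add: le_less_trans)
  then show "emeasure (sphere_measure :: 'e measure) (space sphere_measure) \<noteq> \<infinity>"
    using emeasure_sphere_measure[where 'e = 'e, of UNIV] by (auto simp: ennreal_mult_eq_top_iff)
qed (simp_all add: sets_sphere_measure)

lemma emeasure_lborel_scaleR:
  fixes A :: "'e::euclidean_space set"
  assumes "x > 0" "A \<in> sets borel"
  shows "emeasure lborel A = ennreal (x ^ DIM('e)) * emeasure lborel {v. x *\<^sub>R v \<in> A}"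
proof -
  have "emeasure lborel A = emeasure (density (distr lborel borel (\<lambda>v. 0 + x *\<^sub>R v)) (\<lambda>_. ennreal (\<bar>x\<bar> ^ DIM('e)))) A"
    using lborel_affine[of x "0::'e"] assms(1) by simp
  also have "\<dots> = ennreal (x ^ DIM('e)) * emeasure (distr lborel borel (\<lambda>v. x *\<^sub>R v)) A"
    using assms by (subst emeasure_density_const) auto
  also have "emeasure (distr lborel borel (\<lambda>v. x *\<^sub>R v)) A = emeasure lborel {v. x *\<^sub>R v \<in> A}"
    using assms(2) by (subst emeasure_distr) (auto simp: vimage_def)
  finally show ?thesis .
qed

text \<open>The part of a cone with norm at most \<open>x\<close> is the cone scaled by
  \<open>x\<close>, so it carries the fraction \<open>x ^ DIM('e)\<close> of the volume.\<close>

lemma emeasure_cone_greaterThan: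
  fixes B :: "'e::euclidean_space set"
  assumes B: "B \<in> sets borel" and x: "0 \<le> x" "x \<le> 1"
  defines "C \<equiv> {v \<in> cball 0 1 - {0}. sgn v \<in> B}"
  shows "emeasure lborel {v \<in> C. x < norm v} = ennreal (1 - x ^ DIM('e)) * emeasure lborel C"
proof -
  have sm: "(sgn :: 'e \<Rightarrow> 'e) \<in> borel_measurable borel"
    by (simp add: sgn_div_norm[abs_def])
  have "C = (cball 0 1 - {0}) \<inter> (sgn -` B \<inter> space borel)" by (auto simp: C_def)
  then have C: "C \<in> sets borel" using measurable_sets[OF sm B] by simp
  have "{v \<in> C. x < norm v} = C - cball 0 x" "{v \<in> C. norm v \<le> x} = C \<inter> cball 0 x" by auto
  then have m: "{v \<in> C. x < norm v} \<in> sets borel" "{v \<in> C. norm v \<le> x} \<in> sets borel"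
    using C by auto
  have "emeasure lborel C \<le> emeasure lborel (cball (0::'e) 1)"
    by (rule emeasure_mono) (auto simp: C_def)
  also have "\<dots> < \<infinity>" by (rule emeasure_lborel_cball_finite)
  finally have fin: "emeasure lborel C < \<infinity>" .
  have le: "emeasure lborel {v \<in> C. norm v \<le> x} = ennreal (x ^ DIM('e)) * emeasure lborel C"
  proof (cases "x = 0")
    case True
    then have e: "{v \<in> C. norm v \<le> x} = {}" by (auto simp: C_def)
    show ?thesis unfolding e using True by (simp add: power_0_left)
  next
    case False
    then have x0: "x > 0" using x by simp
    have "{v. x *\<^sub>R v \<in> {v \<in> C. norm v \<le> x}} = C"
      using x0 x(2) mult_le_one[of x "norm _"] by (auto simp: C_def sgn_scaleR)
    then show ?thesis
      using emeasure_lborel_scaleR[OF x0 m(2)] by simp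
  qed
  have "emeasure lborel {v \<in> C. x < norm v} = emeasure lborel (C - {v \<in> C. norm v \<le> x})"
    by (rule arg_cong[where f = "emeasure lborel"]) auto
  also have "\<dots> = emeasure lborel C - ennreal (x ^ DIM('e)) * emeasure lborel C"
    using fin C m le emeasure_mono[of "{v \<in> C. norm v \<le> x}" C lborel]
    by (subst emeasure_Diff) (auto simp: top_unique less_top[symmetric])
  also have "\<dots> = ennreal (1 - x ^ DIM('e)) * emeasure lborel C"
  proof -
    obtain V where V: "emeasure lborel C = ennreal V" "V \<ge> 0"
      using fin by (cases "emeasure lborel C") auto
    have "x ^ DIM('e) \<le> 1" using x by (simp add: power_le_one)
    then show ?thesis
      unfolding V using V(2) x by (simp add: ennreal_mult[symmetric] ennreal_minus left_diff_distrib)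
  qed
  finally show ?thesis .
qed

definition radial_measure :: "nat \<Rightarrow> real measure" where
  "radial_measure n = density lborel (\<lambda>t. ennreal (indicator {0..1} t * t ^ (n - 1)))"

lemma emeasure_radial_measure:
  assumes n: "n > 0" and x: "0 \<le> x" "x \<le> 1"
  shows "ennreal (real n) * emeasure (radial_measure n) {x<..} = ennreal (1 - x ^ n)"
proof -
  have "emeasure (radial_measure n) {x<..} = (\<integral>\<^sup>+t. ennreal (indicator {0..1} t * t ^ (n - 1)) * indicator {x<..} t \<partial>lborel)"
    unfolding radial_measure_def by (subst emeasure_density) auto
  also have "\<dots> = (\<integral>\<^sup>+t. ennreal (t ^ (n - 1)) * indicator {x..1} t \<partial>lborel)"
  proof (rule nn_integral_cong_AE)
    have "AE t in lborel. t \<noteq> x" by (rule AE_lborel_singleton)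
    then show "AE t in lborel. ennreal (indicator {0..1} t * t ^ (n - 1)) * indicator {x<..} t
        = ennreal (t ^ (n - 1)) * indicator {x..1} t"
      by eventually_elim (use x in \<open>auto simp: indicator_def\<close>)
  qed
  also have "\<dots> = ennreal (1 ^ n / real n - x ^ n / real n)"
    by (rule nn_integral_FTC_Icc) (use x n in \<open>auto intro!: derivative_eq_intros\<close>)
  finally have e: "emeasure (radial_measure n) {x<..} = ennreal (1 ^ n / real n - x ^ n / real n)" .
  have "real n * (1 ^ n / real n - x ^ n / real n) = 1 - x ^ n"
    using n by (simp add: field_simps)
  then show ?thesis
    unfolding e by (simp add: ennreal_mult'[symmetric])
qed

lemma finite_measure_radial_measure: "finite_measure (radial_measure n)"
proof (rule finite_measureI)
  have "emeasure (radial_measure n) UNIV = (\<integral>\<^sup>+t. ennreal (indicator {0..1} t * t ^ (n - 1)) \<partial>lborel)"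
    unfolding radial_measure_def by (subst emeasure_density) auto
  also have "\<dots> \<le> (\<integral>\<^sup>+t. indicator {0..1::real} t \<partial>lborel)"
    by (intro nn_integral_mono) (auto simp: indicator_def power_le_one ennreal_le_1)
  also have "\<dots> = 1" by simp
  finally show "emeasure (radial_measure n) (space (radial_measure n)) \<noteq> \<infinity>"
    by (auto simp: radial_measure_def top_unique)
qed

lemma measurable_norm_sgn:
  "(\<lambda>v::'e::euclidean_space. (norm v, sgn v)) \<in>
    measurable (restrict_space lborel (cball 0 1 - {0})) (lborel \<Otimes>\<^sub>M sphere_measure)"
proof (rule measurable_Pair)
  show "norm \<in> restrict_space lborel (cball 0 1 - {0::'e}) \<rightarrow>\<^sub>M lborel"
    by (rule measurable_restrict_space1) simp
  show "sgn \<in> restrict_space lborel (cball 0 1 - {0::'e}) \<rightarrow>\<^sub>M sphere_measure"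
    using sgn_measurable_punctured_cball by (simp add: measurable_cong_sets[OF refl sets_sphere_measure])
qed

text \<open>Both sides are compared on rectangles \<open>A \<times> B'\<close>. For fixed
  \<open>B'\<close> this is an equality of two finite measures on the line, for which half-lines
  suffice, and on these the cone formula applies.\<close>

lemma polar_distr:
  "distr (restrict_space lborel (cball 0 1 - {0})) (lborel \<Otimes>\<^sub>M sphere_measure) (\<lambda>v::'e::euclidean_space. (norm v, sgn v))
    = radial_measure DIM('e) \<Otimes>\<^sub>M sphere_measure" (is "?D = ?R \<Otimes>\<^sub>M ?S")
proof (rule pair_measure_eqI[symmetric])
  let ?C = "cball 0 1 - {0::'e}"
  interpret R: finite_measure ?R by (rule finite_measure_radial_measure)
  show "sigma_finite_measure ?R" by unfold_locales
  show "sigma_finite_measure ?S" by unfold_locales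
  show "sets (?R \<Otimes>\<^sub>M ?S) = sets ?D"
    by (simp add: radial_measure_def cong: sets_pair_measure_cong)
  fix A :: "real set" and B' :: "'e set"
  assume A: "A \<in> sets ?R" and B': "B' \<in> sets ?S"
  then have Ab: "A \<in> sets borel" by (simp add: radial_measure_def)
  obtain B where B: "B \<in> sets borel" "B' = B \<inter> sphere 0 1"
    using B' by (auto simp: sets_sphere_measure sets_restrict_space)
  define C where "C = {v \<in> cball 0 1 - {0::'e}. sgn v \<in> B}"
  have sm: "(sgn :: 'e \<Rightarrow> 'e) \<in> borel_measurable borel"
    by (simp add: sgn_div_norm[abs_def])
  have "C = (cball 0 1 - {0}) \<inter> (sgn -` B \<inter> space borel)" by (auto simp: C_def)
  then have C: "C \<in> sets borel" using measurable_sets[OF sm B(1)] by simp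
  have eS: "emeasure ?S B' = ennreal (real DIM('e)) * emeasure lborel C"
    unfolding B(2) C_def by (rule emeasure_sphere_measure[OF B(1)])
  have "emeasure lborel C \<le> emeasure lborel (cball (0::'e) 1)"
    by (rule emeasure_mono) (auto simp: C_def)
  also have "\<dots> < \<infinity>" by (rule emeasure_lborel_cball_finite)
  finally have fin: "emeasure lborel C < \<infinity>" .
  have nm: "norm \<in> measurable (restrict_space lborel C) borel"
    by (rule measurable_restrict_space1) simp
  have e1: "emeasure (distr (restrict_space lborel C) borel norm) X = emeasure lborel {v \<in> C. norm v \<in> X}"
    if "X \<in> sets borel" for X
  proof -
    have "{v \<in> C. norm v \<in> X} = C \<inter> (norm -` X \<inter> space borel)" by auto
    then have "{v \<in> C. norm v \<in> X} \<in> sets borel"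
      using C measurable_sets[of norm borel borel X] that by simp
    then show ?thesis
      using C that nm by (simp add: emeasure_distr space_restrict_space emeasure_restrict_space vimage_def Int_def conj_commute)
  qed
  have "distr (restrict_space lborel C) borel norm = density ?R (\<lambda>_. emeasure ?S B')"
  proof (rule measure_eqI_lessThan)
    fix x :: real
    have gt: "emeasure (distr (restrict_space lborel C) borel norm) {x<..} = emeasure lborel {v \<in> C. x < norm v}"
      using e1[of "{x<..}"] by simp
    also have "\<dots> \<le> emeasure lborel C"
      by (rule emeasure_mono) (use C in auto)
    finally show "emeasure (distr (restrict_space lborel C) borel norm) {x<..} < \<infinity>"
      using fin by (rule le_less_trans)
    have gt01: "emeasure lborel {v \<in> C. x < norm v} = emeasure ?S B' * emeasure ?R {x<..}" if "0 \<le> x" "x \<le> 1" for x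
      using emeasure_cone_greaterThan[OF B(1) that] emeasure_radial_measure[of "DIM('e)", OF _ that]
      unfolding C_def[symmetric] eS by (simp add: mult_ac)
    \<comment> \<open>Only \<open>0 \<le> x \<le> 1\<close> has content: for negative
      \<open>x\<close> the half-line has the same measure as \<open>{0<..}\<close>, and beyond 1 it
      has measure 0.\<close>
    have "emeasure lborel {v \<in> C. x < norm v} = emeasure ?S B' * emeasure ?R {x<..}"
    proof (cases "0 \<le> x \<and> x \<le> 1")
      case False
      then consider "x < 0" | "x > 1" by linarith
      then show ?thesis
      proof cases
        case 1
        have "{v \<in> C. x < norm v} = {v \<in> C. 0 < norm v}"
          using 1 by (auto simp: C_def intro: less_le_trans)
        moreover have "emeasure ?R {x<..} = emeasure ?R {0<..}"
        proof -
          have "AE t in lborel. t \<noteq> (0::real)" by (rule AE_lborel_singleton)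
          then show ?thesis
            unfolding radial_measure_def using 1
            by (subst (1 2) emeasure_density) (auto intro!: nn_integral_cong_AE elim!: eventually_mono simp: indicator_def)
        qed
        ultimately show ?thesis using gt01[of 0] by simp
      next
        case 2
        then have e: "{v \<in> C. x < norm v} = {}" by (auto simp: C_def)
        have "emeasure ?R {x<..} = 0"
        proof -
          have "emeasure ?R {x<..} = (\<integral>\<^sup>+t. ennreal (indicator {0..1} t * t ^ (DIM('e) - 1)) * indicator {x<..} t \<partial>lborel)"
            unfolding radial_measure_def by (subst emeasure_density) auto
          also have "\<dots> = (\<integral>\<^sup>+(t::real). 0 \<partial>lborel)"
            by (rule nn_integral_cong) (use 2 in \<open>auto simp: indicator_def\<close>)
          finally show ?thesis by simp
        qed
        then show ?thesis unfolding e by simp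
      qed
    qed (use gt01 in auto)
    then show "emeasure (distr (restrict_space lborel C) borel norm) {x<..} = emeasure (density ?R (\<lambda>_. emeasure ?S B')) {x<..}"
      unfolding gt by (subst emeasure_density_const) (auto simp: radial_measure_def)
  qed (auto simp: radial_measure_def)
  then have "emeasure lborel {v \<in> C. norm v \<in> A} = emeasure ?S B' * emeasure ?R A"
    using e1[OF Ab] Ab by (simp add: emeasure_density_const radial_measure_def)
  moreover have "emeasure ?D (A \<times> B') = emeasure lborel {v \<in> C. norm v \<in> A}"
  proof -
    note m = measurable_norm_sgn[where 'e = 'e]
    have "{v \<in> C. norm v \<in> A} = C \<inter> (norm -` A \<inter> space borel)" by auto
    then have "{v \<in> C. norm v \<in> A} \<in> sets borel"
      using C measurable_sets[of norm borel borel A] Ab by simp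
    moreover have "(\<lambda>v. (norm v, sgn v)) -` (A \<times> B') \<inter> ?C = {v \<in> C. norm v \<in> A}"
      by (auto simp: C_def B(2) norm_sgn)
    moreover have "emeasure (restrict_space lborel ?C) {v \<in> C. norm v \<in> A} = emeasure lborel {v \<in> C. norm v \<in> A}"
      by (rule emeasure_restrict_space) (auto simp: C_def)
    ultimately show ?thesis
      using emeasure_distr[OF m, of "A \<times> B'"] Ab B' by (simp add: space_restrict_space)
  qed
  ultimately show "emeasure ?R A * emeasure ?S B' = emeasure ?D (A \<times> B')"
    by (simp add: mult.commute)
qed

text \<open>Functions vanishing outside the unit ball are the ones that arise, because the polar
  charts below live on that ball.\<close>

lemma lborel_integral_polar:
  fixes g :: "'e::euclidean_space \<Rightarrow> real"
  assumes g: "continuous_on UNIV g" and zero: "\<And>v. norm v \<ge> 1 \<Longrightarrow> g v = 0"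
  shows "(\<integral>v. g v \<partial>lborel) =
    (\<integral>t. indicator {0..1} t * t ^ (DIM('e) - 1) * (\<integral>\<omega>. g (t *\<^sub>R \<omega>) \<partial>sphere_measure) \<partial>lborel)"
proof -
  let ?C = "cball 0 1 - {0::'e}" and ?R = "radial_measure DIM('e)" and ?S = "sphere_measure :: 'e measure"
  have gm [measurable]: "g \<in> borel_measurable borel"
    by (rule borel_measurable_continuous_onI[OF g])
  note m = measurable_norm_sgn[where 'e = 'e]
  have idS: "(\<lambda>\<omega>. \<omega>) \<in> measurable ?S borel"
    by (intro sphere_measure.borel_measurable_continuous continuous_on_id)
  have Gm: "(\<lambda>(t, \<omega>). g (t *\<^sub>R \<omega>)) \<in> borel_measurable (lborel \<Otimes>\<^sub>M ?S)"
  proof -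
    have "(\<lambda>p. snd p) \<in> measurable (lborel \<Otimes>\<^sub>M ?S) borel"
      using measurable_compose[OF measurable_snd idS] .
    then show ?thesis
      unfolding split_beta by measurable
  qed
  have "(\<integral>v. g v \<partial>lborel) = (\<integral>v. indicator ?C v *\<^sub>R g v \<partial>lborel)"
  proof (rule integral_cong_AE)
    have "AE v in lborel. v \<noteq> (0::'e)" by (rule AE_lborel_singleton)
    then show "AE v in lborel. g v = indicator ?C v *\<^sub>R g v"
      by eventually_elim (use zero in \<open>auto simp: indicator_def\<close>)
    show "(\<lambda>v. indicator ?C v *\<^sub>R g v) \<in> borel_measurable lborel"
      by (intro borel_measurable_scaleR borel_measurable_indicator) (simp_all add: gm)
  qed (simp add: gm)
  also have "\<dots> = (\<integral>v. g v \<partial>restrict_space lborel ?C)"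
    by (subst integral_restrict_space) (auto simp: set_lebesgue_integral_def)
  also have "\<dots> = (\<integral>v. (case (norm v, sgn v) of (t, \<omega>) \<Rightarrow> g (t *\<^sub>R \<omega>)) \<partial>restrict_space lborel ?C)"
    by (intro Bochner_Integration.integral_cong) (auto simp: space_restrict_space sgn_div_norm)
  also have "\<dots> = (\<integral>p. (case p of (t, \<omega>) \<Rightarrow> g (t *\<^sub>R \<omega>)) \<partial>(?R \<Otimes>\<^sub>M ?S))"
    unfolding polar_distr[symmetric] by (rule integral_distr[OF m Gm, symmetric])
  also have "\<dots> = (\<integral>t. (\<integral>\<omega>. g (t *\<^sub>R \<omega>) \<partial>?S) \<partial>?R)"
  proof -
    interpret R: finite_measure ?R by (rule finite_measure_radial_measure)
    interpret P: pair_sigma_finite ?R ?S ..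
    obtain b where b: "\<And>v. v \<in> cball 0 1 \<Longrightarrow> norm (g v) \<le> b"
      using compact_imp_bounded[OF compact_continuous_image[OF continuous_on_subset[OF g] compact_cball], of 0 1]
      unfolding bounded_iff by (metis imageI subset_UNIV)
    have "finite_measure (?R \<Otimes>\<^sub>M ?S)"
    proof -
      have "emeasure lborel ?C \<le> emeasure lborel (cball (0::'e) 1)"
        by (rule emeasure_mono) auto
      also have "\<dots> < \<infinity>" by (rule emeasure_lborel_cball_finite)
      finally have "emeasure (restrict_space lborel ?C) (space (restrict_space lborel ?C)) \<noteq> \<infinity>"
        by (simp add: emeasure_restrict_space space_restrict_space)
      then have "finite_measure (restrict_space lborel ?C)" by (rule finite_measureI)
      then show ?thesis
        unfolding polar_distr[symmetric] by (rule finite_measure.finite_measure_distr[OF _ m])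
    qed
    then interpret F: finite_measure "?R \<Otimes>\<^sub>M ?S" .
    have "norm (g v) \<le> max b 0" for v
      using b[of v] zero[of v] by (cases "norm v \<le> 1") auto
    then have "integrable (?R \<Otimes>\<^sub>M ?S) (\<lambda>(t, \<omega>). g (t *\<^sub>R \<omega>))"
      by (intro F.integrable_const_bound[of _ "max b 0"])
        (use Gm in \<open>auto simp: radial_measure_def cong: measurable_cong_sets sets_pair_measure_cong\<close>)
    from P.integral_fst'[OF this] show ?thesis by simp
  qed
  also have "\<dots> = (\<integral>t. (indicator {0..1} t * t ^ (DIM('e) - 1)) *\<^sub>R (\<integral>\<omega>. g (t *\<^sub>R \<omega>) \<partial>?S) \<partial>lborel)"
    unfolding radial_measure_def
  proof (rule integral_density)
    show "(\<lambda>t. \<integral>\<omega>. g (t *\<^sub>R \<omega>) \<partial>?S) \<in> borel_measurable lborel"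
      by (rule sphere_measure.borel_measurable_lebesgue_integral) (use Gm in simp)
  qed (auto simp: indicator_def)
  finally show ?thesis by simp
qed

section \<open>Uniqueness for a singular hyperbolic equation\<close>

text \<open>The energy $\frac12\int_0^r (W_1^2+W_2^2)(r,s)\,A(s)\,ds$ vanishes at $r=0$ and is
  nonincreasing, since $W_1 + W_2 = 0$ on the diagonal, which is characteristic, and $A(0) = 0$.
  The substitution $s = r\sigma$ fixes the domain of integration.\<close>

lemma antisymmetric_hyperbolic_zero:
  fixes W W1 W2 W11 W12 W22 :: "real \<times> real \<Rightarrow> real" and A A' :: "real \<Rightarrow> real"
  assumes dW: "\<And>p. (W has_derivative (\<lambda>h. W1 p * fst h + W2 p * snd h)) (at p)"
    and dW1: "\<And>p. (W1 has_derivative (\<lambda>h. W11 p * fst h + W12 p * snd h)) (at p)"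
    and dW2: "\<And>p. (W2 has_derivative (\<lambda>h. W12 p * fst h + W22 p * snd h)) (at p)"
    and cont: "continuous_on UNIV W11" "continuous_on UNIV W12" "continuous_on UNIV W22"
    and dA: "\<And>r. (A has_real_derivative A' r) (at r)" and contA': "continuous_on UNIV A'"
    and A0: "A 0 = 0" and Apos: "\<And>r. r > 0 \<Longrightarrow> A r > 0" and A'nonneg: "\<And>r. r > 0 \<Longrightarrow> A' r \<ge> 0"
    and pde: "\<And>r s. r > 0 \<Longrightarrow> s > 0 \<Longrightarrow>
      W11 (r, s) + A' r / A r * W1 (r, s) = W22 (r, s) + A' s / A s * W2 (r, s)"
    and diag: "\<And>r. W (r, r) = 0"
    and "0 < s" "s \<le> r"
  shows "W (r, s) = 0"
proof -
  have contW: "continuous_on UNIV W1" "continuous_on UNIV W2" "continuous_on UNIV A"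
    using dW1 dW2 dA by (auto intro!: continuous_at_imp_continuous_on has_derivative_continuous DERIV_isCont)
  note cc = continuous_on_compose2[OF cont(1)] continuous_on_compose2[OF cont(2)]
    continuous_on_compose2[OF cont(3)] continuous_on_compose2[OF contW(1)]
    continuous_on_compose2[OF contW(2)] continuous_on_compose2[OF contW(3)]
    continuous_on_compose2[OF contA']
  \<comment> \<open>After the substitution \<open>r * e (r, r * \<sigma>)\<close> is the energy
    density and \<open>Ed\<close> is its derivative in \<open>r\<close>. \<open>G\<close> is the
    matching flux, with derivative \<open>Gd\<close> in \<sigma>. They are chosen so that
    \<open>Ed - Gd\<close> contains second derivatives only through \<open>W11 - W22\<close>, which
    the equation turns into first-order terms.\<close>
  define e where "e p = (W1 p ^ 2 + W2 p ^ 2) / 2 * A (snd p)" for p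
  define Ed where "Ed r \<sigma> = (let p = (r, r * \<sigma>) in e p +
      r * ((W1 p * (W11 p + \<sigma> * W12 p) + W2 p * (W12 p + \<sigma> * W22 p)) * A (r * \<sigma>)
        + (W1 p ^ 2 + W2 p ^ 2) / 2 * (A' (r * \<sigma>) * \<sigma>)))" for r \<sigma>
  define G where "G r \<sigma> = (let p = (r, r * \<sigma>) in \<sigma> * e p + A (r * \<sigma>) * (W1 p * W2 p))" for r \<sigma>
  define Gd where "Gd r \<sigma> = (let p = (r, r * \<sigma>) in e p +
      \<sigma> * r * ((W1 p * W12 p + W2 p * W22 p) * A (r * \<sigma>) + (W1 p ^ 2 + W2 p ^ 2) / 2 * A' (r * \<sigma>))
      + r * (A' (r * \<sigma>) * (W1 p * W2 p) + A (r * \<sigma>) * (W12 p * W2 p + W1 p * W22 p)))" for r \<sigma>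
  define E where "E r = integral {0..1} (\<lambda>\<sigma>. r * e (r, r * \<sigma>))" for r
  have dr: "((\<lambda>r. F (r, r * \<sigma>)) has_real_derivative (Fr (r, r * \<sigma>) + \<sigma> * Fs (r, r * \<sigma>))) (at r)"
    if "\<And>p. (F has_derivative (\<lambda>h. Fr p * fst h + Fs p * snd h)) (at p)" for F Fr Fs r \<sigma>
  proof -
    have "((\<lambda>r. (r, r * \<sigma>)) has_derivative (\<lambda>h. (h, h * \<sigma>))) (at r)"
      by (auto intro!: derivative_eq_intros)
    from has_derivative_compose[OF this that] show ?thesis
      by (auto simp: has_field_derivative_def algebra_simps elim!: has_derivative_eq_rhs)
  qed
  have d\<sigma>: "((\<lambda>\<sigma>. F (r, r * \<sigma>)) has_real_derivative (r * Fs (r, r * \<sigma>))) (at \<sigma>)"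
    if "\<And>p. (F has_derivative (\<lambda>h. Fr p * fst h + Fs p * snd h)) (at p)" for F Fr Fs r \<sigma>
  proof -
    have "((\<lambda>\<sigma>. (r, r * \<sigma>)) has_derivative (\<lambda>h. (0, r * h))) (at \<sigma>)"
      by (auto intro!: derivative_eq_intros)
    from has_derivative_compose[OF this that] show ?thesis
      by (auto simp: has_field_derivative_def algebra_simps elim!: has_derivative_eq_rhs)
  qed
  have dAr: "((\<lambda>r. A (r * \<sigma>)) has_real_derivative A' (r * \<sigma>) * \<sigma>) (at r)" for r \<sigma>
    by (rule DERIV_chain2[OF dA]) (auto intro!: derivative_eq_intros)
  have dA\<sigma>: "((\<lambda>\<sigma>. A (r * \<sigma>)) has_real_derivative A' (r * \<sigma>) * r) (at \<sigma>)" for r \<sigma>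
    by (rule DERIV_chain2[OF dA]) (auto intro!: derivative_eq_intros)
  have prd1: "((\<lambda>r. r * ((f r ^ 2 + g r ^ 2) / 2 * a r)) has_real_derivative
      (f r ^ 2 + g r ^ 2) / 2 * a r + r * ((f r * f' + g r * g') * a r + (f r ^ 2 + g r ^ 2) / 2 * a')) (at r)"
    if "(f has_real_derivative f') (at r)" "(g has_real_derivative g') (at r)" "(a has_real_derivative a') (at r)"
    for f g a :: "real \<Rightarrow> real" and f' g' a' r
    using that by (auto intro!: derivative_eq_intros simp: power2_eq_square field_simps)
  have prd2: "((\<lambda>r. r * ((f r ^ 2 + g r ^ 2) / 2 * a r) + a r * (f r * g r)) has_real_derivative
      (f r ^ 2 + g r ^ 2) / 2 * a r + r * ((f r * f' + g r * g') * a r + (f r ^ 2 + g r ^ 2) / 2 * a')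
      + (a' * (f r * g r) + a r * (f' * g r + f r * g'))) (at r)"
    if "(f has_real_derivative f') (at r)" "(g has_real_derivative g') (at r)" "(a has_real_derivative a') (at r)"
    for f g a :: "real \<Rightarrow> real" and f' g' a' r
    using that by (auto intro!: derivative_eq_intros simp: power2_eq_square field_simps)
  have dE: "(E has_real_derivative integral {0..1} (Ed r)) (at r)" for r
  proof -
    have "((\<lambda>r. integral (cbox 0 1) (\<lambda>\<sigma>. r * e (r, r * \<sigma>))) has_real_derivative integral (cbox 0 1) (Ed r)) (at r within UNIV)"
    proof (rule leibniz_rule_field_derivative)
      show "((\<lambda>r. r * e (r, r * \<sigma>)) has_real_derivative Ed r \<sigma>) (at r within UNIV)" for r \<sigma>
        unfolding e_def Ed_def Let_def snd_conv
        by (rule DERIV_cong[OF prd1[OF dr[OF dW1] dr[OF dW2] dAr]]) simp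
      show "(\<lambda>\<sigma>. r * e (r, r * \<sigma>)) integrable_on cbox 0 1" for r
        unfolding e_def by (intro integrable_continuous continuous_intros cc) auto
      show "continuous_on (UNIV \<times> cbox 0 1) (\<lambda>(r, \<sigma>). Ed r \<sigma>)"
        unfolding Ed_def e_def Let_def split_beta by (intro continuous_intros cc) auto
    qed auto
    then show ?thesis by (simp add: E_def[abs_def])
  qed
  have W12diag: "W1 (r, r) + W2 (r, r) = 0" for r
  proof -
    have "((\<lambda>r. W (r, r * 1)) has_real_derivative W1 (r, r * 1) + 1 * W2 (r, r * 1)) (at r)"
      by (rule dr[OF dW])
    moreover have "((\<lambda>r. W (r, r * 1)) has_real_derivative 0) (at r)"
      by (simp add: diag)
    ultimately show ?thesis using DERIV_unique by fastforce
  qed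
  have dE_le: "integral {0..1} (Ed r) \<le> 0" if "r > 0" for r
  proof -
    have "((\<lambda>\<sigma>. Gd r \<sigma>) has_integral (G r 1 - G r 0)) {0..1}"
    proof (rule fundamental_theorem_of_calculus)
      fix \<sigma> :: real
      have "(G r has_real_derivative Gd r \<sigma>) (at \<sigma>)"
        unfolding G_def Gd_def e_def Let_def snd_conv
        by (rule DERIV_cong[OF prd2[OF d\<sigma>[OF dW1] d\<sigma>[OF dW2] dA\<sigma>]]) (simp add: algebra_simps)
      then show "(G r has_vector_derivative Gd r \<sigma>) (at \<sigma> within {0..1})"
        by (simp add: has_real_derivative_iff_has_vector_derivative has_vector_derivative_at_within)
    qed simp
    \<comment> \<open>At \<sigma> = 1 the flux is a multiple of the square of the derivative of
      \<open>W\<close> along the diagonal; at \<sigma> = 0 it is a multiple of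
      \<open>A 0\<close>.\<close>
    moreover have "G r 1 = A r / 2 * (W1 (r, r) + W2 (r, r))\<^sup>2"
      by (simp add: G_def e_def Let_def power2_eq_square field_simps)
    moreover have "G r 0 = 0"
      by (simp add: G_def Let_def A0)
    ultimately have Gd0: "(Gd r has_integral 0) {0..1}"
      by (simp add: W12diag)
    have "Ed r integrable_on {0..1}"
      unfolding Ed_def e_def Let_def by (intro integrable_continuous_interval continuous_intros cc) auto
    then have Edi: "((\<lambda>\<sigma>. if \<sigma> = 0 then Gd r 0 else Ed r \<sigma>) has_integral integral {0..1} (Ed r)) {0..1}"
      by (intro has_integral_spike_finite[where S = "{0}", OF _ _ integrable_integral]) auto
    show ?thesis
    proof (rule has_integral_le[OF Edi Gd0])
      fix \<sigma> :: real assume \<sigma>: "\<sigma> \<in> {0..1}"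
      show "(if \<sigma> = 0 then Gd r 0 else Ed r \<sigma>) \<le> Gd r \<sigma>"
      proof (cases "\<sigma> = 0")
        case False
        define p where "p = (r, r * \<sigma>)"
        have s: "r * \<sigma> > 0" using \<sigma> False that by auto
        have "A (r * \<sigma>) * (W11 p - W22 p) - A' (r * \<sigma>) * W2 p = - (A (r * \<sigma>) * (A' r / A r) * W1 p)"
          using pde[OF that s] Apos[OF s] by (simp add: p_def field_simps)
        moreover have "Ed r \<sigma> - Gd r \<sigma> = r * W1 p * (A (r * \<sigma>) * (W11 p - W22 p) - A' (r * \<sigma>) * W2 p)"
          unfolding Ed_def Gd_def Let_def p_def[symmetric] by (simp add: algebra_simps)
        ultimately have "Ed r \<sigma> - Gd r \<sigma> = - (r * A (r * \<sigma>) * (A' r / A r) * (W1 p)\<^sup>2)"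
          by (simp only:) (simp add: power2_eq_square)
        moreover have "r * A (r * \<sigma>) * (A' r / A r) * (W1 p)\<^sup>2 \<ge> 0"
          using that Apos[OF s] Apos[OF that] A'nonneg[OF that] by auto
        ultimately show ?thesis using False by simp
      qed auto
    qed
  qed
  have e0: "W1 (r, s) = 0 \<and> W2 (r, s) = 0" if "r > 0" "0 < s" "s \<le> r" for r s
  proof -
    have "E r \<le> E 0"
    proof (rule DERIV_nonpos_imp_decreasing_open[of 0 r E])
      show "\<exists>y. (E has_real_derivative y) (at x) \<and> y \<le> 0" if "0 < x" for x
        using dE dE_le[OF that] by blast
      show "continuous_on {0..r} E"
        using DERIV_isCont[OF dE] by (intro continuous_at_imp_continuous_on) blast
    qed (use that in simp)
    then have "E r \<le> 0" by (simp add: E_def)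
    have ce: "continuous_on {0..1} (\<lambda>\<sigma>. r * e (r, r * \<sigma>))"
      unfolding e_def by (intro continuous_intros cc) auto
    have enn: "r * e (r, r * \<sigma>) \<ge> 0" if "\<sigma> \<in> {0..1}" for \<sigma>
      using that \<open>r > 0\<close> Apos[of "r * \<sigma>"] A0 by (cases "\<sigma> = 0") (auto simp: e_def)
    then have "E r \<ge> 0"
      unfolding E_def by (intro integral_nonneg integrable_continuous_interval ce) auto
    with \<open>E r \<le> 0\<close> have "E r = 0" by simp
    moreover have "((\<lambda>\<sigma>. r * e (r, r * \<sigma>)) has_integral E r) {0..1}"
      unfolding E_def by (rule integrable_integral[OF integrable_continuous_interval[OF ce]])
    ultimately have "((\<lambda>\<sigma>. r * e (r, r * \<sigma>)) has_integral 0) {0..1}" by (simp only:)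
    then have "r * e (r, r * (s / r)) = 0"
      using has_integral_0_cbox_imp_0[of 0 1 "\<lambda>\<sigma>. r * e (r, r * \<sigma>)" "s / r"] ce enn that by auto
    then have "e (r, s) = 0" using that by simp
    then show ?thesis
      using Apos[OF that(2)] by (simp add: e_def add_nonneg_eq_0_iff)
  qed
  \<comment> \<open>Since \<open>W2\<close> vanishes below the diagonal, \<open>W\<close> is
    constant on the segment from \<open>(r, s)\<close> to \<open>(r, r)\<close>.\<close>
  have "W (r, s) = W (r, r)"
  proof (cases "s = r")
    case False
    have sr: "s < r" using \<open>s \<le> r\<close> False by simp
    have d: "((\<lambda>t. W (r, t)) has_real_derivative W2 (r, t)) (at t)" for t
    proof -
      have "((\<lambda>t. (r, t)) has_derivative (\<lambda>h. (0, h))) (at t)"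
        by (auto intro!: derivative_eq_intros)
      from has_derivative_compose[OF this dW] show ?thesis
        by (auto simp: has_field_derivative_def elim!: has_derivative_eq_rhs)
    qed
    obtain t where t: "s < t" "t < r" "W (r, r) - W (r, s) = (r - s) * W2 (r, t)"
      using MVT2[OF sr, of "\<lambda>t. W (r, t)" "\<lambda>t. W2 (r, t)"] d by blast
    moreover have "W2 (r, t) = 0"
      by (rule e0[THEN conjunct2]) (use t \<open>0 < s\<close> in auto)
    ultimately show ?thesis by simp
  qed simp
  then show ?thesis by (simp add: diag)
qed

section \<open>Metrics with a geodesic polar chart\<close>

lemma eq_neg_self_imp_zero:
  fixes x :: "'a::real_vector"
  assumes "x = - x"
  shows "x = 0"
proof -
  have "2 *\<^sub>R x = x + x" by (rule scaleR_2)
  also have "x + x = x + - x" by (rule arg_cong[OF assms])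
  finally show ?thesis by simp
qed

text \<open>The eigenspaces of the involution \<open>S\<close> are the blocks: \<open>L\<close>
  preserves them, while \<open>N\<close> kills the eigenspace of 1 and maps into it. The inverse
  \<open>K\<close> of \<open>L\<close> preserves the blocks too, so
  \<open>N (K (N u)) = 0\<close>.\<close>

lemma abs_det_lin_block_triangular:
  assumes lin: "linear S" "linear L" "linear N"
    and S: "\<And>u. S (S u) = u" "\<And>u. S (L (S u)) = L u" "\<And>u. S (N u) = N u" "\<And>u. N (S u) = - N u"
    and inj: "inj L"
  shows "\<bar>det_lin (\<lambda>u. L u + N u)\<bar> = \<bar>det_lin L\<bar>"
proof -
  obtain K where K: "linear K" "\<And>u. K (L u) = u" "\<And>u. L (K u) = u"
    using linear_injective_isomorphism[OF lin(2) inj] by blast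
  have SK: "S (K u) = K (S u)" for u
    using S(2)[of "S (K u)"] K by (metis S(1))
  show ?thesis
  proof (rule abs_det_lin_triangular[OF lin K(1) S(1,2) _ K(2,3)])
    show "S (N (S u)) = - N u" for u
      by (simp add: S linear_neg[OF lin(1)])
    show "N (K (N u)) = 0" for u
    proof -
      have "N (K (N u)) = - N (K (N u))"
        using S(4)[of "K (N u)"] by (simp add: SK S(3))
      then show ?thesis by (rule eq_neg_self_imp_zero)
    qed
  qed
qed

text \<open>A metric presented by an orthonormal frame: \<open>D p\<close> sends the standard basis
  to the frame at \<open>p\<close>, and \<open>Di p\<close> reads off coordinates in it. In the
  application the frame is left-invariant.\<close>

locale frame_metric =
  fixes g :: "'e::euclidean_space metric_tensor" and D Di :: "'e \<Rightarrow> 'e \<Rightarrow> 'e"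
  assumes linear_D: "linear (D p)" and linear_Di: "linear (Di p)"
    and D_Di [simp]: "D p (Di p u) = u" and Di_D [simp]: "Di p (D p u) = u"
    and g_eq: "g p u w = Di p u \<bullet> Di p w"
    and smooth_D: "smooth_on UNIV (\<lambda>p. D p u)"
    and smooth_det: "smooth_on UNIV (\<lambda>p. \<bar>det_lin (Di p)\<bar>)"

text \<open>\<open>E\<close> is a diffeomorphism of the open unit ball onto the whole space, with inverse \<open>F\<close>. In it
  the radial rays are orthogonal to the centered spheres and have speed $2/(1-|v|^2)$, as in the
  ball model of hyperbolic space, and the Riemannian volume has a radial density.\<close>

locale polar_chart = frame_metric g D Di
  for g :: "('a::euclidean_space \<times> real) metric_tensor" and D Di +
  fixes E F :: "'a \<times> real \<Rightarrow> 'a \<times> real" and Q :: real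
  assumes smooth_E: "smooth_on (ball 0 1) E" and smooth_F: "smooth_on UNIV F"
    and F_E: "norm v < 1 \<Longrightarrow> F (E v) = v" and E_F [simp]: "E (F p) = p" and norm_F: "norm (F p) < 1"
    and gauss: "norm v < 1 \<Longrightarrow>
      Di (E v) (frechet_derivative E (at v) v) \<bullet> Di (E v) (frechet_derivative E (at v) u)
        = 4 * (v \<bullet> u) / (1 - (norm v)\<^sup>2)\<^sup>2"
    and jac: "norm v < 1 \<Longrightarrow> \<bar>det_lin (\<lambda>u. Di (E v) (frechet_derivative E (at v) u))\<bar>
        = 2 ^ DIM('a \<times> real) * (1 - (norm v)\<^sup>2) powr - (Q + 1)"
    and Q_nonneg: "Q \<ge> 0"

lemma tanh_artanh_real: "tanh (artanh x) = x" if "\<bar>x\<bar> < 1" for x :: real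
proof -
  have "1 + x > 0" "1 - x > 0" using that by auto
  then have "exp (- 2 * artanh x) = (1 - x) / (1 + x)"
    by (simp add: artanh_def exp_minus)
  then show ?thesis
    unfolding tanh_real_altdef using \<open>1 + x > 0\<close> by (simp only:) (simp add: field_simps)
qed

section \<open>Distance from the centre of a polar chart\<close>

context polar_chart
begin

abbreviation DE where "DE v \<equiv> frechet_derivative E (at v)"
abbreviation DF where "DF p \<equiv> frechet_derivative F (at p)"

lemma E_has_derivative: "norm v < 1 \<Longrightarrow> (E has_derivative DE v) (at v)"
  using smooth_on_has_derivative[OF smooth_E, of v] by simp

lemma F_has_derivative: "(F has_derivative DF p) (at p)"
  using smooth_on_has_derivative[OF smooth_F, of p] by simp

lemma linear_DE: "norm v < 1 \<Longrightarrow> linear (DE v)"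
  using E_has_derivative has_derivative_linear by blast

lemma linear_DF: "linear (DF p)"
  using F_has_derivative has_derivative_linear by blast

lemma DE_DF [simp]: "DE (F p) (DF p u) = u"
proof -
  have "((\<lambda>p. E (F p)) has_derivative (\<lambda>u. DE (F p) (DF p u))) (at p)"
    by (rule has_derivative_compose[OF F_has_derivative E_has_derivative[OF norm_F]])
  then have "((\<lambda>p. p) has_derivative (\<lambda>u. DE (F p) (DF p u))) (at p)" by simp
  from has_derivative_unique[OF this has_derivative_ident] show ?thesis by metis
qed

lemma F_0 [simp]: "F (E 0) = 0"
  by (rule F_E) simp

text \<open>The vector \<open>DE v u\<close> in the orthonormal frame at \<open>E v\<close>, so that
  Euclidean norms and inner products of \<open>T v u\<close> are the Riemannian ones.\<close>

definition T where "T v u = Di (E v) (DE v u)"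

lemma linear_T: "norm v < 1 \<Longrightarrow> linear (T v)"
  unfolding T_def using linear_compose[OF linear_DE linear_Di] by (simp add: o_def)

lemma D_T: "D (E v) (T v u) = DE v u"
  by (simp add: T_def)

lemma T_inner: "norm v < 1 \<Longrightarrow> T v v \<bullet> T v u = 4 * (v \<bullet> u) / (1 - (norm v)\<^sup>2)\<^sup>2"
  unfolding T_def by (rule gauss)

lemma norm_T:
  assumes "norm v < 1"
  shows "norm (T v v) = 2 * norm v / (1 - (norm v)\<^sup>2)"
proof -
  have "(norm v)\<^sup>2 < 1" using assms by (simp add: power_less_one_iff)
  moreover have "(norm (T v v))\<^sup>2 = (2 * norm v / (1 - (norm v)\<^sup>2))\<^sup>2"
    using T_inner[OF assms, of v] by (simp add: power2_norm_eq_inner[symmetric] power_divide power_mult_distrib)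
  ultimately show ?thesis
    by (simp add: power2_eq_iff_nonneg)
qed

text \<open>Cauchy--Schwarz against \<open>T v v\<close>: by the Gauss identity the radial component
  of a motion does not exceed its Riemannian speed. The factor \<open>2 / (1 - (norm v)^2)\<close>
  is the derivative of \<open>2 * artanh\<close> at \<open>norm v\<close>.\<close>

lemma radial_speed_le:
  assumes v: "norm v < 1" "v \<noteq> 0"
  shows "2 / (1 - (norm v)\<^sup>2) * (v \<bullet> u / norm v) \<le> norm (T v u)"
proof -
  have q: "(norm v)\<^sup>2 < 1" using v by (simp add: power_less_one_iff)
  then have pos: "norm (T v v) > 0" using v by (simp add: norm_T)
  have "2 / (1 - (norm v)\<^sup>2) * (v \<bullet> u / norm v) * norm (T v v) = T v v \<bullet> T v u"
  proof -
    have "2 / q * (c / a) * (2 * a / q) = 4 * c / q\<^sup>2" if "a \<noteq> 0" for a c q :: real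
      using that by (simp add: power2_eq_square)
    from this[of "norm v" "1 - (norm v)\<^sup>2" "v \<bullet> u"] show ?thesis
      unfolding norm_T[OF v(1)] T_inner[OF v(1)] using v(2) by simp
  qed
  also have "\<dots> \<le> norm (T v v) * norm (T v u)" by (rule norm_cauchy_schwarz)
  also have "\<dots> = norm (T v u) * norm (T v v)" by (rule mult.commute)
  finally show ?thesis
    using pos by (rule mult_right_le_imp_le)
qed

definition rad where "rad p = 2 * artanh (norm (F p))"

lemma rad_nonneg: "rad p \<ge> 0"
  unfolding rad_def artanh_def using norm_F[of p] by (simp add: field_simps)

lemma tanh_rad: "tanh (rad p / 2) = norm (F p)"
  using norm_F[of p] by (simp add: rad_def tanh_artanh_real)

lemma continuous_on_F: "continuous_on S F"
  using smooth_on_imp_continuous_on[OF smooth_F] continuous_on_subset by blast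

text \<open>The radial speed is integrated along the curve. The norm is not differentiable at 0, so
  the integration begins at the last time \<open>t0\<close> at which the curve is at the
  centre.\<close>

lemma rad_le_length:
  assumes \<gamma>: "\<gamma> piecewise_C1_differentiable_on {0..1}" and start: "pathstart \<gamma> = E 0" and finish: "pathfinish \<gamma> = p"
    and L: "((\<lambda>t. sqrt (g (\<gamma> t) (vector_derivative \<gamma> (at t)) (vector_derivative \<gamma> (at t)))) has_integral L) {0..1}"
  shows "rad p \<le> L"
proof -
  let ?sp = "\<lambda>t. sqrt (g (\<gamma> t) (vector_derivative \<gamma> (at t)) (vector_derivative \<gamma> (at t)))"
  obtain S where S: "finite S" "\<gamma> C1_differentiable_on ({0..1} - S)" and cont: "continuous_on {0..1} \<gamma>"
    using \<gamma> unfolding piecewise_C1_differentiable_on_def by blast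
  have contF: "continuous_on {0..1} (\<lambda>t. F (\<gamma> t))"
    by (rule continuous_on_compose2[OF continuous_on_F cont]) auto
  have "closedin (top_of_set {0..1}) {t \<in> {0..1}. F (\<gamma> t) = 0}"
    by (rule continuous_closedin_preimage_constant[OF contF])
  then have "compact {t \<in> {0..1}. F (\<gamma> t) = 0}"
    using closedin_compact compact_Icc by blast
  moreover have "0 \<in> {t \<in> {0..1::real}. F (\<gamma> t) = 0}"
    using start by (simp add: pathstart_def)
  ultimately obtain t0 where t0: "t0 \<in> {0..1}" "F (\<gamma> t0) = 0" "\<And>t. t \<in> {0..1} \<Longrightarrow> F (\<gamma> t) = 0 \<Longrightarrow> t \<le> t0"
    using compact_attains_sup[of "{t \<in> {0..1}. F (\<gamma> t) = 0}"] by blast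
  define v where "v t = F (\<gamma> t)" for t
  define w where "w t = DF (\<gamma> t) (vector_derivative \<gamma> (at t))" for t
  define f' where "f' t = 2 / (1 - (norm (v t))\<^sup>2) * (v t \<bullet> w t / norm (v t))" for t
  have nv: "norm (v t) < 1" for t by (simp add: v_def norm_F)
  have int: "(f' has_integral (rad (\<gamma> 1) - rad (\<gamma> t0))) {t0..1}"
  proof (rule fundamental_theorem_of_calculus_interior_strong[OF S(1)])
    show "continuous_on {t0..1} (\<lambda>t. rad (\<gamma> t))"
      unfolding rad_def using norm_F t0(1)
      by (intro continuous_intros continuous_on_subset[OF contF]) (auto intro: less_trans[of "-1" 0] simp: less_le_trans[of "-1" 0])
    fix t assume t: "t \<in> {t0<..<1} - S"
    then have t01: "t \<in> {0..1} - S" using t0(1) by auto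
    have nz: "v t \<noteq> 0" using t0(3)[of t] t t01 by (auto simp: v_def)
    have "\<gamma> differentiable at t"
      using S(2) t01 unfolding C1_differentiable_on_eq by blast
    then have d\<gamma>: "(\<gamma> has_vector_derivative vector_derivative \<gamma> (at t)) (at t)"
      by (simp add: vector_derivative_works)
    have "(v has_vector_derivative w t) (at t)"
      using vector_derivative_diff_chain_within[OF d\<gamma> has_derivative_at_withinI[OF F_has_derivative[of "\<gamma> t"]]]
      unfolding v_def w_def o_def .
    then have dv: "(v has_derivative (\<lambda>h. h *\<^sub>R w t)) (at t)"
      by (simp add: has_vector_derivative_def)
    have "(norm has_derivative (\<lambda>h. v t \<bullet> h / norm (v t))) (at (v t))"
      using has_derivative_norm[OF nz] by (simp add: sgn_div_norm inner_commute divide_inverse mult.commute)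
    from has_derivative_compose[OF dv this]
    have dn: "((\<lambda>t. norm (v t)) has_real_derivative (v t \<bullet> w t / norm (v t))) (at t)"
      by (auto simp: has_field_derivative_def elim!: has_derivative_eq_rhs)
    have da: "(artanh has_real_derivative 1 / (1 - (norm (v t))\<^sup>2)) (at (norm (v t)))"
      using nv[of t] by (intro artanh_real_has_field_derivative) simp
    have "((\<lambda>t. artanh (norm (v t))) has_real_derivative 1 / (1 - (norm (v t))\<^sup>2) * (v t \<bullet> w t / norm (v t))) (at t)"
      by (rule DERIV_chain2[where g = "\<lambda>t. norm (v t)", OF da dn])
    from DERIV_cmult[OF this, of 2] have "((\<lambda>t. 2 * artanh (norm (v t))) has_real_derivative f' t) (at t)"
      by (simp add: f'_def)
    then show "((\<lambda>t. rad (\<gamma> t)) has_vector_derivative f' t) (at t)"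
      by (simp add: rad_def v_def has_real_derivative_iff_has_vector_derivative)
  qed (use t0 in auto)
  have spi: "?sp integrable_on {t0..1}"
    using L t0(1) by (intro integrable_subinterval_real[OF has_integral_integrable[OF L]]) auto
  have le: "f' t \<le> ?sp t" if "t \<in> {t0..1} - insert t0 S" for t
  proof -
    have t01: "t \<in> {0..1} - S" using that t0(1) by auto
    have nz: "v t \<noteq> 0" using t0(3)[of t] that t01 by (auto simp: v_def)
    have "T (v t) (w t) = Di (\<gamma> t) (vector_derivative \<gamma> (at t))"
      by (simp add: T_def v_def w_def)
    then have "?sp t = norm (T (v t) (w t))"
      by (simp add: g_eq norm_eq_sqrt_inner)
    then show ?thesis
      unfolding f'_def using radial_speed_le[OF nv nz] by simp
  qed
  have "((\<lambda>t. if t \<in> insert t0 S then ?sp t else f' t) has_integral (rad (\<gamma> 1) - rad (\<gamma> t0))) {t0..1}"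
    by (rule has_integral_spike_finite[OF _ _ int, of "insert t0 S"]) (use S(1) in auto)
  then have "rad (\<gamma> 1) - rad (\<gamma> t0) \<le> integral {t0..1} ?sp"
    by (rule has_integral_le[OF _ integrable_integral[OF spi]]) (use le in auto)
  also have "\<dots> \<le> integral {0..1} ?sp"
    using t0(1) L spi by (intro integral_subset_le) (auto simp: g_eq has_integral_integrable)
  also have "\<dots> = L" using L by (rule integral_unique)
  finally show ?thesis
    using finish t0(2) by (simp add: pathfinish_def rad_def)
qed

text \<open>For a unit vector \<omega> and \<open>r \<ge> 0\<close>, the point at distance
  \<open>r\<close> from the centre in direction \<omega>: \<open>tanh (r / 2)\<close> inverts the
  radius \<open>2 * artanh\<close>.\<close>

definition ray where "ray r \<omega> = E (tanh (r / 2) *\<^sub>R \<omega>)"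

lemma norm_tanh_scaleR: "norm \<omega> \<le> 1 \<Longrightarrow> norm (tanh (r / 2 :: real) *\<^sub>R \<omega>) < 1"
proof -
  assume "norm \<omega> \<le> 1"
  moreover have "\<bar>tanh (r / 2)\<bar> < 1"
    using tanh_real_bounds[of "r / 2"] by (simp add: abs_less_iff)
  ultimately show ?thesis
    using mult_left_le[of "norm \<omega>" "\<bar>tanh (r / 2)\<bar>"] by simp
qed

text \<open>An open neighbourhood of all pairs of a radius and a unit vector. The unit sphere is not
  open, and smoothness is meant for open sets.\<close>

definition ray_domain where "ray_domain = {(r, \<omega>). norm (tanh (r / 2 :: real) *\<^sub>R (\<omega> :: 'a \<times> real)) < 1}"

lemma open_ray_domain: "open ray_domain"
  unfolding ray_domain_def split_beta by (intro open_Collect_less continuous_intros) auto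

lemma ray_domain_sphere: "norm \<omega> \<le> 1 \<Longrightarrow> (r, \<omega>) \<in> ray_domain"
  using norm_tanh_scaleR by (simp add: ray_domain_def)

lemma smooth_ray: "smooth_on ray_domain (\<lambda>(r, \<omega>). ray r \<omega>)"
proof -
  have "smooth_on ray_domain (\<lambda>q. tanh (fst q * (1 / 2)) *\<^sub>R snd q)"
    by (intro smooth_intros open_ray_domain)
  then have "smooth_on ray_domain (\<lambda>q. E (tanh (fst q * (1 / 2)) *\<^sub>R snd q))"
    by (rule smooth_on_compose[OF open_ray_domain open_ball _ smooth_E])
      (intro image_subsetI, simp add: ray_domain_def split_beta)
  then show ?thesis by (simp add: ray_def case_prod_beta')
qed

lemma DERIV_tanh_half: "((\<lambda>r::real. tanh (r / 2)) has_real_derivative (1 - (tanh (r / 2))\<^sup>2) / 2) (at r)"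
  by (auto intro!: derivative_eq_intros)

lemma ray_has_vector_derivative:
  assumes "norm \<omega> \<le> 1"
  shows "((\<lambda>r. ray r \<omega>) has_vector_derivative
    ((1 - (tanh (r / 2))\<^sup>2) / 2) *\<^sub>R DE (tanh (r / 2) *\<^sub>R \<omega>) \<omega>) (at r)"
proof -
  have "((\<lambda>r. tanh (r / 2) *\<^sub>R \<omega>) has_vector_derivative ((1 - (tanh (r / 2))\<^sup>2) / 2) *\<^sub>R \<omega>) (at r)"
    using has_vector_derivative_scaleR[OF DERIV_tanh_half has_vector_derivative_const[of \<omega>]] by simp
  from vector_derivative_diff_chain_within[OF this has_derivative_at_withinI[OF E_has_derivative[OF norm_tanh_scaleR[OF assms]]]]
  show ?thesis
    unfolding ray_def o_def by (simp add: linear_cmul[OF linear_DE[OF norm_tanh_scaleR[OF assms]]])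
qed

lemma smooth_ray_slice:
  assumes "norm \<omega> \<le> 1"
  shows "smooth_on UNIV (\<lambda>r. ray r \<omega>)"
proof -
  have "smooth_on UNIV (\<lambda>r::real. (r, \<omega>))"
    by (intro smooth_intros open_UNIV)
  from smooth_on_compose[OF open_UNIV open_ray_domain this smooth_ray] show ?thesis
    using ray_domain_sphere[OF assms] by auto
qed

lemma ray_rad: "ray (rad p) (sgn (F p)) = p"
proof -
  have "norm (F p) *\<^sub>R sgn (F p) = F p"
    by (cases "F p = 0") (simp_all add: sgn_div_norm)
  then show ?thesis by (simp add: ray_def tanh_rad)
qed

text \<open>\<open>rad_le_length\<close> is the lower bound; the rescaled ray to \<open>p\<close>,
  of constant speed \<open>rad p\<close>, attains it.\<close>

lemma riemannian_dist_eq: "riemannian_dist g (E 0) p = rad p"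
  unfolding riemannian_dist_def
proof (rule cInf_eq_minimum)
  let ?\<omega> = "sgn (F p)" and ?R = "rad p"
  let ?\<gamma> = "\<lambda>t. ray (t * ?R) ?\<omega>"
  have \<omega>: "norm ?\<omega> \<le> 1" by (simp add: norm_sgn)
  let ?V = "\<lambda>t. ?R *\<^sub>R (((1 - (tanh (t * ?R / 2))\<^sup>2) / 2) *\<^sub>R DE (tanh (t * ?R / 2) *\<^sub>R ?\<omega>) ?\<omega>)"
  have d: "(?\<gamma> has_vector_derivative ?V t) (at t)" for t
  proof -
    have "((\<lambda>t. t * ?R) has_vector_derivative ?R) (at t)"
      by (auto intro!: derivative_eq_intros simp: has_vector_derivative_def)
    from vector_diff_chain_at[OF this ray_has_vector_derivative[OF \<omega>]] show ?thesis
      by (simp add: o_def)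
  qed
  then have V: "vector_derivative ?\<gamma> (at t) = ?V t" for t
    by (rule vector_derivative_at)
  have sm: "smooth_on UNIV ?\<gamma>"
    by (rule smooth_on_compose[OF open_UNIV open_UNIV _ smooth_ray_slice[OF \<omega>]]) (auto intro!: smooth_intros)
  have "frechet_derivative ?\<gamma> (at t) 1 = ?V t" for t
  proof -
    have "frechet_derivative ?\<gamma> (at t) = (\<lambda>h. h *\<^sub>R ?V t)"
      by (rule frechet_derivative_at[symmetric]) (use d[of t] in \<open>simp add: has_vector_derivative_def\<close>)
    then show ?thesis by simp
  qed
  then have "continuous_on UNIV ?V"
    using smooth_on_imp_continuous_on[OF smooth_on_frechet_derivative[OF sm, of 1]] by simp
  then have "continuous_on {0..1} ?V"
    by (rule continuous_on_subset) simp
  with d have "?\<gamma> C1_differentiable_on {0..1}"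
    unfolding C1_differentiable_on_def by (intro exI[of _ ?V] conjI ballI)
  then have pw: "?\<gamma> piecewise_C1_differentiable_on {0..1}"
    by (rule C1_differentiable_imp_piecewise)
  \<comment> \<open>At \<open>t = 0\<close> the factor \<open>tanh (t * ?R / 2)\<close>, by which
    the computation divides, is 0; one point of time does not affect the integral.\<close>
  have speed: "sqrt (g (?\<gamma> t) (?V t) (?V t)) = ?R" if "t \<in> {0..1} - {0}" for t
  proof (cases "?R = 0")
    case True
    then show ?thesis by (simp add: g_eq linear_0[OF linear_Di])
  next
    case False
    then have R: "?R > 0" using rad_nonneg[of p] by simp
    then have \<tau>: "tanh (t * ?R / 2) > 0" using that by simp
    have n1: "norm ?\<omega> = 1"
      using False by (auto simp: norm_sgn rad_def)
    let ?\<tau> = "tanh (t * ?R / 2)"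
    let ?v = "?\<tau> *\<^sub>R ?\<omega>"
    have v: "norm ?v < 1" by (rule norm_tanh_scaleR[OF \<omega>])
    have nv: "norm ?v = ?\<tau>" using \<tau> n1 by simp
    have q: "1 - ?\<tau>\<^sup>2 > 0" using v \<tau> unfolding nv by (simp add: power_less_one_iff)
    have "T ?v ?v = ?\<tau> *\<^sub>R T ?v ?\<omega>"
      by (rule linear_cmul[OF linear_T[OF v]])
    then have eq: "?\<tau> * norm (T ?v ?\<omega>) = ?\<tau> * (2 / (1 - ?\<tau>\<^sup>2))"
      using norm_T[OF v] \<tau> unfolding nv by simp
    have nz: "?\<tau> \<noteq> 0" using \<tau> by (rule less_imp_neq[THEN not_sym])
    have nT: "norm (T ?v ?\<omega>) = 2 / (1 - ?\<tau>\<^sup>2)"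
      by (rule mult_left_cancel[OF nz, THEN iffD1, OF eq])
    have "sqrt (g (?\<gamma> t) (?V t) (?V t)) = norm (Di (?\<gamma> t) (?V t))"
      by (simp add: g_eq norm_eq_sqrt_inner)
    also have "Di (?\<gamma> t) (?V t) = ?R *\<^sub>R ((1 - ?\<tau>\<^sup>2) / 2) *\<^sub>R T ?v ?\<omega>"
      by (simp add: linear_cmul[OF linear_Di] T_def ray_def)
    also have "norm \<dots> = ?R"
      using R q nT by simp
    finally show ?thesis .
  qed
  have "((\<lambda>t. sqrt (g (?\<gamma> t) (?V t) (?V t))) has_integral ?R) {0..1}"
    using has_integral_const_real[of ?R 0 1]
    by (intro has_integral_spike_finite[of "{0}", OF _ speed]) auto
  then have "((\<lambda>t. sqrt (g (?\<gamma> t) (vector_derivative ?\<gamma> (at t)) (vector_derivative ?\<gamma> (at t)))) has_integral ?R) {0..1}"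
    unfolding V .
  with pw show "?R \<in> {L. \<exists>\<gamma>. \<gamma> piecewise_C1_differentiable_on {0..1} \<and> pathstart \<gamma> = E 0 \<and> pathfinish \<gamma> = p \<and>
      ((\<lambda>t. sqrt (g (\<gamma> t) (vector_derivative \<gamma> (at t)) (vector_derivative \<gamma> (at t)))) has_integral L) {0..1}}"
    by (intro CollectI exI[of _ ?\<gamma>]) (auto simp: pathstart_def pathfinish_def ray_rad, simp add: ray_def)
qed (use rad_le_length in blast)

lemma geodesic_sphere_eq:
  assumes "r > 0"
  shows "geodesic_sphere g (E 0) r = {p. norm (F p) = tanh (r / 2)}"
proof -
  have "rad p = r \<longleftrightarrow> norm (F p) = tanh (r / 2)" for p
    using tanh_rad[of p] artanh_tanh_real[of "r / 2"] by (auto simp: rad_def)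
  then show ?thesis
    by (simp add: geodesic_sphere_def riemannian_dist_eq)
qed

end

section \<open>Surface measure of geodesic spheres\<close>

text \<open>The cone over the image of \<open>B\<close> is parametrized by
  \<open>(w, t) \<mapsto> t *\<^sub>R h w\<close>, with Jacobian \<open>t ^ (n - 1)\<close> times
  the determinant at \<open>w\<close>. Integration over \<open>t\<close> gives \<open>1 / n\<close>,
  which cancels the dimension in \<open>sphere_measure\<close>.\<close>

lemma emeasure_sphere_measure_image:
  fixes h :: "'a::euclidean_space \<Rightarrow> 'a \<times> real"
  assumes W: "open W" and sph: "\<And>w. w \<in> W \<Longrightarrow> norm (h w) = 1"
    and der: "\<And>w. w \<in> W \<Longrightarrow> (h has_derivative h' w) (at w)"
    and cont: "\<And>b. b \<in> Basis \<Longrightarrow> continuous_on W (\<lambda>w. h' w b)"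
    and homeo: "homeomorphism W (h ` W) h hi" and opn: "openin (top_of_set (sphere 0 1)) (h ` W)"
    and B: "B \<in> sets borel" "B \<subseteq> W"
  shows "emeasure sphere_measure (h ` B) = (\<integral>\<^sup>+w\<in>B. ennreal \<bar>det_lin (\<lambda>u. h' w (fst u) + snd u *\<^sub>R h w)\<bar> \<partial>lborel)"
proof -
  have contw: "continuous_on W h" and conthi: "continuous_on (h ` W) hi" and hih: "\<And>w. w \<in> W \<Longrightarrow> hi (h w) = w"
    using homeo by (auto simp: homeomorphism_def)
  have hW: "h ` W \<in> sets borel"
    using opn by (auto simp: openin_open)
  define K where "K u = snd u *\<^sub>R h (fst u)" for u :: "'a \<times> real"
  define L where "L w u = h' w (fst u) + snd u *\<^sub>R h w" for w and u :: "'a \<times> real"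
  define K' where "K' x u = L (fst x) (snd x *\<^sub>R fst u, snd u)" for x u :: "'a \<times> real"
  define n where "n = DIM('a \<times> real)"
  have n: "n = DIM('a) + 1" "n > 0" by (simp_all add: n_def DIM_prod)
  have linh: "linear (h' w)" if "w \<in> W" for w
    using der[OF that] has_derivative_linear by blast
  have linL: "linear (L w)" if "w \<in> W" for w
    by (rule linearI) (simp_all add: L_def linear_add[OF linh[OF that]] linear_cmul[OF linh[OF that]] algebra_simps)
  have detK: "\<bar>det_lin (K' x)\<bar> = snd x ^ (n - 1) * \<bar>det_lin (L (fst x))\<bar>" if "fst x \<in> W" "snd x \<ge> 0" for x
  proof -
    have "det_lin (\<lambda>u::'a \<times> real. (snd x *\<^sub>R fst u, snd u)) = (\<Prod>b\<in>(Basis :: ('a \<times> real) set). if b = (0, 1) then 1 else snd x)"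
      by (rule det_lin_diag) (auto simp: Basis_prod_def)
    also have "\<dots> = snd x ^ (n - 1)"
    proof -
      have Be: "(Basis :: ('a \<times> real) set) = insert (0, 1) ((\<lambda>u. (u, 0)) ` Basis)"
        by (auto simp: Basis_prod_def)
      have "(\<Prod>b\<in>(Basis :: ('a \<times> real) set). if b = (0, 1) then 1 else snd x)
          = (\<Prod>b\<in>(\<lambda>u::'a. (u, 0::real)) ` Basis. if b = (0, 1) then 1 else snd x)"
        unfolding Be by (subst prod.insert) auto
      also have "\<dots> = (\<Prod>b\<in>(Basis::'a set). snd x)"
        by (subst prod.reindex) (auto simp: inj_on_def)
      finally show ?thesis by (simp add: n)
    qed
    finally show ?thesis
      using det_lin_compose[OF linL[OF that(1)], of "\<lambda>u. (snd x *\<^sub>R fst u, snd u)"] that(2)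
      by (simp add: K'_def[abs_def] abs_mult)
  qed
  define S where "S = B \<times> {0<..1::real}"
  have S: "S \<in> sets borel"
    unfolding S_def using B by (intro borel_Times) auto
  define G where "G v = (hi (sgn v), norm v)" for v :: "'a \<times> real"
  define D where "D = {v \<in> cball 0 1 - {0}. sgn v \<in> h ` W}"
  have sm: "(sgn :: 'a \<times> real \<Rightarrow> 'a \<times> real) \<in> borel_measurable borel"
    by (simp add: sgn_div_norm[abs_def])
  have D: "D \<in> sets borel"
  proof -
    have "D = (cball 0 1 - {0}) \<inter> (sgn -` (h ` W) \<inter> space borel)" by (auto simp: D_def)
    then show ?thesis using measurable_sets[OF sm hW] by simp
  qed
  have contG: "continuous_on D G"
    unfolding G_def
    by (intro continuous_intros continuous_on_compose2[OF conthi]) (auto simp: D_def)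
  have sgnK: "sgn (K (w, t)) = h w" "norm (K (w, t)) = t" if "w \<in> W" "t > 0" for w t
    using that sph[OF that(1)] by (auto simp: K_def sgn_scaleR sgn_div_norm)
  have GK: "G (K (w, t)) = (w, t)" "K (w, t) \<in> D" if "w \<in> W" "0 < t" "t \<le> 1" for w t
    using sgnK[OF that(1,2)] that hih[OF that(1)] by (auto simp: G_def D_def simp del: norm_Pair)
  have KG: "K (G v) = v" "fst (G v) \<in> W" "0 < snd (G v)" "snd (G v) \<le> 1" if "v \<in> D" for v
  proof -
    obtain w where w: "w \<in> W" "sgn v = h w" using \<open>v \<in> D\<close> unfolding D_def by blast
    show "K (G v) = v"
      using w hih[OF w(1)] by (simp add: K_def G_def) (metis sgn_div_norm scaleR_one divideR_right norm_eq_zero scaleR_zero_left sgn_zero w(2))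
    show "fst (G v) \<in> W" using w hih[OF w(1)] by (simp add: G_def)
  qed (use that in \<open>auto simp: G_def D_def\<close>)
  have Kimg: "K ` A = G -` A \<inter> D" if "A \<subseteq> S" for A
  proof (intro equalityI subsetI)
    fix v assume "v \<in> K ` A"
    then obtain w t where wt: "v = K (w, t)" "(w, t) \<in> A" by auto
    then have "w \<in> W" "0 < t" "t \<le> 1" using that B(2) by (auto simp: S_def)
    from GK[OF this] wt show "v \<in> G -` A \<inter> D" by simp
  next
    fix v assume "v \<in> G -` A \<inter> D"
    then show "v \<in> K ` A" using KG(1)[of v] by (metis IntE image_eqI vimageE)
  qed
  have Kb: "K ` A \<in> sets borel" if "A \<in> sets borel" "A \<subseteq> S" for A
    unfolding Kimg[OF that(2)]
    using measurable_sets[OF borel_measurable_continuous_on_restrict[OF contG] that(1)] D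
    by (simp add: space_restrict_space sets_restrict_space_iff)
  have contL: "continuous_on W (\<lambda>w. \<bar>det_lin (L w)\<bar>)"
    unfolding L_def
  proof (intro continuous_on_rabs continuous_on_det_lin continuous_intros contw)
    fix b :: "'a \<times> real" assume "b \<in> Basis"
    then have "fst b \<in> Basis \<or> fst b = 0" by (auto simp: Basis_prod_def)
    then show "continuous_on W (\<lambda>w. h' w (fst b))"
    proof
      assume "fst b = 0"
      then have "\<And>w. w \<in> W \<Longrightarrow> 0 = h' w (fst b)" by (simp add: linear_0[OF linh])
      then show ?thesis by (rule continuous_on_eq[OF continuous_on_const])
    qed (rule cont)
  qed
  define l where "l w = indicator B w *\<^sub>R \<bar>det_lin (L w)\<bar>" for w
  have lm: "l \<in> borel_measurable borel"
    unfolding l_def by (rule borel_measurable_continuous_on_indicator[OF B(1) continuous_on_subset[OF contL B(2)]])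
  define k where "k x = ennreal (l (fst x)) * ennreal (indicator {0..1} (snd x) * snd x ^ (n - 1)) * indicator {0<..} (snd x)" for x
  have km: "k \<in> borel_measurable borel"
    unfolding k_def borel_prod[symmetric]
    by (intro borel_measurable_times_ennreal borel_measurable_indicator' measurable_compose[OF measurable_fst lm, THEN measurable_compose[OF _ measurable_ennreal]]
        measurable_compose[OF _ measurable_ennreal] borel_measurable_times borel_measurable_power) auto
  have kK: "ennreal \<bar>det_lin (K' x)\<bar> * indicator S x = k x" for x
  proof (cases "x \<in> S")
    case True
    then have "fst x \<in> B" "fst x \<in> W" "0 < snd x" "snd x \<le> 1" using B(2) by (auto simp: S_def)
    then show ?thesis
      using True detK[of x] by (simp add: k_def l_def ennreal_mult'[symmetric] mult.commute)
  next
    case False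
    then show ?thesis by (auto simp: k_def l_def S_def indicator_def mem_Times_iff)
  qed
  have hB: "h ` B = (hi -` B \<inter> h ` W)"
    using B(2) hih by (auto simp: image_iff)
  have hBb: "h ` B \<in> sets borel"
    unfolding hB
    using measurable_sets[OF borel_measurable_continuous_on_restrict[OF conthi] B(1)] hW
    by (simp add: space_restrict_space sets_restrict_space_iff)
  have cone: "{v \<in> cball 0 1 - {0}. sgn v \<in> h ` B} = K ` S"
    unfolding Kimg[OF order.refl]
  proof (intro equalityI subsetI)
    fix v assume v: "v \<in> {v \<in> cball 0 1 - {0}. sgn v \<in> h ` B}"
    then obtain w where w: "w \<in> B" "sgn v = h w" by auto
    then have "hi (sgn v) = w" using hih B(2) by auto
    then show "v \<in> G -` S \<inter> D" using v w B(2) by (auto simp: G_def S_def D_def)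
  next
    fix v assume v: "v \<in> G -` S \<inter> D"
    then obtain w where w: "w \<in> W" "sgn v = h w" unfolding D_def by blast
    with v have "w \<in> B" using hih by (auto simp: G_def S_def)
    with v w show "v \<in> {v \<in> cball 0 1 - {0}. sgn v \<in> h ` B}" by (auto simp: D_def)
  qed
  have "emeasure sphere_measure (h ` B) = ennreal (real n) * emeasure lborel (K ` S)"
  proof -
    have hS: "h ` B \<inter> sphere 0 1 = h ` B" using sph B(2) by auto
    show ?thesis
      using emeasure_sphere_measure[OF hBb] unfolding hS cone n_def .
  qed
  also have "emeasure lborel (K ` S) = (\<integral>\<^sup>+x\<in>S. ennreal \<bar>det_lin (K' x)\<bar> \<partial>lborel)"
  proof (rule emeasure_image_eq_nn_integral[OF S Kb])
    fix x assume "x \<in> S"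
    then have x: "fst x \<in> W" using B(2) by (auto simp: S_def)
    have "((\<lambda>x. h (fst x)) has_derivative (\<lambda>u. h' (fst x) (fst u))) (at x)"
      by (rule has_derivative_compose[where g = h and f = fst and f' = fst, OF _ der[OF x]])
        (auto intro!: derivative_eq_intros)
    then have "(K has_derivative (\<lambda>u. snd x *\<^sub>R h' (fst x) (fst u) + snd u *\<^sub>R h (fst x))) (at x)"
      unfolding K_def[abs_def] by (auto intro!: derivative_eq_intros)
    then have "(K has_derivative K' x) (at x)"
      by (rule has_derivative_eq_rhs) (simp add: K'_def L_def fun_eq_iff linear_cmul[OF linh[OF x]])
    then show "(K has_derivative K' x) (at x within S)" by (rule has_derivative_at_withinI)
  next
    show "inj_on K S"
      by (rule inj_on_inverseI[of _ G]) (use GK(1) B(2) in \<open>auto simp: S_def\<close>)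
    show "(\<lambda>x. ennreal \<bar>det_lin (K' x)\<bar> * indicator S x) \<in> borel_measurable borel"
      unfolding kK by (rule km)
  qed
  also have "\<dots> = (\<integral>\<^sup>+w. \<integral>\<^sup>+t. k (w, t) \<partial>lborel \<partial>lborel)"
    unfolding kK lborel_prod[symmetric]
    by (rule lborel.nn_integral_fst[symmetric]) (use km in \<open>simp add: lborel_prod\<close>)
  also have "\<dots> = (\<integral>\<^sup>+w. ennreal (l w) * emeasure (radial_measure n) {0<..} \<partial>lborel)"
  proof (intro nn_integral_cong)
    fix w
    have "(\<integral>\<^sup>+t. k (w, t) \<partial>lborel) = ennreal (l w) * (\<integral>\<^sup>+t. ennreal (indicator {0..1} t * t ^ (n - 1)) * indicator {0<..} t \<partial>lborel)"
      by (simp add: k_def mult.assoc nn_integral_cmult)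
    then show "(\<integral>\<^sup>+t. k (w, t) \<partial>lborel) = ennreal (l w) * emeasure (radial_measure n) {0<..}"
      by (simp add: radial_measure_def emeasure_density)
  qed
  also have "ennreal (real n) * \<dots> = (\<integral>\<^sup>+w. ennreal (l w) * (ennreal (real n) * emeasure (radial_measure n) {0<..}) \<partial>lborel)"
    using lm by (subst nn_integral_cmult[symmetric]) (auto simp: mult_ac)
  also have "ennreal (real n) * emeasure (radial_measure n) {0<..} = 1"
    using emeasure_radial_measure[OF n(2), of 0] n(2) by (simp add: power_0_left)
  finally show ?thesis
    by (simp add: l_def L_def[abs_def]) (intro nn_integral_cong, simp add: indicator_def)
qed

text \<open>Inverse stereographic projection from the pole \<open>(0, \<epsilon>)\<close>. The signs
  \<epsilon> = 1 and \<epsilon> = -1 give two charts that together cover the sphere.\<close>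

definition stereo :: "real \<Rightarrow> 'a::euclidean_space \<Rightarrow> 'a \<times> real" where
  "stereo \<epsilon> w = ((2 / (1 + w \<bullet> w)) *\<^sub>R w, \<epsilon> * (w \<bullet> w - 1) / (1 + w \<bullet> w))"

definition stereo_inv :: "real \<Rightarrow> 'a::euclidean_space \<times> real \<Rightarrow> 'a" where
  "stereo_inv \<epsilon> u = (1 / (1 - \<epsilon> * snd u)) *\<^sub>R fst u"

lemma stereo_denominator_pos: "1 + w \<bullet> w > 0"
  by (simp add: add_pos_nonneg)

lemma norm_stereo:
  assumes "\<epsilon>\<^sup>2 = 1"
  shows "norm (stereo \<epsilon> w) = 1"
proof -
  have "stereo \<epsilon> w \<bullet> stereo \<epsilon> w = (4 * (w \<bullet> w) + \<epsilon>\<^sup>2 * (w \<bullet> w - 1)\<^sup>2) / (1 + w \<bullet> w)\<^sup>2"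
    by (simp add: stereo_def inner_prod_def power2_eq_square add_divide_distrib)
  also have "\<dots> = 1"
  proof -
    have "4 * (w \<bullet> w) + 1 * (w \<bullet> w - 1)\<^sup>2 = (1 + w \<bullet> w)\<^sup>2"
      by (simp add: power2_eq_square algebra_simps)
    then show ?thesis
      unfolding assms using stereo_denominator_pos[of w] by simp
  qed
  finally show ?thesis by (simp add: norm_eq_1)
qed

lemma stereo_snd_neq:
  assumes "\<epsilon>\<^sup>2 = 1"
  shows "1 - \<epsilon> * snd (stereo \<epsilon> w) = 2 / (1 + w \<bullet> w)"
proof -
  have "\<epsilon> * snd (stereo \<epsilon> w) = \<epsilon>\<^sup>2 * ((w \<bullet> w - 1) / (1 + w \<bullet> w))"
    by (simp add: stereo_def power2_eq_square)
  then show ?thesis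
    unfolding assms using stereo_denominator_pos[of w] by (simp add: field_simps)
qed

lemma stereo_inv_stereo:
  assumes "\<epsilon>\<^sup>2 = 1"
  shows "stereo_inv \<epsilon> (stereo \<epsilon> w) = w"
proof -
  have "1 / (2 / (1 + w \<bullet> w)) * (2 / (1 + w \<bullet> w)) = 1"
    using stereo_denominator_pos[of w] by simp
  then show ?thesis
    unfolding stereo_inv_def stereo_snd_neq[OF assms] by (simp only: stereo_def fst_conv scaleR_scaleR scaleR_one)
qed

lemma stereo_stereo_inv:
  assumes "\<epsilon>\<^sup>2 = 1" "norm u = 1" "\<epsilon> * snd u \<noteq> 1"
  shows "stereo \<epsilon> (stereo_inv \<epsilon> u) = u"
proof -
  define s where "s = \<epsilon> * snd u"
  have s: "1 - s \<noteq> 0" using assms(3) by (simp add: s_def)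
  have es: "\<epsilon> * s = snd u" using assms(1) by (simp add: s_def power2_eq_square mult.assoc[symmetric])
  have "u \<bullet> u = 1" using assms(2) by (simp add: norm_eq_1)
  moreover have "snd u * snd u = s\<^sup>2"
    using assms(1) by (simp add: s_def power_mult_distrib power2_eq_square)
  ultimately have q: "fst u \<bullet> fst u = (1 - s) * (1 + s)" by (simp add: inner_prod_def power2_eq_square algebra_simps)
  let ?w = "stereo_inv \<epsilon> u"
  have ww: "?w \<bullet> ?w = (1 + s) / (1 - s)"
    using s by (simp add: stereo_inv_def s_def[symmetric] q)
  have w1: "1 + ?w \<bullet> ?w = 2 / (1 - s)" "?w \<bullet> ?w - 1 = 2 * s / (1 - s)"
    unfolding ww using s by (simp_all add: field_simps)
  show ?thesis
    unfolding stereo_def w1 using s es by (simp add: stereo_inv_def s_def[symmetric] prod_eq_iff mult.assoc[symmetric])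
qed

lemma smooth_on_stereo: "smooth_on UNIV (stereo \<epsilon>)"
  unfolding stereo_def[abs_def]
  by (intro smooth_intros) (auto simp: stereo_denominator_pos less_imp_neq[THEN not_sym])

lemma geodesic_unit_sphere_poles:
  fixes u :: "'a::euclidean_space \<times> real"
  assumes "norm u = 1" "snd u = 1 \<or> snd u = - 1"
  shows "fst u = 0"
proof -
  have "u \<bullet> u = 1" using assms(1) by (simp add: norm_eq_1)
  then show ?thesis using assms(2) by (auto simp: inner_prod_def)
qed

context polar_chart
begin

text \<open>The density of the geodesic sphere of radius \<open>r\<close> with respect to the unit
  sphere of directions. With n = \<open>DIM('a \<times> real)\<close> it is 2^(n-1) sinh(r/2)^(n-1)
  cosh(r/2)^(2Q-n+1), which for a Damek--Ricci space becomes 2^(m+k) sinh(r/2)^(m+k)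
  cosh(r/2)^k.\<close>

definition A :: "real \<Rightarrow> real" where
  "A r = 2 ^ (DIM('a \<times> real) - 1) * tanh (r / 2) ^ (DIM('a \<times> real) - 1) * (1 - (tanh (r / 2))\<^sup>2) powr - Q"

lemma tanh_sq_less_1: "(tanh (r / 2 :: real))\<^sup>2 < 1"
  using tanh_real_bounds[of "r / 2"] by (simp add: abs_square_less_1 abs_less_iff)

text \<open>The Gram matrix of the parametrization, bordered by the radial vector, which is orthogonal
  to it, has determinant \<open>(det_lin (T v \<circ> M))\<^sup>2\<close>.\<close>

lemma sqrt_Gram:
  assumes W: "open W" "w \<in> W" and \<phi>: "\<And>w. w \<in> W \<Longrightarrow> (\<phi> has_derivative \<phi>' w) (at w)"
    and r: "r > 0" and sph: "\<And>w. w \<in> W \<Longrightarrow> norm (F (\<phi> w)) = tanh (r / 2)"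
  shows "sqrt (det_Basis (\<lambda>i j. g (\<phi> w) (\<phi>' w i) (\<phi>' w j))) =
    A r * \<bar>det_lin (\<lambda>u. (1 / tanh (r / 2)) *\<^sub>R DF (\<phi> w) (\<phi>' w (fst u)) + snd u *\<^sub>R ((1 / tanh (r / 2)) *\<^sub>R F (\<phi> w)))\<bar>"
proof -
  define \<tau> where "\<tau> = tanh (r / 2)"
  have \<tau>: "\<tau> > 0" using r by (simp add: \<tau>_def)
  have q: "1 - \<tau>\<^sup>2 > 0" using tanh_sq_less_1[of r] by (simp add: \<tau>_def)
  let ?v = "F (\<phi> w)" and ?v' = "\<lambda>u. DF (\<phi> w) (\<phi>' w u)"
  have nv: "norm ?v = \<tau>" using sph[OF W(2)] by (simp add: \<tau>_def)
  have v: "norm ?v < 1" by (rule norm_F)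
  have lin': "linear (\<phi>' w)" using \<phi>[OF W(2)] has_derivative_linear by blast
  have linv': "linear ?v'" using linear_compose[OF lin' linear_DF] by (simp add: o_def)
  define M where "M u = (1 / \<tau>) *\<^sub>R ?v' (fst u) + snd u *\<^sub>R ((1 / \<tau>) *\<^sub>R ?v)" for u
  define N where "N u = T ?v (?v' (fst u) + snd u *\<^sub>R ?v)" for u
  have linM: "linear M"
    by (rule linearI) (simp_all add: M_def linear_add[OF linv'] linear_cmul[OF linv'] algebra_simps)
  \<comment> \<open>\<open>F (\<phi> w)\<close> stays on a Euclidean sphere, so its derivative is
    orthogonal to it; by the Gauss identity the corresponding vectors in the frame are then
    orthogonal to \<open>T ?v ?v\<close>.\<close>
  have orth: "?v \<bullet> ?v' u = 0" for u
  proof -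
    have d: "((\<lambda>w. F (\<phi> w)) has_derivative ?v') (at w)"
      by (rule has_derivative_compose[OF \<phi>[OF W(2)] F_has_derivative])
    have "((\<lambda>w. F (\<phi> w) \<bullet> F (\<phi> w)) has_derivative (\<lambda>u. ?v \<bullet> ?v' u + ?v' u \<bullet> ?v)) (at w)"
      by (rule has_derivative_inner[OF d d])
    then have "((\<lambda>_. \<tau>\<^sup>2) has_derivative (\<lambda>u. ?v \<bullet> ?v' u + ?v' u \<bullet> ?v)) (at w)"
      by (rule has_derivative_transform_within_open[OF _ W])
        (use sph in \<open>simp add: \<tau>_def power2_norm_eq_inner[symmetric]\<close>)
    from has_derivative_unique[OF this has_derivative_const]
    have "?v \<bullet> ?v' u + ?v' u \<bullet> ?v = 0" by metis
    then show ?thesis by (simp add: inner_commute)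
  qed
  have Nb: "N (b, 0) = Di (\<phi> w) (\<phi>' w b)" for b
    by (simp add: N_def T_def)
  have N1: "N (0, 1) = T ?v ?v"
    by (simp add: N_def linear_0[OF linv'])
  have "(det_lin N)\<^sup>2 = det_Basis (\<lambda>i j. N i \<bullet> N j)"
    by (rule det_Basis_Gram[symmetric])
  also have "\<dots> = (norm (T ?v ?v))\<^sup>2 * det_Basis (\<lambda>i j. g (\<phi> w) (\<phi>' w i) (\<phi>' w j))"
  proof -
    have "N (0, 1) \<bullet> N (b, 0) = 0" for b
      using T_inner[OF v, of "?v' b"] unfolding N1 by (simp add: N_def orth)
    then show ?thesis
      by (subst det_Basis_prod_real) (simp_all add: N1 Nb g_eq power2_norm_eq_inner)
  qed
  finally have sq: "(det_lin N)\<^sup>2 = (norm (T ?v ?v))\<^sup>2 * det_Basis (\<lambda>i j. g (\<phi> w) (\<phi>' w i) (\<phi>' w j))" .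
  have "N = (\<lambda>u. T ?v (\<tau> *\<^sub>R M u))"
    using \<tau> by (simp add: N_def M_def fun_eq_iff scaleR_add_right)
  then have "det_lin N = det_lin (T ?v) * det_lin (\<lambda>u. \<tau> *\<^sub>R M u)"
    using det_lin_compose[OF linear_T[OF v], of "\<lambda>u. \<tau> *\<^sub>R M u"] by simp
  also have "det_lin (\<lambda>u. \<tau> *\<^sub>R M u) = \<tau> ^ DIM('a \<times> real) * det_lin M"
  proof -
    have "linear (\<lambda>u::'a \<times> real. \<tau> *\<^sub>R u)" by (rule linear_scaleR)
    moreover have "det_lin (\<lambda>u::'a \<times> real. \<tau> *\<^sub>R u) = \<tau> ^ DIM('a \<times> real)"
      by (subst det_lin_diag[where c = "\<lambda>_. \<tau>"]) auto
    ultimately show ?thesis using det_lin_compose[of "\<lambda>u. \<tau> *\<^sub>R u" M] by simp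
  qed
  finally have dN: "\<bar>det_lin N\<bar> = 2 ^ DIM('a \<times> real) * (1 - \<tau>\<^sup>2) powr - (Q + 1) * (\<tau> ^ DIM('a \<times> real) * \<bar>det_lin M\<bar>)"
    using jac[OF v] \<tau> unfolding T_def[symmetric] nv by (simp add: abs_mult T_def[abs_def])
  have nT: "norm (T ?v ?v) = 2 * \<tau> / (1 - \<tau>\<^sup>2)"
    using norm_T[OF v] by (simp add: nv)
  then have "norm (T ?v ?v) > 0" using \<tau> q by simp
  then have "sqrt (det_Basis (\<lambda>i j. g (\<phi> w) (\<phi>' w i) (\<phi>' w j))) = \<bar>det_lin N\<bar> / norm (T ?v ?v)"
    using arg_cong[OF sq, of sqrt] by (simp add: real_sqrt_mult)
  also have "\<dots> = A r * \<bar>det_lin M\<bar>"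
  proof -
    \<comment> \<open>The radial length \<open>2 * \<tau> / (1 - \<tau>^2)\<close> takes a factor 2,
      a factor \<tau> and a factor \<open>1 / (1 - \<tau>^2)\<close> out of the volume density;
      \<open>A r\<close> is what remains.\<close>
    obtain m where m: "DIM('a \<times> real) = Suc m" using DIM_positive gr0_implies_Suc by blast
    have "(1 - \<tau>\<^sup>2) powr - (Q + 1) * (1 - \<tau>\<^sup>2) = (1 - \<tau>\<^sup>2) powr - Q"
      using q powr_add[of "1 - \<tau>\<^sup>2" "- (Q + 1)" 1] by simp
    moreover have "2 ^ Suc m * p * (\<tau> ^ Suc m * X) / (2 * \<tau> / (1 - \<tau>\<^sup>2)) = 2 ^ m * \<tau> ^ m * (p * (1 - \<tau>\<^sup>2)) * X" for p X
      using \<tau> q by (simp add: field_simps)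
    ultimately show ?thesis
      unfolding dN nT A_def m \<tau>_def[symmetric] by simp
  qed
  finally show ?thesis
    by (simp add: M_def[abs_def] \<tau>_def)
qed

end

context polar_chart
begin

lemma continuous_on_E: "continuous_on (ball 0 1) E"
  by (rule smooth_on_imp_continuous_on[OF smooth_E])

lemma continuous_on_ray_sphere: "continuous_on (sphere 0 1) (ray r)"
  unfolding ray_def
proof (rule continuous_on_compose2[OF continuous_on_E])
  show "(\<lambda>\<omega>. tanh (r / 2) *\<^sub>R \<omega>) ` sphere (0 :: 'a \<times> real) 1 \<subseteq> ball 0 1"
  proof (intro image_subsetI)
    fix \<omega> :: "'a \<times> real" assume "\<omega> \<in> sphere 0 1"
    then have "norm \<omega> \<le> 1" by (simp only: mem_sphere_0)
    then show "tanh (r / 2) *\<^sub>R \<omega> \<in> ball 0 1"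
      unfolding mem_ball_0 by (rule norm_tanh_scaleR)
  qed
qed (intro continuous_intros)

lemma A_pos: "r > 0 \<Longrightarrow> A r > 0"
  using tanh_sq_less_1[of r] by (simp add: A_def)

lemma F_ray: "norm \<omega> \<le> 1 \<Longrightarrow> F (ray r \<omega>) = tanh (r / 2) *\<^sub>R \<omega>"
  unfolding ray_def by (rule F_E[OF norm_tanh_scaleR])

definition Sph where "Sph r = {p. norm (F p) = tanh (r / 2)}"

text \<open>The explicit measure that turns out to satisfy the definite description in
  \<open>surface_measure\<close>.\<close>

definition \<mu> where
  "\<mu> r = distr (density sphere_measure (\<lambda>_. ennreal (A r))) (restrict_space borel (Sph r)) (ray r)"

lemma ray_Sph: "r > 0 \<Longrightarrow> norm \<omega> = 1 \<Longrightarrow> ray r \<omega> \<in> Sph r"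
  by (simp add: Sph_def F_ray)

lemma closed_Sph: "closed (Sph r)"
proof -
  have "closed ((\<lambda>p. norm (F p)) -` {tanh (r / 2)})"
    by (intro continuous_closed_vimage continuous_intros) (use continuous_on_F[of UNIV] in \<open>simp add: continuous_on_eq_continuous_at\<close>)
  moreover have "(\<lambda>p. norm (F p)) -` {tanh (r / 2)} = Sph r" by (auto simp: Sph_def)
  ultimately show ?thesis by simp
qed

lemma ray_measurable:
  assumes "r > 0"
  shows "ray r \<in> measurable sphere_measure (restrict_space borel (Sph r))"
  using sphere_measure.borel_measurable_continuous[of "ray r"] continuous_on_ray_sphere ray_Sph[OF assms]
  by (intro measurable_restrict_space2) auto

lemma emeasure_\<mu>:
  assumes "r > 0" "X \<in> sets (restrict_space borel (Sph r))"
  shows "emeasure (\<mu> r) X = ennreal (A r) * emeasure sphere_measure {\<omega> \<in> sphere 0 1. ray r \<omega> \<in> X}"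
proof -
  have m: "ray r \<in> measurable (density sphere_measure (\<lambda>_. ennreal (A r))) (restrict_space borel (Sph r))"
    using ray_measurable[OF assms(1)] by simp
  have "ray r -` X \<inter> sphere 0 1 = {\<omega> \<in> sphere 0 1. ray r \<omega> \<in> X}" by auto
  then show ?thesis
    using measurable_sets[OF ray_measurable[OF assms(1)] assms(2)]
    unfolding \<mu>_def by (subst emeasure_distr[OF m assms(2)]) (simp add: emeasure_density_const)
qed

lemma local_parametrization_image_measurable:
  assumes "local_parametrization (Sph r) W \<phi>" "B \<in> sets borel" "B \<subseteq> W"
  shows "\<phi> ` B \<in> sets (restrict_space borel (Sph r))"
proof -
  obtain \<psi> where op: "openin (top_of_set (Sph r)) (\<phi> ` W)" and ho: "homeomorphism W (\<phi> ` W) \<phi> \<psi>"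
    using assms(1) unfolding local_parametrization_def by blast
  have \<phi>W: "\<phi> ` W \<in> sets borel"
    using op closed_Sph by (auto simp: openin_open)
  have "\<phi> ` B = \<psi> -` B \<inter> \<phi> ` W"
    using ho assms(3) by (auto simp: homeomorphism_def image_iff)
  moreover have "\<psi> -` B \<inter> \<phi> ` W \<in> sets borel"
    using measurable_sets[OF borel_measurable_continuous_on_restrict assms(2), of "\<phi> ` W" \<psi>] ho \<phi>W
    by (simp add: homeomorphism_def space_restrict_space sets_restrict_space_iff)
  moreover have "\<phi> ` B \<subseteq> Sph r"
    using openin_imp_subset[OF op] assms(3) by blast
  ultimately show ?thesis
    using closed_Sph by (simp add: sets_restrict_space_iff)
qed

text \<open>Dividing \<open>F (\<phi> w)\<close> by \<open>tanh (r / 2)\<close> turns \<phi> into a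
  parametrization of the Euclidean unit sphere, to which the cone computation applies. By
  \<open>sqrt_Gram\<close> the two densities differ by the constant factor
  \<open>A r\<close>.\<close>

lemma emeasure_\<mu>_local_parametrization:
  assumes r: "r > 0" and lp: "local_parametrization (Sph r) W \<phi>" and B: "B \<in> sets borel" "B \<subseteq> W"
  shows "emeasure (\<mu> r) (\<phi> ` B) = (\<integral>\<^sup>+ w\<in>B. ennreal (sqrt (det_Basis (\<lambda>i j.
      g (\<phi> w) (frechet_derivative \<phi> (at w) i) (frechet_derivative \<phi> (at w) j)))) \<partial>lborel)"
proof -
  have W: "open W" and sm: "smooth_on W \<phi>" and op: "openin (top_of_set (Sph r)) (\<phi> ` W)"
    using lp unfolding local_parametrization_def by auto
  obtain \<psi> where ho: "homeomorphism W (\<phi> ` W) \<phi> \<psi>"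
    using lp unfolding local_parametrization_def by blast
  have \<phi>S: "norm (F (\<phi> w)) = tanh (r / 2)" if "w \<in> W" for w
    using openin_imp_subset[OF op] that by (auto simp: Sph_def)
  let ?\<phi>' = "\<lambda>w. frechet_derivative \<phi> (at w)"
  have d\<phi>: "(\<phi> has_derivative ?\<phi>' w) (at w)" if "w \<in> W" for w
    by (rule smooth_on_has_derivative[OF sm that])
  define c where "c = 1 / tanh (r / 2)"
  have c: "c > 0" "c * tanh (r / 2) = 1" using r by (simp_all add: c_def)
  define h where "h w = c *\<^sub>R F (\<phi> w)" for w
  define h' where "h' w u = c *\<^sub>R DF (\<phi> w) (?\<phi>' w u)" for w u
  have hray: "ray r (h w) = \<phi> w" if "w \<in> W" for w
    using c by (simp add: ray_def h_def mult.commute)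
  have hsph: "norm (h w) = 1" if "w \<in> W" for w
    using \<phi>S[OF that] c by (simp add: h_def)
  have hF: "h w = \<omega> \<longleftrightarrow> \<phi> w = ray r \<omega>" if "w \<in> W" "norm \<omega> = 1" for w \<omega>
    using hray[OF that(1)] c F_ray[of \<omega> r] that by (auto simp: h_def)
  have dh: "(h has_derivative h' w) (at w)" if "w \<in> W" for w
    unfolding h_def[abs_def] h'_def[abs_def]
    by (intro has_derivative_scaleR_right has_derivative_compose[OF d\<phi>[OF that] F_has_derivative])
  have smh: "smooth_on W h"
  proof -
    have "smooth_on W (\<lambda>w. F (\<phi> w))"
      by (rule smooth_on_compose[OF W open_UNIV sm smooth_F]) auto
    then show ?thesis unfolding h_def[abs_def] by (intro smooth_intros W)
  qed
  have conth': "continuous_on W (\<lambda>w. h' w b)" for b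
    by (rule continuous_on_eq[OF smooth_on_imp_continuous_on[OF smooth_on_frechet_derivative[OF smh, of b]]])
      (use frechet_derivative_at[OF dh] in metis)
  have img: "h ` W = {\<omega> \<in> sphere 0 1. ray r \<omega> \<in> \<phi> ` W}"
    using hsph hF by (auto simp: image_iff) (metis hray)+
  have "homeomorphism W (h ` W) h (\<lambda>\<omega>. \<psi> (ray r \<omega>))"
    unfolding homeomorphism_def
  proof (intro conjI ballI)
    show "continuous_on W h" by (rule smooth_on_imp_continuous_on[OF smh])
    show "continuous_on (h ` W) (\<lambda>\<omega>. \<psi> (ray r \<omega>))"
    proof (rule continuous_on_compose2[of "\<phi> ` W" \<psi>])
      show "continuous_on (h ` W) (ray r)"
        by (rule continuous_on_subset[OF continuous_on_ray_sphere]) (use img in blast)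
    qed (use ho img in \<open>auto simp: homeomorphism_def\<close>)
    show "\<psi> (ray r (h w)) = w" if "w \<in> W" for w
      using ho that by (simp add: hray homeomorphism_def)
    show "h (\<psi> (ray r \<omega>)) = \<omega>" if "\<omega> \<in> h ` W" for \<omega>
      using ho that by (auto simp: hray homeomorphism_def)
    show "(\<lambda>\<omega>. \<psi> (ray r \<omega>)) ` h ` W = W"
      using ho by (auto simp: hray homeomorphism_def image_iff)
  qed simp
  moreover have "openin (top_of_set (sphere 0 1)) (h ` W)"
  proof -
    obtain O' where O': "open O'" "\<phi> ` W = Sph r \<inter> O'" using op by (auto simp: openin_open)
    have "h ` W = sphere 0 1 \<inter> ray r -` O'"
    proof -
      have "ray r \<omega> \<in> Sph r" if "\<omega> \<in> sphere 0 1" for \<omega>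
        using ray_Sph[OF r] that by simp
      then show ?thesis unfolding img O'(2) by blast
    qed
    then show ?thesis
      using continuous_openin_preimage_gen[OF continuous_on_ray_sphere O'(1)] by simp
  qed
  ultimately have eh: "emeasure sphere_measure (h ` B) =
      (\<integral>\<^sup>+w\<in>B. ennreal \<bar>det_lin (\<lambda>u. h' w (fst u) + snd u *\<^sub>R h w)\<bar> \<partial>lborel)"
    by (intro emeasure_sphere_measure_image[OF W hsph dh conth' _ _ B])
  have "emeasure (\<mu> r) (\<phi> ` B) = ennreal (A r) * emeasure sphere_measure (h ` B)"
  proof -
    have "{\<omega> \<in> sphere 0 1. ray r \<omega> \<in> \<phi> ` B} = h ` B"
      using hsph hF B(2) by (auto simp: image_iff subset_iff) (metis hray)+
    then show ?thesis
      using emeasure_\<mu>[OF r local_parametrization_image_measurable[OF lp B]] by simp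
  qed
  also have "\<dots> = (\<integral>\<^sup>+w. ennreal (A r) * (ennreal \<bar>det_lin (\<lambda>u. h' w (fst u) + snd u *\<^sub>R h w)\<bar> * indicator B w) \<partial>lborel)"
  proof -
    have cL: "continuous_on B (\<lambda>w. \<bar>det_lin (\<lambda>u. h' w (fst u) + snd u *\<^sub>R h w)\<bar>)"
      by (intro continuous_on_rabs continuous_on_det_lin continuous_intros
          continuous_on_subset[OF conth' B(2)] continuous_on_subset[OF smooth_on_imp_continuous_on[OF smh] B(2)])
    have "(\<lambda>w. indicator B w *\<^sub>R \<bar>det_lin (\<lambda>u. h' w (fst u) + snd u *\<^sub>R h w)\<bar>) \<in> borel_measurable borel"
      by (rule borel_measurable_continuous_on_indicator[OF B(1) cL])
    then have "(\<lambda>w. ennreal (indicator B w *\<^sub>R \<bar>det_lin (\<lambda>u. h' w (fst u) + snd u *\<^sub>R h w)\<bar>)) \<in> borel_measurable lborel"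
      by simp
    moreover have e: "ennreal (indicator B w *\<^sub>R \<bar>det_lin (\<lambda>u. h' w (fst u) + snd u *\<^sub>R h w)\<bar>)
        = ennreal \<bar>det_lin (\<lambda>u. h' w (fst u) + snd u *\<^sub>R h w)\<bar> * indicator B w" for w
      by (simp add: indicator_def)
    ultimately have "(\<lambda>w. ennreal \<bar>det_lin (\<lambda>u. h' w (fst u) + snd u *\<^sub>R h w)\<bar> * indicator B w) \<in> borel_measurable lborel"
      unfolding e by blast
    then show ?thesis
      unfolding eh by (rule nn_integral_cmult[symmetric])
  qed
  also have "\<dots> = (\<integral>\<^sup>+ w\<in>B. ennreal (sqrt (det_Basis (\<lambda>i j. g (\<phi> w) (?\<phi>' w i) (?\<phi>' w j)))) \<partial>lborel)"
  proof (intro nn_integral_cong)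
    fix w
    show "ennreal (A r) * (ennreal \<bar>det_lin (\<lambda>u. h' w (fst u) + snd u *\<^sub>R h w)\<bar> * indicator B w)
      = ennreal (sqrt (det_Basis (\<lambda>i j. g (\<phi> w) (?\<phi>' w i) (?\<phi>' w j)))) * indicator B w"
    proof (cases "w \<in> B")
      case True
      then have w: "w \<in> W" using B(2) by blast
      have "sqrt (det_Basis (\<lambda>i j. g (\<phi> w) (?\<phi>' w i) (?\<phi>' w j)))
          = A r * \<bar>det_lin (\<lambda>u. h' w (fst u) + snd u *\<^sub>R h w)\<bar>"
        unfolding h_def h'_def c_def by (rule sqrt_Gram[OF W w d\<phi> r \<phi>S])
      then show ?thesis
        using A_pos[OF r] True by (simp add: ennreal_mult)
    qed simp
  qed
  finally show ?thesis .
qed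

text \<open>The derivative of the chart is injective because the chart has a differentiable left
  inverse, built from \<open>F\<close> and \<open>stereo_inv\<close>.\<close>

lemma local_parametrization_stereo:
  assumes r: "r > 0" and \<epsilon>: "\<epsilon>\<^sup>2 = 1"
  shows "local_parametrization (Sph r) UNIV (\<lambda>w. ray r (stereo \<epsilon> w))"
    and "range (\<lambda>w. ray r (stereo \<epsilon> w)) = Sph r - {ray r (0, \<epsilon>)}"
proof -
  define c where "c = 1 / tanh (r / 2)"
  have c: "c > 0" "c * tanh (r / 2) = 1" using r by (simp_all add: c_def)
  let ?\<phi> = "\<lambda>w. ray r (stereo \<epsilon> w)" and ?\<psi> = "\<lambda>p. stereo_inv \<epsilon> (c *\<^sub>R F p)"
  have n1: "norm (stereo \<epsilon> w) = 1" for w :: 'a by (rule norm_stereo[OF \<epsilon>])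
  have cF: "c *\<^sub>R F (ray r \<omega>) = \<omega>" if "norm \<omega> = 1" for \<omega>
    using that c by (simp add: F_ray)
  have rF: "ray r (c *\<^sub>R F p) = p" for p
    using c by (simp add: ray_def mult.commute)
  have \<psi>\<phi>: "?\<psi> (?\<phi> w) = w" for w
    by (simp add: cF[OF n1] stereo_inv_stereo[OF \<epsilon>])
  have ee: "\<epsilon> * \<epsilon> = 1" using \<epsilon> by (simp add: power2_eq_square)
  have nz: "1 - \<epsilon> * snd (c *\<^sub>R F p) \<noteq> 0" if "p \<in> Sph r - {ray r (0, \<epsilon>)}" for p
  proof
    let ?\<omega> = "c *\<^sub>R F p"
    assume "1 - \<epsilon> * snd ?\<omega> = 0"
    then have "\<epsilon> * (\<epsilon> * snd ?\<omega>) = \<epsilon>" by simp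
    then have s: "snd ?\<omega> = \<epsilon>" by (simp only: mult.assoc[symmetric] ee mult_1)
    have n: "norm ?\<omega> = 1" using that c by (simp add: Sph_def)
    have "\<epsilon> = 1 \<or> \<epsilon> = - 1" using \<epsilon> by (simp add: power2_eq_1_iff)
    then have "fst ?\<omega> = 0" using geodesic_unit_sphere_poles[OF n] s by auto
    then have "?\<omega> = (0, \<epsilon>)" using s by (simp add: prod_eq_iff)
    then show False using that rF[of p] by auto
  qed
  have \<phi>\<psi>: "?\<phi> (?\<psi> p) = p" if "p \<in> Sph r - {ray r (0, \<epsilon>)}" for p
  proof -
    have "norm (c *\<^sub>R F p) = 1" using that c by (simp add: Sph_def)
    then show ?thesis using nz[OF that] by (simp add: stereo_stereo_inv[OF \<epsilon>] rF)
  qed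
  have \<phi>in: "?\<phi> w \<in> Sph r - {ray r (0, \<epsilon>)}" for w
  proof -
    have "\<epsilon> * snd (stereo \<epsilon> w) \<noteq> 1"
      using stereo_snd_neq[OF \<epsilon>, of w] stereo_denominator_pos[of w] by auto
    then have "stereo \<epsilon> w \<noteq> (0, \<epsilon>)" using ee by auto
    moreover have "norm (0::'a, \<epsilon>) = 1" using \<epsilon> by (auto simp: power2_eq_1_iff)
    ultimately have "?\<phi> w \<noteq> ray r (0, \<epsilon>)" using cF n1 by metis
    then show ?thesis using ray_Sph[OF r n1] by simp
  qed
  show rng: "range ?\<phi> = Sph r - {ray r (0, \<epsilon>)}"
  proof (intro equalityI subsetI)
    fix p assume "p \<in> Sph r - {ray r (0, \<epsilon>)}"
    then show "p \<in> range ?\<phi>" using \<phi>\<psi>[of p] by (metis rangeI)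
  next
    fix p assume "p \<in> range ?\<phi>"
    then obtain w where "p = ?\<phi> w" by blast
    then show "p \<in> Sph r - {ray r (0, \<epsilon>)}" using \<phi>in by simp
  qed
  have sm: "smooth_on UNIV ?\<phi>"
  proof -
    have s1: "smooth_on UNIV (\<lambda>w::'a. (r, stereo \<epsilon> w))"
      by (intro smooth_intros smooth_on_stereo open_UNIV)
    have s2: "(\<lambda>w. (r, stereo \<epsilon> w)) ` UNIV \<subseteq> ray_domain"
      using ray_domain_sphere[OF eq_refl[OF n1]] by blast
    show ?thesis using smooth_on_compose[OF open_UNIV open_ray_domain s1 smooth_ray s2] by simp
  qed
  have c\<psi>: "continuous_on (Sph r - {ray r (0, \<epsilon>)}) ?\<psi>"
    unfolding stereo_inv_def using nz by (intro continuous_intros continuous_on_F) auto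
  show "local_parametrization (Sph r) UNIV ?\<phi>"
    unfolding local_parametrization_def
  proof (intro conjI ballI)
    show "openin (top_of_set (Sph r)) (range ?\<phi>)"
    proof -
      have "norm (0::'a, \<epsilon>) = 1" using \<epsilon> by (auto simp: power2_eq_1_iff)
      then show ?thesis
        unfolding rng using ray_Sph[OF r, of "(0, \<epsilon>)"] by (intro openin_diff) auto
    qed
    have "homeomorphism UNIV (range ?\<phi>) ?\<phi> ?\<psi>"
      unfolding homeomorphism_def
      using \<psi>\<phi> c\<psi> smooth_on_imp_continuous_on[OF sm] \<phi>\<psi> unfolding rng[symmetric]
      by (auto simp: image_iff)
    then show "\<exists>\<psi>. homeomorphism UNIV (range ?\<phi>) ?\<phi> \<psi>" by blast
    fix w
    show "inj (frechet_derivative ?\<phi> (at w))"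
    proof -
      let ?p = "?\<phi> w"
      have d\<phi>: "(?\<phi> has_derivative frechet_derivative ?\<phi> (at w)) (at w)"
        by (rule smooth_on_has_derivative[OF sm]) simp
      have "?\<psi> differentiable (at ?p)"
      proof -
        have dF: "(F has_derivative DF ?p) (at ?p)" by (rule F_has_derivative)
        have "(\<lambda>p. c *\<^sub>R F p) differentiable (at ?p)"
          using has_derivative_scaleR_right[OF dF] by (auto simp: differentiable_def)
        moreover have "stereo_inv \<epsilon> differentiable (at (c *\<^sub>R F ?p))"
        proof -
          have nz': "1 - \<epsilon> * snd (c *\<^sub>R F ?p) \<noteq> 0" by (rule nz[OF \<phi>in])
          have "snd differentiable (at (c *\<^sub>R F ?p))" "fst differentiable (at (c *\<^sub>R F ?p))"
            by (auto simp: differentiable_def intro!: bounded_linear_imp_has_derivative bounded_linear_fst bounded_linear_snd)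
          then show ?thesis
            unfolding stereo_inv_def using nz' by (intro derivative_intros differentiable_scaleR) auto
        qed
        ultimately show ?thesis
          using differentiable_chain_at[of "\<lambda>p. c *\<^sub>R F p" ?p "stereo_inv \<epsilon>"] by (simp add: o_def)
      qed
      then obtain \<psi>' where d\<psi>: "(?\<psi> has_derivative \<psi>') (at ?p)" by (auto simp: differentiable_def)
      have "((\<lambda>w. ?\<psi> (?\<phi> w)) has_derivative (\<lambda>u. \<psi>' (frechet_derivative ?\<phi> (at w) u))) (at w)"
        by (rule has_derivative_compose[OF d\<phi> d\<psi>])
      then have "((\<lambda>w. w) has_derivative (\<lambda>u. \<psi>' (frechet_derivative ?\<phi> (at w) u))) (at w)"
        by (simp only: \<psi>\<phi>)
      from has_derivative_unique[OF this has_derivative_ident]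
      have "\<psi>' (frechet_derivative ?\<phi> (at w) u) = u" for u by metis
      then show ?thesis by (rule inj_on_inverseI)
    qed
  qed (use sm in auto)
qed

text \<open>Uniqueness in the definite description holds because the integral formula determines a
  measure on the image of every chart, and two stereographic charts cover the sphere.\<close>

lemma surface_measure_eq:
  assumes r: "r > 0"
  shows "surface_measure g (geodesic_sphere g (E 0) r) = \<mu> r"
proof -
  have Sp: "geodesic_sphere g (E 0) r = Sph r"
    using geodesic_sphere_eq[OF r] by (simp add: Sph_def)
  show ?thesis
    unfolding surface_measure_def Sp
  proof (rule the_equality)
    show "sets (\<mu> r) = sets (restrict_space borel (Sph r)) \<and>
      (\<forall>W \<phi>. local_parametrization (Sph r) W \<phi> \<longrightarrow> (\<forall>A\<in>sets borel. A \<subseteq> W \<longrightarrow>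
        emeasure (\<mu> r) (\<phi> ` A) = (\<integral>\<^sup>+ w\<in>A. ennreal (sqrt (det_Basis (\<lambda>i j.
          g (\<phi> w) (frechet_derivative \<phi> (at w) i) (frechet_derivative \<phi> (at w) j)))) \<partial>lborel)))"
      using emeasure_\<mu>_local_parametrization[OF r] by (auto simp: \<mu>_def)
  next
    fix \<nu>
    assume \<nu>: "sets \<nu> = sets (restrict_space borel (Sph r)) \<and>
      (\<forall>W \<phi>. local_parametrization (Sph r) W \<phi> \<longrightarrow> (\<forall>A\<in>sets borel. A \<subseteq> W \<longrightarrow>
        emeasure \<nu> (\<phi> ` A) = (\<integral>\<^sup>+ w\<in>A. ennreal (sqrt (det_Basis (\<lambda>i j.
          g (\<phi> w) (frechet_derivative \<phi> (at w) i) (frechet_derivative \<phi> (at w) j)))) \<partial>lborel)))"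
    have sets\<mu>: "sets (\<mu> r) = sets (restrict_space borel (Sph r))" by (simp add: \<mu>_def)
    have on_chart: "emeasure \<nu> X = emeasure (\<mu> r) X"
      if X: "X \<in> sets borel" "X \<subseteq> range (\<lambda>w. ray r (stereo \<epsilon> w))" and \<epsilon>: "\<epsilon>\<^sup>2 = 1" for X \<epsilon>
    proof -
      let ?\<phi> = "\<lambda>w. ray r (stereo \<epsilon> w)"
      have lp: "local_parametrization (Sph r) UNIV ?\<phi>" by (rule local_parametrization_stereo(1)[OF r \<epsilon>])
      then have "?\<phi> \<in> borel_measurable borel"
        unfolding local_parametrization_def
        by (intro borel_measurable_continuous_onI smooth_on_imp_continuous_on) auto
      then have B: "?\<phi> -` X \<in> sets borel" using measurable_sets[of ?\<phi> borel borel X] X(1) by simp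
      have "?\<phi> ` (?\<phi> -` X) = X" using X(2) by auto
      then show ?thesis
        using \<nu>[THEN conjunct2, rule_format, OF lp B] emeasure_\<mu>_local_parametrization[OF r lp B] by simp
    qed
    show "\<nu> = \<mu> r"
    proof (rule measure_eqI)
      show "sets \<nu> = sets (\<mu> r)" using \<nu> sets\<mu> by simp
      fix X assume "X \<in> sets \<nu>"
      then have XS: "X \<in> sets borel" "X \<subseteq> Sph r"
        using \<nu> closed_Sph by (auto simp: sets_restrict_space_iff)
      let ?p = "ray r (0, 1)"
      have r1: "range (\<lambda>w. ray r (stereo 1 w)) = Sph r - {?p}"
        and r2: "range (\<lambda>w. ray r (stereo (- 1) w)) = Sph r - {ray r (0, - 1)}"
        by (rule local_parametrization_stereo(2)[OF r], simp)+
      have "F ?p \<noteq> F (ray r (0, - 1))"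
        using r by (simp add: F_ray prod_eq_iff)
      then have ne: "?p \<noteq> ray r (0, - 1)" by metis
      \<comment> \<open>The chart \<open>stereo 1\<close> misses \<open>?p\<close> only, and the
        chart \<open>stereo (- 1)\<close> contains it.\<close>
      have X1: "X - {?p} \<in> sets borel" "X - {?p} \<subseteq> Sph r - {?p}"
        and X2: "X \<inter> {?p} \<in> sets borel" "X \<inter> {?p} \<subseteq> Sph r - {ray r (0, - 1)}"
        using XS ne by auto
      have e: "emeasure \<nu> (X - {?p}) = emeasure (\<mu> r) (X - {?p})" "emeasure \<nu> (X \<inter> {?p}) = emeasure (\<mu> r) (X \<inter> {?p})"
        using on_chart[of "X - {?p}" 1] on_chart[of "X \<inter> {?p}" "- 1"] X1 X2 by (simp_all only: r1 r2) simp_all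
      have split: "emeasure m X = emeasure m (X - {?p}) + emeasure m (X \<inter> {?p})"
        if "sets m = sets (restrict_space borel (Sph r))" for m
      proof -
        have "X - {?p} \<in> sets m" "X \<inter> {?p} \<in> sets m"
          unfolding that using X1 X2 closed_Sph by (auto simp: sets_restrict_space_iff)
        then have "emeasure m (X - {?p}) + emeasure m (X \<inter> {?p}) = emeasure m ((X - {?p}) \<union> (X \<inter> {?p}))"
          by (intro plus_emeasure) auto
        then show ?thesis by (simp add: Un_Diff_Int Un_commute)
      qed
      show "emeasure \<nu> X = emeasure (\<mu> r) X"
        using split[of \<nu>] split[of "\<mu> r"] e \<nu> sets\<mu> by simp
    qed
  qed
qed

lemma sphere_integral_eq:
  fixes f :: "'a \<times> real \<Rightarrow> 'b::{banach, second_countable_topology}"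
  assumes r: "r > 0" and f: "continuous_on UNIV f"
  shows "sphere_integral g (E 0) r f = A r *\<^sub>R (\<integral>\<omega>. f (ray r \<omega>) \<partial>sphere_measure)"
proof -
  have m: "ray r \<in> measurable (density sphere_measure (\<lambda>_. ennreal (A r))) (restrict_space borel (Sph r))"
    using ray_measurable[OF r] by simp
  have fm: "f \<in> borel_measurable borel" by (rule borel_measurable_continuous_onI[OF f])
  have "sphere_integral g (E 0) r f = (\<integral>\<omega>. f (ray r \<omega>) \<partial>density sphere_measure (\<lambda>_. ennreal (A r)))"
    unfolding sphere_integral_def surface_measure_eq[OF r] \<mu>_def
    by (rule integral_distr[OF m measurable_restrict_space1[OF fm]])
  also have "\<dots> = (\<integral>\<omega>. A r *\<^sub>R f (ray r \<omega>) \<partial>sphere_measure)"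
    by (rule integral_density)
      (use A_pos[OF r] measurable_compose[OF ray_measurable[OF r] measurable_restrict_space1[OF fm]] in auto)
  finally show ?thesis by simp
qed

end

section \<open>The radial part of the Laplacian\<close>

lemma smooth_on_slice_derivative:
  fixes u :: "real \<times> 'z::euclidean_space \<Rightarrow> real"
  assumes u: "smooth_on U u" and U: "(t, z) \<in> U"
  shows "((\<lambda>t. u (t, z)) has_real_derivative frechet_derivative u (at (t, z)) (1, 0)) (at t)"
proof -
  have l: "((\<lambda>t. (t, z)) has_derivative (\<lambda>h. (h, 0))) (at t)"
    by (auto intro!: derivative_eq_intros)
  have d: "(u has_derivative frechet_derivative u (at (t, z))) (at (t, z))"
    by (rule smooth_on_has_derivative[OF u U])
  have e: "frechet_derivative u (at (t, z)) (h, 0) = frechet_derivative u (at (t, z)) (1, 0) * h" for h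
    using linear_cmul[OF has_derivative_linear[OF d], of h "(1, 0)"] by simp
  show ?thesis
    unfolding has_field_derivative_def
    by (rule has_derivative_eq_rhs[OF has_derivative_compose[OF l d]]) (rule ext, rule e)
qed

lemma (in compact_finite_measure) has_real_derivative_integral_smooth:
  assumes u: "smooth_on U u" and U: "\<And>t z. z \<in> space M \<Longrightarrow> (t, z) \<in> U"
  shows "((\<lambda>t. \<integral>z. u (t, z) \<partial>M) has_real_derivative (\<integral>z. frechet_derivative u (at (t, z)) (1, 0) \<partial>M)) (at t)"
proof (rule has_real_derivative_integral)
  have sub: "UNIV \<times> space M \<subseteq> U" using U by auto
  have cu: "continuous_on (UNIV \<times> space M) u"
    by (rule continuous_on_subset[OF smooth_on_imp_continuous_on[OF u] sub])
  show "continuous_on (space M) (\<lambda>z. u (t, z))" for t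
    by (rule continuous_on_compose2[OF cu]) (auto intro!: continuous_intros)
  show "continuous_on (UNIV \<times> space M) (\<lambda>(t, z). frechet_derivative u (at (t, z)) (1, 0))"
    using continuous_on_subset[OF smooth_on_imp_continuous_on[OF smooth_on_frechet_derivative[OF u, of "(1, 0)"]] sub]
    by (simp add: case_prod_beta')
  show "((\<lambda>t. u (t, z)) has_real_derivative frechet_derivative u (at (t, z)) (1, 0)) (at t)" if "z \<in> space M" for t z
    by (rule smooth_on_slice_derivative[OF u U[OF that]])
qed

lemma integrable_lborel_compact_support:
  fixes k :: "'e::euclidean_space \<Rightarrow> real"
  assumes "continuous_on UNIV k" "\<And>p. norm p > r \<Longrightarrow> k p = 0"
  shows "integrable lborel k"
proof -
  have "integrable lborel (\<lambda>p. indicator (cball 0 r) p *\<^sub>R k p)"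
    by (rule borel_integrable_compact[OF compact_cball continuous_on_subset[OF assms(1)]]) simp
  moreover have "(\<lambda>p. indicator (cball 0 r) p *\<^sub>R k p) = k"
    using assms(2) by (auto simp: indicator_def fun_eq_iff not_le)
  ultimately show ?thesis by (simp only:)
qed

text \<open>A cut-off function, positive inside \<open>(a, b)\<close>. Squaring the quadratic makes
  its derivative continuous at the ends, and the divergence argument differentiates it once.\<close>

definition bump :: "real \<Rightarrow> real \<Rightarrow> real \<Rightarrow> real" where
  "bump a b s = (if a \<le> s \<and> s \<le> b then ((s - a) * (b - s))\<^sup>2 else 0)"

definition bump' :: "real \<Rightarrow> real \<Rightarrow> real \<Rightarrow> real" where
  "bump' a b s = (if a \<le> s \<and> s \<le> b then 2 * ((s - a) * (b - s)) * (a + b - 2 * s) else 0)"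

lemma bump_eq: assumes "a < b" shows "bump a b s = (max 0 ((s - a) * (b - s)))\<^sup>2"
  and "bump' a b s = 2 * max 0 ((s - a) * (b - s)) * (a + b - 2 * s)"
  using assms by (auto simp: bump_def bump'_def max_def zero_le_mult_iff mult_le_0_iff not_le)

lemma continuous_on_bump': "a < b \<Longrightarrow> continuous_on S (bump' a b)"
proof -
  assume "a < b"
  then have "bump' a b = (\<lambda>s. 2 * max 0 ((s - a) * (b - s)) * (a + b - 2 * s))"
    by (intro ext bump_eq(2))
  then show ?thesis by (simp only:) (intro continuous_intros)
qed

lemma has_real_derivative_bump:
  assumes ab: "a < b"
  shows "(bump a b has_real_derivative bump' a b s) (at s)"
proof -
  let ?p = "\<lambda>s. (s - a) * (b - s)"
  have dp: "(?p has_real_derivative (a + b - 2 * s)) (at s)"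
    by (auto intro!: derivative_eq_intros)
  have sq: "((\<lambda>x::real. (max 0 x)\<^sup>2) has_real_derivative 2 * max 0 x) (at x)" for x
  proof -
    consider "x > 0" | "x < 0" | "x = 0" by linarith
    then show ?thesis
    proof cases
      case 1
      have "((\<lambda>x::real. x\<^sup>2) has_real_derivative 2 * max 0 x) (at x)"
        using 1 by (auto intro!: derivative_eq_intros)
      then show ?thesis
        by (rule has_field_derivative_transform_within_open[of _ _ _ "{0<..}"]) (use 1 in auto)
    next
      case 2
      have "((\<lambda>x::real. 0) has_real_derivative 2 * max 0 x) (at x)"
        using 2 by auto
      then show ?thesis
        by (rule has_field_derivative_transform_within_open[of _ _ _ "{..<0}"]) (use 2 in auto)
    next
      case 3
      have "((\<lambda>h. ((max 0 h)\<^sup>2 - 0) / h) \<longlongrightarrow> 0) (at (0::real))"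
      proof (rule Lim_null_comparison)
        show "\<forall>\<^sub>F h in at 0. norm (((max 0 h)\<^sup>2 - 0) / h) \<le> \<bar>h::real\<bar>"
          by (intro always_eventually) (auto simp: max_def power2_eq_square)
        show "((\<lambda>h::real. \<bar>h\<bar>) \<longlongrightarrow> 0) (at 0)"
          by (rule tendsto_eq_intros refl | simp)+
      qed
      then show ?thesis using 3 by (simp add: DERIV_def)
    qed
  qed
  show ?thesis
    unfolding bump_eq(1)[OF ab, abs_def] bump_eq(2)[OF ab] by (rule DERIV_chain2[OF sq dp])
qed

section \<open>The Laplacian in an orthonormal frame and Green's formula\<close>

context polar_chart
begin

abbreviation vol where "vol p \<equiv> \<bar>det_lin (Di p)\<bar>"

lemma vol_pos: "vol p > 0"
proof -
  have "det_lin (D p) * det_lin (Di p) = 1"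
    using det_lin_compose[OF linear_D, of p "Di p"] by (simp add: det_lin_ident)
  then show ?thesis by auto
qed

lemma volume_density_eq: "volume_density g p = vol p"
proof -
  have "g p = (\<lambda>i j. Di p i \<bullet> Di p j)" by (intro ext g_eq)
  then show ?thesis by (simp add: volume_density_def det_Basis_Gram)
qed

text \<open>The vectors \<open>D q i\<close> form an orthonormal frame, and the inverse metric is
  the sum of the tensor squares of such a frame.\<close>

lemma inverse_metric_eq: "inverse_metric g q b c = (\<Sum>i\<in>Basis. (D q i \<bullet> b) * (D q i \<bullet> c))"
proof -
  let ?u = "\<Sum>i\<in>Basis. (D q i \<bullet> b) *\<^sub>R i"
  have u: "?u \<bullet> w = b \<bullet> D q w" for w
  proof -
    have e: "D q w = (\<Sum>i\<in>Basis. (w \<bullet> i) *\<^sub>R D q i)"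
      by (rule linear_Basis_expansion[OF linear_D])
    show ?thesis
      unfolding e by (simp add: inner_sum_left inner_sum_right inner_commute mult.commute)
  qed
  have "(THE v. \<forall>w. g q v w = b \<bullet> w) = D q ?u"
  proof (rule the_equality)
    show "\<forall>w. g q (D q ?u) w = b \<bullet> w"
      by (simp only: g_eq Di_D u D_Di) simp
    fix v assume v: "\<forall>w. g q v w = b \<bullet> w"
    have "Di q v \<bullet> y = ?u \<bullet> y" for y
      using v[rule_format, of "D q y"] by (simp only: g_eq Di_D u)
    then have "\<forall>y. Di q v \<bullet> y = ?u \<bullet> y" by blast
    then have "Di q v = ?u" by (rule iffD1[OF vector_eq_rdot])
    then have "D q (Di q v) = D q ?u" by (rule arg_cong)
    then show "v = D q ?u" by (simp only: D_Di)
  qed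
  then show ?thesis
    unfolding inverse_metric_def
    by (simp add: linear_sum[OF linear_D] linear_cmul[OF linear_D] inner_sum_left)
qed

text \<open>The component along \<open>b\<close> of the gradient of \<open>f\<close>, expanded in
  the frame and multiplied by the volume density. The Laplacian is the divergence of this field over
  the volume density.\<close>

definition Xf :: "('a \<times> real \<Rightarrow> real) \<Rightarrow> 'a \<times> real \<Rightarrow> 'a \<times> real \<Rightarrow> real" where
  "Xf f b q = vol q * (\<Sum>i\<in>Basis. (D q i \<bullet> b) * frechet_derivative f (at q) (D q i))"

context
  fixes f :: "'a \<times> real \<Rightarrow> real"
  assumes f: "smooth_on UNIV f"
begin

lemma f_has_derivative: "(f has_derivative frechet_derivative f (at p)) (at p)"
  by (rule smooth_on_has_derivative[OF f UNIV_I])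

lemma linear_Df: "linear (frechet_derivative f (at p))"
  using f_has_derivative has_derivative_linear by blast

lemma smooth_Xf: "smooth_on UNIV (Xf f b)"
proof -
  have "frechet_derivative f (at q) (D q i) = (\<Sum>c\<in>Basis. (D q i \<bullet> c) * frechet_derivative f (at q) c)" for q i
    by (subst linear_Basis_expansion[OF linear_Df]) simp
  then show ?thesis
    unfolding Xf_def[abs_def] by (simp only:) (intro smooth_intros smooth_det smooth_D f open_UNIV)
qed

lemma laplace_beltrami_eq:
  "laplace_beltrami g f p = (1 / vol p) * (\<Sum>b\<in>Basis. frechet_derivative (Xf f b) (at p) b)"
proof -
  have "(\<Sum>c\<in>Basis. inverse_metric g q b c *\<^sub>R frechet_derivative f (at q) c)
      = (\<Sum>i\<in>Basis. (D q i \<bullet> b) * frechet_derivative f (at q) (D q i))" for q b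
  proof -
    have "(\<Sum>c\<in>Basis. inverse_metric g q b c *\<^sub>R frechet_derivative f (at q) c)
        = (\<Sum>c\<in>Basis. \<Sum>i\<in>Basis. (D q i \<bullet> b) * ((D q i \<bullet> c) * frechet_derivative f (at q) c))"
      by (simp add: inverse_metric_eq sum_distrib_right mult.assoc)
    also have "\<dots> = (\<Sum>i\<in>Basis. \<Sum>c\<in>Basis. (D q i \<bullet> b) * ((D q i \<bullet> c) * frechet_derivative f (at q) c))"
      by (rule sum.swap)
    also have "\<dots> = (\<Sum>i\<in>Basis. (D q i \<bullet> b) * frechet_derivative f (at q) (D q i))"
    proof (rule sum.cong[OF refl])
      fix i
      show "(\<Sum>c\<in>Basis. (D q i \<bullet> b) * ((D q i \<bullet> c) * frechet_derivative f (at q) c))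
          = (D q i \<bullet> b) * frechet_derivative f (at q) (D q i)"
        using linear_Basis_expansion[OF linear_Df, of q "D q i"] by (simp add: sum_distrib_left)
    qed
    finally show ?thesis .
  qed
  then have "(\<lambda>q. volume_density g q *\<^sub>R (\<Sum>c\<in>Basis. inverse_metric g q b c *\<^sub>R frechet_derivative f (at q) c)) = Xf f b" for b
    by (simp add: fun_eq_iff Xf_def volume_density_eq)
  then show ?thesis
    unfolding laplace_beltrami_def by (simp add: volume_density_eq)
qed

lemma continuous_on_laplace_beltrami: "continuous_on S (laplace_beltrami g f)"
proof -
  have "continuous_on UNIV (\<lambda>p. (1 / vol p) * (\<Sum>b\<in>Basis. frechet_derivative (Xf f b) (at p) b))"
    using less_imp_neq[OF vol_pos]
    by (intro continuous_on_mult continuous_on_divide continuous_on_sum continuous_on_const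
        smooth_on_imp_continuous_on[OF smooth_det]
        smooth_on_imp_continuous_on[OF smooth_on_frechet_derivative[OF smooth_Xf]]) (metis)
  then show ?thesis
    unfolding laplace_beltrami_eq[abs_def] using continuous_on_subset by blast
qed

text \<open>The left side is half the derivative of \<open>F p \<bullet> F p\<close> along the
  gradient field of \<open>f\<close> with its volume factor. By the Gauss identity only the radial
  derivative of \<open>f\<close> enters; \<open>(1 - (norm v)^2)^2 / 4\<close> is the inverse square
  of the radial speed.\<close>

lemma Df_radial:
  assumes v: "norm v < 1"
  shows "(\<Sum>b\<in>Basis. (v \<bullet> DF (E v) b) * Xf f b (E v))
    = vol (E v) * ((1 - (norm v)\<^sup>2)\<^sup>2 / 4) * frechet_derivative f (at (E v)) (DE v v)"
proof -
  let ?p = "E v" and ?df = "frechet_derivative f (at (E v))"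
  have a: "v \<bullet> DF ?p (D ?p i) = (1 - (norm v)\<^sup>2)\<^sup>2 / 4 * (T v v \<bullet> i)" for i
  proof -
    have q: "1 - (norm v)\<^sup>2 \<noteq> 0" using v by (simp add: power_less_one_iff less_imp_neq)
    have "T v (DF ?p (D ?p i)) = i"
      using DE_DF[of ?p] F_E[OF v] by (simp add: T_def)
    then show ?thesis
      using T_inner[OF v, of "DF ?p (D ?p i)"] q by (simp add: field_simps)
  qed
  have b: "(\<Sum>b\<in>Basis. (D ?p i \<bullet> b) * (v \<bullet> DF ?p b)) = v \<bullet> DF ?p (D ?p i)" for i
  proof -
    have e: "DF ?p (D ?p i) = (\<Sum>b\<in>Basis. (D ?p i \<bullet> b) *\<^sub>R DF ?p b)"
      by (rule linear_Basis_expansion[OF linear_DF])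
    show ?thesis unfolding e by (simp add: inner_sum_right)
  qed
  have "(\<Sum>b\<in>Basis. (v \<bullet> DF ?p b) * Xf f b ?p)
      = vol ?p * (\<Sum>b\<in>Basis. \<Sum>i\<in>Basis. ?df (D ?p i) * ((D ?p i \<bullet> b) * (v \<bullet> DF ?p b)))"
    unfolding Xf_def sum_distrib_left by (intro sum.cong refl) (simp add: mult_ac)
  also have "\<dots> = vol ?p * (\<Sum>i\<in>Basis. ?df (D ?p i) * (v \<bullet> DF ?p (D ?p i)))"
    by (subst sum.swap) (simp add: sum_distrib_left[symmetric] b)
  also have "\<dots> = vol ?p * ((1 - (norm v)\<^sup>2)\<^sup>2 / 4) * (\<Sum>i\<in>Basis. (T v v \<bullet> i) * ?df (D ?p i))"
    unfolding a by (simp add: sum_distrib_left mult_ac)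
  also have "(\<Sum>i\<in>Basis. (T v v \<bullet> i) * ?df (D ?p i)) = ?df (D ?p (T v v))"
  proof -
    have "linear (\<lambda>u. ?df (D ?p u))"
      using linear_compose[OF linear_D linear_Df] by (simp add: o_def)
    from linear_Basis_expansion[OF this, of "T v v"] show ?thesis by simp
  qed
  finally show ?thesis by (simp only: D_T)
qed

definition radial_density :: "real \<Rightarrow> real" where
  "radial_density t = 2 ^ DIM('a \<times> real) * (1 - t\<^sup>2) powr - (Q + 1)"

text \<open>The field \<open>Xf f\<close> times the cut-off
  \<open>bump (a^2) (b^2) (F p \<bullet> F p)\<close> has compact support, so its divergence has
  Lebesgue integral 0. Passing to the ball and to polar coordinates there gives this form.\<close>

lemma Green_weak:
  assumes ab: "0 < a" "a < b" "b < 1"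
  shows "(\<integral>t. indicator {0..1} t * t ^ (DIM('a \<times> real) - 1) * (\<integral>\<omega>. indicator (ball 0 1) (t *\<^sub>R \<omega>) *\<^sub>R (radial_density t *
    (bump (a\<^sup>2) (b\<^sup>2) (t\<^sup>2) * laplace_beltrami g f (E (t *\<^sub>R \<omega>))
      + bump' (a\<^sup>2) (b\<^sup>2) (t\<^sup>2) * ((1 - t\<^sup>2)\<^sup>2 / 2) * frechet_derivative f (at (E (t *\<^sub>R \<omega>))) (DE (t *\<^sub>R \<omega>) (t *\<^sub>R \<omega>))))
    \<partial>sphere_measure) \<partial>lborel) = 0"
proof -
  let ?\<eta> = "bump (a\<^sup>2) (b\<^sup>2)" and ?\<eta>' = "bump' (a\<^sup>2) (b\<^sup>2)"
  have ab2: "a\<^sup>2 < b\<^sup>2" using ab by (simp add: power_strict_mono)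
  have contF: "continuous_on UNIV F" by (rule continuous_on_F)
  have vanish: "?\<eta> (F p \<bullet> F p) = 0" "?\<eta>' (F p \<bullet> F p) = 0" if "norm (F p) > b" for p
  proof -
    have "b\<^sup>2 < F p \<bullet> F p"
      using that ab by (simp add: power2_norm_eq_inner[symmetric] power_strict_mono)
    then show "?\<eta> (F p \<bullet> F p) = 0" "?\<eta>' (F p \<bullet> F p) = 0" by (simp_all add: bump_def bump'_def)
  qed
  define h where "h p = ?\<eta> (F p \<bullet> F p)" for p
  define h' where "h' p u = ?\<eta>' (F p \<bullet> F p) * (2 * (F p \<bullet> DF p u))" for p u
  have dh: "(h has_derivative h' p) (at p)" for p
  proof -
    have "((\<lambda>p. F p \<bullet> F p) has_derivative (\<lambda>u. F p \<bullet> DF p u + DF p u \<bullet> F p)) (at p)"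
      by (rule has_derivative_inner[OF F_has_derivative F_has_derivative])
    moreover have "(?\<eta> has_derivative (*) (?\<eta>' (F p \<bullet> F p))) (at (F p \<bullet> F p))"
      using has_real_derivative_bump[OF ab2] by (simp add: has_field_derivative_def)
    ultimately have "((\<lambda>p. ?\<eta> (F p \<bullet> F p)) has_derivative (\<lambda>u. ?\<eta>' (F p \<bullet> F p) * (F p \<bullet> DF p u + DF p u \<bullet> F p))) (at p)"
      by (rule has_derivative_compose)
    then show ?thesis
      unfolding h_def[abs_def] by (rule has_derivative_eq_rhs) (simp add: h'_def fun_eq_iff inner_commute)
  qed
  have conth: "continuous_on UNIV h"
    using dh has_derivative_continuous by (intro continuous_at_imp_continuous_on) blast
  have conth': "continuous_on UNIV (\<lambda>p. h' p u)" for u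
    unfolding h'_def
    by (intro continuous_intros continuous_on_compose2[OF continuous_on_bump'[OF ab2, of UNIV]] contF
        smooth_on_imp_continuous_on[OF smooth_on_frechet_derivative[OF smooth_F]]) auto
  \<comment> \<open>The cut-off vanishes off this compact set, which bounds its support.\<close>
  have "compact (E ` cball 0 b)"
    by (rule compact_continuous_image[OF continuous_on_subset[OF smooth_on_imp_continuous_on[OF smooth_E]] compact_cball])
      (use ab in auto)
  then obtain R where R: "\<And>p. p \<in> E ` cball 0 b \<Longrightarrow> norm p \<le> R"
    using compact_imp_bounded bounded_iff by metis
  have out: "norm (F p) > b" if "norm p > R" for p
  proof (rule ccontr)
    assume "\<not> norm (F p) > b"
    then have "p \<in> E ` cball 0 b" by (intro image_eqI[of _ _ "F p"]) auto
    from R[OF this] that show False by simp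
  qed
  let ?X = "Xf f"
  let ?X' = "\<lambda>b p. frechet_derivative (Xf f b) (at p)"
  have dX: "(?X b has_derivative ?X' b p) (at p)" for b p
    by (rule smooth_on_has_derivative[OF smooth_Xf UNIV_I])
  have contX: "continuous_on UNIV (?X b)" "continuous_on UNIV (\<lambda>p. ?X' b p u)" for b u
    using smooth_on_imp_continuous_on[OF smooth_Xf] smooth_on_imp_continuous_on[OF smooth_on_frechet_derivative[OF smooth_Xf]]
    by auto
  define k where "k p = (\<Sum>b\<in>Basis. h p * ?X' b p b + h' p b * ?X b p)" for p
  have contk: "continuous_on UNIV k"
    unfolding k_def by (intro continuous_intros conth conth' contX)
  have "(\<integral>p. k p \<partial>lborel) = (\<Sum>b\<in>Basis. \<integral>p. h p * ?X' b p b + h' p b * ?X b p \<partial>lborel)"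
    unfolding k_def
  proof (rule Bochner_Integration.integral_sum)
    fix b :: "'a \<times> real"
    show "integrable lborel (\<lambda>p. h p * ?X' b p b + h' p b * ?X b p)"
      by (rule integrable_lborel_compact_support[where r = R])
        (use vanish out in \<open>auto simp: h_def h'_def intro!: continuous_intros conth[unfolded h_def[abs_def]] conth'[unfolded h'_def[abs_def]] contX\<close>)
  qed
  also have "\<dots> = 0"
  proof (rule sum.neutral, rule ballI)
    fix b :: "'a \<times> real"
    show "(\<integral>p. h p * ?X' b p b + h' p b * ?X b p \<partial>lborel) = 0"
    proof (rule integral_directional_derivative_eq_0[where G = "\<lambda>p. h p * ?X b p" and r = R and G' = "\<lambda>p u. h p * ?X' b p u + h' p u * ?X b p"])
      show "((\<lambda>p. h p * ?X b p) has_derivative (\<lambda>u. h p * ?X' b p u + h' p u * ?X b p)) (at p)" for p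
        by (rule has_derivative_mult[OF dh dX])
      show "continuous_on UNIV (\<lambda>p. h p * ?X' b p b + h' p b * ?X b p)"
        by (intro continuous_intros conth conth' contX)
    qed (use vanish out in \<open>simp add: h_def\<close>)
  qed
  finally have k0: "(\<integral>p. k p \<partial>lborel) = 0" .
  define K where "K v = indicator (ball 0 1) v *\<^sub>R (\<bar>det_lin (DE v)\<bar> * k (E v))" for v
  have homeo: "homeomorphism (ball 0 1) UNIV E F"
    unfolding homeomorphism_def
  proof (intro conjI ballI)
    have "p \<in> E ` ball 0 1" for p
      by (rule image_eqI[of _ _ "F p"]) (simp_all add: norm_F)
    then show "E ` ball 0 1 = UNIV" by blast
    have "v \<in> range F" if "v \<in> ball 0 1" for v
      by (rule image_eqI[of _ _ "E v"]) (use F_E that in simp_all)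
    then show "range F = ball 0 1" using norm_F by auto
  qed (use smooth_on_imp_continuous_on[OF smooth_E] contF F_E in simp_all)
  have contDE: "continuous_on (ball 0 1) (\<lambda>v. DE v b)" for b
    by (rule smooth_on_imp_continuous_on[OF smooth_on_frechet_derivative[OF smooth_E]])
  have "(\<integral>v. K v \<partial>lborel) = 0"
    unfolding K_def k0[symmetric]
    by (rule lborel_integral_change_of_variables(2)[symmetric, OF open_ball homeo])
      (use E_has_derivative contDE borel_measurable_continuous_onI[OF contk] in auto)
  then have "(\<integral>t. indicator {0..1} t * t ^ (DIM('a \<times> real) - 1) *
      (\<integral>\<omega>. K (t *\<^sub>R \<omega>) \<partial>sphere_measure) \<partial>lborel) = 0"
  proof (rule trans[rotated])
    show "(\<integral>t. indicator {0..1} t * t ^ (DIM('a \<times> real) - 1) *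
      (\<integral>\<omega>. K (t *\<^sub>R \<omega>) \<partial>sphere_measure) \<partial>lborel) = (\<integral>v. K v \<partial>lborel)"
  proof (rule lborel_integral_polar[symmetric])
    have "continuous_on (ball 0 1) (\<lambda>v. \<bar>det_lin (DE v)\<bar> * k (E v))"
      by (intro continuous_intros continuous_on_det_lin contDE
          continuous_on_compose2[OF contk smooth_on_imp_continuous_on[OF smooth_E]]) auto
    then have c1: "continuous_on (ball 0 1) K"
      by (rule continuous_on_eq) (simp add: K_def)
    have "K v = 0" if "v \<in> - cball 0 b" for v
    proof (cases "norm v < 1")
      case True
      then have "k (E v) = 0"
        using vanish[of "E v"] F_E[OF True] that by (simp add: k_def h_def h'_def)
      then show ?thesis by (simp add: K_def)
    qed (simp add: K_def)
    then have "continuous_on (- cball 0 b) K"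
      by (intro continuous_on_eq[OF continuous_on_const[of _ 0]]) auto
    \<comment> \<open>\<open>K\<close> is continuous on the open unit ball and zero off a smaller
      closed ball; these two open sets cover the space.\<close>
    then have "continuous_on (ball 0 1 \<union> - cball 0 b) K"
      using c1 by (intro continuous_on_open_Un) auto
    moreover have "ball 0 1 \<union> - cball 0 b = (UNIV :: ('a \<times> real) set)"
      using ab by (auto simp del: norm_Pair)
    ultimately show "continuous_on UNIV K" by simp
    show "K v = 0" if "norm v \<ge> 1" for v
      using that by (simp add: K_def)
  qed
  qed
  moreover have Keq: "K (t *\<^sub>R \<omega>) = indicator (ball 0 1) (t *\<^sub>R \<omega>) *\<^sub>R (radial_density t *
      (?\<eta> (t\<^sup>2) * laplace_beltrami g f (E (t *\<^sub>R \<omega>))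
        + ?\<eta>' (t\<^sup>2) * ((1 - t\<^sup>2)\<^sup>2 / 2) * frechet_derivative f (at (E (t *\<^sub>R \<omega>))) (DE (t *\<^sub>R \<omega>) (t *\<^sub>R \<omega>))))"
    if \<omega>: "\<omega> \<in> space sphere_measure" for t \<omega>
  proof (cases "norm (t *\<^sub>R \<omega>) < 1")
    case v: True
    let ?v = "t *\<^sub>R \<omega>"
    have nv: "?v \<bullet> ?v = t\<^sup>2" "(norm ?v)\<^sup>2 = t\<^sup>2"
      using \<omega> by (simp_all add: power2_eq_square norm_eq_1[symmetric] power_mult_distrib)
    have dens: "\<bar>det_lin (DE ?v)\<bar> * vol (E ?v) = radial_density t"
      using jac[OF v] det_lin_compose[OF linear_Di, of "E ?v" "DE ?v"]
      unfolding radial_density_def nv(2) by (simp add: abs_mult mult.commute)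
    have "k (E ?v) = ?\<eta> (t\<^sup>2) * (\<Sum>b\<in>Basis. ?X' b (E ?v) b) + 2 * ?\<eta>' (t\<^sup>2) * (\<Sum>b\<in>Basis. (?v \<bullet> DF (E ?v) b) * ?X b (E ?v))"
      unfolding k_def h_def h'_def F_E[OF v] nv(1) by (simp add: sum.distrib sum_distrib_left sum_distrib_right mult_ac)
    also have "\<dots> = vol (E ?v) * (?\<eta> (t\<^sup>2) * laplace_beltrami g f (E ?v)
        + ?\<eta>' (t\<^sup>2) * ((1 - t\<^sup>2)\<^sup>2 / 2) * frechet_derivative f (at (E ?v)) (DE ?v ?v))"
      unfolding Df_radial[OF v] nv(2) laplace_beltrami_eq using vol_pos[of "E ?v"] by (simp add: field_simps)
    finally show ?thesis
      using v dens by (simp add: K_def mult.assoc[symmetric] del: norm_scaleR)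
  qed (simp add: K_def del: norm_scaleR)
  ultimately show ?thesis
    by (simp only: Bochner_Integration.integral_cong[OF refl Keq])
qed

end

end

section \<open>The differential equation of spherical means\<close>

context polar_chart
begin

text \<open>Written without dividing by \<open>tanh (r / 2)\<close>, so that the formula is
  continuous at 0 as well.\<close>

definition A' :: "real \<Rightarrow> real" where
  "A' r = (let n = DIM('a \<times> real) - 1; t = tanh (r / 2) in
    2 ^ n * (1 - t\<^sup>2) powr - Q * (n * t ^ (n - 1) * (1 - t\<^sup>2) / 2 + Q * t ^ (n + 1)))"

lemma A_has_derivative: "(A has_real_derivative A' r) (at r)"
proof -
  define n where "n = DIM('a \<times> real) - 1"
  let ?t = "tanh (r / 2)"
  have q: "1 - ?t\<^sup>2 > 0" using tanh_sq_less_1[of r] by simp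
  have d1: "((\<lambda>r. tanh (r / 2) ^ n) has_real_derivative n * ?t ^ (n - 1) * ((1 - ?t\<^sup>2) / 2)) (at r)"
    using DERIV_power[OF DERIV_tanh_half, of n r] by (simp add: mult_ac)
  have d2: "((\<lambda>r. 1 - (tanh (r / 2))\<^sup>2) has_real_derivative - (?t * (1 - ?t\<^sup>2))) (at r)"
    using DERIV_diff[OF DERIV_const[of 1] DERIV_power[OF DERIV_tanh_half, of 2 r]]
    by (simp add: mult.commute)
  have "((\<lambda>x. x powr - Q) has_real_derivative - Q * (1 - ?t\<^sup>2) powr (- Q - 1)) (at (1 - ?t\<^sup>2))"
    by (rule has_real_derivative_powr[OF q])
  from DERIV_chain2[OF this d2]
  have "((\<lambda>r. (1 - (tanh (r / 2))\<^sup>2) powr - Q) has_real_derivative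
      - Q * (1 - ?t\<^sup>2) powr (- Q - 1) * - (?t * (1 - ?t\<^sup>2))) (at r)" .
  moreover have "(1 - ?t\<^sup>2) powr (- Q - 1) * (1 - ?t\<^sup>2) = (1 - ?t\<^sup>2) powr - Q"
    using q powr_add[of "1 - ?t\<^sup>2" "- Q - 1" 1] by simp
  ultimately have d3: "((\<lambda>r. (1 - (tanh (r / 2))\<^sup>2) powr - Q) has_real_derivative Q * ?t * (1 - ?t\<^sup>2) powr - Q) (at r)"
    by (auto elim!: DERIV_cong simp: mult_ac)
  have "((\<lambda>r. 2 ^ n * (tanh (r / 2) ^ n * (1 - (tanh (r / 2))\<^sup>2) powr - Q)) has_real_derivative
      2 ^ n * (n * ?t ^ (n - 1) * ((1 - ?t\<^sup>2) / 2) * (1 - ?t\<^sup>2) powr - Q + Q * ?t * (1 - ?t\<^sup>2) powr - Q * ?t ^ n)) (at r)"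
    by (rule DERIV_cmult[OF DERIV_mult[OF d1 d3]])
  then show ?thesis
    unfolding A_def[abs_def] A'_def Let_def n_def[symmetric] by (simp add: algebra_simps)
qed

lemma continuous_on_A: "continuous_on S A"
  using A_has_derivative by (intro continuous_at_imp_continuous_on ballI DERIV_isCont)

lemma continuous_on_A': "continuous_on S A'"
proof -
  have "1 - (tanh (r / 2 :: real))\<^sup>2 \<noteq> 0" for r using tanh_sq_less_1[of r] by simp
  then show ?thesis
    unfolding A'_def Let_def by (intro continuous_intros) auto
qed

lemma A'_nonneg: "r > 0 \<Longrightarrow> A' r \<ge> 0"
  using tanh_sq_less_1[of r] Q_nonneg by (simp add: A'_def Let_def)

lemma A_0: "A 0 = 0"
  by (simp add: A_def DIM_prod)

context
  fixes f :: "'a \<times> real \<Rightarrow> real"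
  assumes f: "smooth_on UNIV f"
begin

definition ur where "ur = (\<lambda>(r, \<omega>). f (ray r \<omega>))"
definition ur1 where "ur1 q = frechet_derivative ur (at q) (1, 0)"
definition ur2 where "ur2 q = frechet_derivative ur1 (at q) (1, 0)"

lemma smooth_ur: "smooth_on ray_domain ur"
  using smooth_on_compose[OF open_ray_domain open_UNIV smooth_ray f]
  by (simp add: ur_def case_prod_beta')

lemma smooth_ur1: "smooth_on ray_domain ur1" and smooth_ur2: "smooth_on ray_domain ur2"
  unfolding ur1_def[abs_def] ur2_def[abs_def]
  by (auto intro!: smooth_on_frechet_derivative smooth_ur)

lemma ur1_eq:
  assumes \<omega>: "norm \<omega> \<le> 1"
  shows "ur1 (r, \<omega>) = (1 - (tanh (r / 2))\<^sup>2) / 2 * frechet_derivative f (at (ray r \<omega>)) (DE (tanh (r / 2) *\<^sub>R \<omega>) \<omega>)"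
proof -
  have "((\<lambda>r. ur (r, \<omega>)) has_real_derivative ur1 (r, \<omega>)) (at r)"
    unfolding ur1_def by (rule smooth_on_slice_derivative[OF smooth_ur ray_domain_sphere[OF \<omega>]])
  moreover have "((\<lambda>r. f (ray r \<omega>)) has_vector_derivative
      frechet_derivative f (at (ray r \<omega>)) (((1 - (tanh (r / 2))\<^sup>2) / 2) *\<^sub>R DE (tanh (r / 2) *\<^sub>R \<omega>) \<omega>)) (at r)"
    using vector_derivative_diff_chain_within[OF ray_has_vector_derivative[OF \<omega>]
        has_derivative_at_withinI[OF f_has_derivative[OF f]]] by (simp add: o_def)
  ultimately show ?thesis
    using vector_derivative_unique_at
    by (fastforce simp: ur_def has_real_derivative_iff_has_vector_derivative linear_cmul[OF linear_Df[OF f]])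
qed

lemma continuous_on_ur12:
  "continuous_on (UNIV \<times> sphere 0 1) ur1" "continuous_on (UNIV \<times> sphere 0 1) ur2"
proof -
  have "UNIV \<times> sphere 0 1 \<subseteq> ray_domain"
    using ray_domain_sphere by auto
  then show "continuous_on (UNIV \<times> sphere 0 1) ur1" "continuous_on (UNIV \<times> sphere 0 1) ur2"
    using continuous_on_subset smooth_on_imp_continuous_on smooth_ur1 smooth_ur2 by blast+
qed

text \<open>\<open>N1\<close> and \<open>N2\<close> are the first two derivatives in
  \<open>r\<close> of the integral of \<open>f\<close> over the directions at radius
  \<open>r\<close>, and \<open>La\<close> is the corresponding integral of its Laplacian. None of
  them is normalized.\<close>

definition N1 where "N1 r = (\<integral>\<omega>. ur1 (r, \<omega>) \<partial>sphere_measure)"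
definition N2 where "N2 r = (\<integral>\<omega>. ur2 (r, \<omega>) \<partial>sphere_measure)"
definition La where "La r = (\<integral>\<omega>. laplace_beltrami g f (ray r \<omega>) \<partial>sphere_measure)"

lemma N1_has_derivative: "(N1 has_real_derivative N2 r) (at r)"
  unfolding N1_def[abs_def] N2_def ur2_def
  by (rule sphere_measure.has_real_derivative_integral_smooth[OF smooth_ur1]) (simp add: ray_domain_sphere)

lemma continuous_on_N1: "continuous_on S N1"
  using N1_has_derivative by (intro continuous_at_imp_continuous_on ballI DERIV_isCont)

lemma continuous_on_N2: "continuous_on S N2"
  unfolding N2_def
proof (rule sphere_measure.continuous_on_integral)
  have "continuous_on (S \<times> sphere 0 1) ur2"
    by (rule continuous_on_subset[OF continuous_on_ur12(2)]) auto
  then show "continuous_on (S \<times> space sphere_measure) (\<lambda>(r, \<omega>). ur2 (r, \<omega>))"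
    by (simp add: case_prod_beta')
qed

lemma continuous_on_ray_joint: "continuous_on (UNIV \<times> sphere 0 1) (\<lambda>(r, \<omega>). ray r \<omega>)"
  by (rule continuous_on_subset[OF smooth_on_imp_continuous_on[OF smooth_ray]]) (use ray_domain_sphere in auto)

lemma continuous_on_La: "continuous_on S La"
  unfolding La_def
proof (rule sphere_measure.continuous_on_integral)
  have "continuous_on (UNIV \<times> sphere 0 1) (\<lambda>q. laplace_beltrami g f (case q of (r, \<omega>) \<Rightarrow> ray r \<omega>))"
    by (rule continuous_on_compose2[OF continuous_on_laplace_beltrami[OF f] continuous_on_ray_joint order.refl[THEN subset_trans]]) auto
  then show "continuous_on (S \<times> space sphere_measure) (\<lambda>(r, \<omega>). laplace_beltrami g f (ray r \<omega>))"
    by (rule continuous_on_subset[THEN continuous_on_eq]) auto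
qed

text \<open>The fundamental lemma of the calculus of variations. In the coordinate
  \<open>t = tanh (r / 2)\<close> the cut-off times \<open>A * N1\<close> vanishes at both ends. Its
  derivative is \<open>J + Z\<close>, where \<open>J\<close> is the integrand of
  \<open>Green_weak\<close> after integration over directions and \<open>Z\<close> is the cut-off
  times the defect \<open>L\<close>, up to a positive factor. So \<open>Z\<close> integrates to 0,
  which is impossible if \<open>L\<close> keeps a sign near \<open>r0\<close>.\<close>

lemma radial_laplacian:
  assumes r0: "r0 > 0"
  shows "A r0 * N2 r0 + A' r0 * N1 r0 = A r0 * La r0"
proof (rule ccontr)
  define L where "L r = A r * N2 r + A' r * N1 r - A r * La r" for r
  assume "\<not> ?thesis"
  then have L0: "L r0 \<noteq> 0" by (simp add: L_def)
  have contL: "continuous_on S L" for S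
    unfolding L_def by (intro continuous_intros continuous_on_A continuous_on_A' continuous_on_N1 continuous_on_N2 continuous_on_La)
  \<comment> \<open>Multiplying by \<open>L r0\<close> treats both signs of the defect at
    once.\<close>
  have "isCont (\<lambda>r. L r0 * L r) r0"
    using contL[of UNIV] by (auto simp: continuous_on_eq_continuous_at intro!: continuous_intros)
  moreover have "0 < L r0 * L r0" using L0 by (simp add: zero_less_mult_iff) linarith
  ultimately have "\<forall>\<^sub>F r in at r0. 0 < L r0 * L r"
    unfolding isCont_def by (rule order_tendstoD(1))
  then obtain \<delta> where \<delta>: "\<delta> > 0" "\<And>r. r \<noteq> r0 \<Longrightarrow> dist r r0 < \<delta> \<Longrightarrow> 0 < L r0 * L r"
    unfolding eventually_at by blast
  define e where "e = min \<delta> r0 / 2"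
  have e: "e > 0" "e < \<delta>" "e < r0" using \<delta>(1) r0 by (auto simp: e_def min_def)
  have Lpos: "0 \<le> L r0 * L r" if "r0 - e \<le> r" "r \<le> r0 + e" for r
    using \<delta>(2)[of r] that e \<open>0 < L r0 * L r0\<close> by (cases "r = r0") (auto simp: dist_real_def intro: less_imp_le)
  define a b where "a = tanh ((r0 - e) / 2)" and "b = tanh ((r0 + e) / 2)"
  have ab: "0 < a" "a < b" "b < 1"
    using e tanh_real_lt_1 by (auto simp: a_def b_def)
  define R where "R t = 2 * artanh t" for t :: real
  have tR: "tanh (R t / 2) = t" if "t \<in> {a..b}" for t
    using that ab by (simp add: R_def tanh_artanh_real)
  have Rbd: "r0 - e \<le> R t" "R t \<le> r0 + e" if "t \<in> {a..b}" for t
    using that tR[OF that] tanh_real_le_iff[of "(r0 - e) / 2" "R t / 2"] tanh_real_le_iff[of "R t / 2" "(r0 + e) / 2"]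
    by (auto simp: a_def b_def)
  have t1: "1 - t\<^sup>2 > 0" if "t \<in> {a..b}" for t
    using that ab by (simp add: power_less_one_iff)
  have dR: "(R has_real_derivative 2 / (1 - t\<^sup>2)) (at t)" if "t \<in> {a..b}" for t
    unfolding R_def[abs_def] using that ab DERIV_cmult[OF artanh_real_has_field_derivative[of t UNIV], of 2] by simp
  have contR: "continuous_on {a..b} R"
    using dR by (intro continuous_at_imp_continuous_on ballI DERIV_isCont) blast
  have contc: "continuous_on {a..b} (\<lambda>t. G (R t))" if "\<And>S. continuous_on S G" for G :: "real \<Rightarrow> real"
    by (rule continuous_on_compose2[OF that[of UNIV] contR]) auto
  let ?\<eta> = "\<lambda>t. bump (a\<^sup>2) (b\<^sup>2) (t\<^sup>2)" and ?\<eta>' = "\<lambda>t. bump' (a\<^sup>2) (b\<^sup>2) (t\<^sup>2)"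
  have ab2: "a\<^sup>2 < b\<^sup>2" using ab by (simp add: power_strict_mono)
  have d\<eta>: "(?\<eta> has_real_derivative ?\<eta>' t * (2 * t)) (at t)" for t
    by (rule DERIV_chain2[OF has_real_derivative_bump[OF ab2]]) (auto intro!: derivative_eq_intros)
  have cont\<eta>: "continuous_on S ?\<eta>" "continuous_on S ?\<eta>'" for S
    using d\<eta> by (intro continuous_at_imp_continuous_on ballI DERIV_isCont)
      (auto intro!: continuous_on_compose2[OF continuous_on_bump'[OF ab2, of UNIV]] continuous_intros)
  define J where "J t = 2 / (1 - t\<^sup>2) * A (R t) * ?\<eta> t * La (R t) + 2 * t * ?\<eta>' t * A (R t) * N1 (R t)" for t
  define Z where "Z t = ?\<eta> t * (2 / (1 - t\<^sup>2)) * L (R t)" for t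
  have contJ: "continuous_on {a..b} J"
    unfolding J_def using t1
    by (intro continuous_intros contc continuous_on_A continuous_on_La continuous_on_N1 cont\<eta>) (auto simp: less_imp_neq[THEN not_sym])
  have contZ: "continuous_on {a..b} Z"
    unfolding Z_def using t1
    by (intro continuous_intros contc contL cont\<eta>) (auto simp: less_imp_neq[THEN not_sym])
  have dH: "((\<lambda>t. ?\<eta> t * (A (R t) * N1 (R t))) has_real_derivative J t + Z t) (at t)" if "t \<in> {a..b}" for t
    by (rule DERIV_cong[OF DERIV_mult[OF d\<eta> DERIV_mult[OF DERIV_chain2[OF A_has_derivative dR[OF that]] DERIV_chain2[OF N1_has_derivative dR[OF that]]]]])
      (simp add: J_def Z_def L_def algebra_simps add_divide_distrib)
  have "((\<lambda>t. J t + Z t) has_integral (?\<eta> b * (A (R b) * N1 (R b)) - ?\<eta> a * (A (R a) * N1 (R a)))) {a..b}"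
    by (rule fundamental_theorem_of_calculus)
      (use dH ab in \<open>auto simp: has_real_derivative_iff_has_vector_derivative[symmetric] intro: has_field_derivative_at_within\<close>)
  moreover have "?\<eta> a = 0" "?\<eta> b = 0" by (simp_all add: bump_def)
  ultimately have JZ: "((\<lambda>t. J t + Z t) has_integral 0) {a..b}" by simp
  have "(\<integral>t. indicator {a..b} t *\<^sub>R J t \<partial>lborel) = 0"
  proof -
    let ?K = "\<lambda>t \<omega>. indicator (ball 0 1) (t *\<^sub>R \<omega>) *\<^sub>R (radial_density t *
      (?\<eta> t * laplace_beltrami g f (E (t *\<^sub>R \<omega>))
        + ?\<eta>' t * ((1 - t\<^sup>2)\<^sup>2 / 2) * frechet_derivative f (at (E (t *\<^sub>R \<omega>))) (DE (t *\<^sub>R \<omega>) (t *\<^sub>R \<omega>))))"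
    have "indicator {0..1} t * t ^ (DIM('a \<times> real) - 1) * (\<integral>\<omega>. ?K t \<omega> \<partial>sphere_measure) = indicator {a..b} t *\<^sub>R J t" for t
    proof (cases "t \<in> {a..b}")
      case True
      have t: "0 < t" "t < 1" using True ab by auto
      have K: "?K t \<omega> = radial_density t * (?\<eta> t * laplace_beltrami g f (ray (R t) \<omega>) + ?\<eta>' t * (1 - t\<^sup>2) * t * ur1 (R t, \<omega>))"
        if \<omega>: "\<omega> \<in> space sphere_measure" for \<omega>
      proof -
        have n: "norm \<omega> \<le> 1" "norm \<omega> = 1" using \<omega> by simp_all
        have v: "norm (t *\<^sub>R \<omega>) < 1" using n t by simp
        have "DE (t *\<^sub>R \<omega>) (t *\<^sub>R \<omega>) = t *\<^sub>R DE (t *\<^sub>R \<omega>) \<omega>"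
          by (rule linear_cmul[OF linear_DE[OF v]])
        then have "(1 - t\<^sup>2) / 2 * frechet_derivative f (at (E (t *\<^sub>R \<omega>))) (DE (t *\<^sub>R \<omega>) (t *\<^sub>R \<omega>)) = t * ur1 (R t, \<omega>)"
          unfolding ur1_eq[OF n(1)] by (simp add: ray_def tR[OF True] linear_cmul[OF linear_Df[OF f]])
        then have "(1 - t\<^sup>2)\<^sup>2 / 2 * frechet_derivative f (at (E (t *\<^sub>R \<omega>))) (DE (t *\<^sub>R \<omega>) (t *\<^sub>R \<omega>)) = (1 - t\<^sup>2) * (t * ur1 (R t, \<omega>))"
          by (simp add: power2_eq_square)
        moreover have "ray (R t) \<omega> = E (t *\<^sub>R \<omega>)" by (simp add: ray_def tR[OF True])
        ultimately show ?thesis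
          using v by (simp add: mult.assoc del: norm_scaleR)
      qed
      have "(\<integral>\<omega>. ?K t \<omega> \<partial>sphere_measure) = (\<integral>\<omega>. radial_density t * (?\<eta> t * laplace_beltrami g f (ray (R t) \<omega>) + ?\<eta>' t * (1 - t\<^sup>2) * t * ur1 (R t, \<omega>)) \<partial>sphere_measure)"
        by (rule Bochner_Integration.integral_cong[OF refl K])
      also have "\<dots> = radial_density t * (?\<eta> t * La (R t) + ?\<eta>' t * (1 - t\<^sup>2) * t * N1 (R t))"
      proof -
        have "continuous_on (sphere 0 1) (\<lambda>\<omega>. laplace_beltrami g f (ray (R t) \<omega>))"
          by (rule continuous_on_compose2[OF continuous_on_laplace_beltrami[OF f, of UNIV] continuous_on_ray_sphere]) simp
        moreover have "continuous_on (sphere 0 1) (\<lambda>\<omega>. ur1 (R t, \<omega>))"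
          by (rule continuous_on_compose2[OF continuous_on_ur12(1)]) (auto intro!: continuous_intros)
        ultimately have "integrable sphere_measure (\<lambda>\<omega>. laplace_beltrami g f (ray (R t) \<omega>))" "integrable sphere_measure (\<lambda>\<omega>. ur1 (R t, \<omega>))"
          by (auto intro: sphere_measure.integrable_continuous)
        then show ?thesis by (simp add: La_def N1_def)
      qed
      finally have I: "(\<integral>\<omega>. ?K t \<omega> \<partial>sphere_measure) = radial_density t * (?\<eta> t * La (R t) + ?\<eta>' t * (1 - t\<^sup>2) * t * N1 (R t))" .
      \<comment> \<open>The radial volume element in two forms: \<open>2 / (1 - t^2)\<close> is the
        derivative of the radius \<open>R t\<close>.\<close>
      have "t ^ (DIM('a \<times> real) - 1) * radial_density t = 2 / (1 - t\<^sup>2) * A (R t)"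
      proof -
        have q: "1 - t\<^sup>2 > 0" using t1[OF True] .
        obtain m where m: "DIM('a \<times> real) = Suc m" using DIM_positive gr0_implies_Suc by blast
        have "(1 - t\<^sup>2) powr - (Q + 1) = (1 - t\<^sup>2) powr - Q / (1 - t\<^sup>2)"
          using q powr_add[of "1 - t\<^sup>2" "- Q" "- 1"] by (simp add: powr_minus_divide)
        then show ?thesis
          unfolding A_def radial_density_def[OF f] tR[OF True] m by simp
      qed
      then have pw: "t ^ (DIM('a \<times> real) - 1) * (radial_density t * y) = 2 / (1 - t\<^sup>2) * A (R t) * y" for y
        by (simp only: mult.assoc[symmetric])
      have alg: "2 / q * x * (h * y + h' * q * t * z) = 2 / q * x * h * y + 2 * t * h' * x * z" if "q \<noteq> 0"
        for q x h y h' z :: real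
        using that by (simp add: field_simps)
      have "indicator {0..1} t = (1::real)" "indicator {a..b} t = (1::real)"
        using True t by (simp_all add: indicator_def)
      then show ?thesis
        unfolding I J_def using t1[OF True]
        by (simp only: mult_1 scaleR_one mult.assoc[of 1] pw alg[OF less_imp_neq[OF t1[OF True], THEN not_sym]])
    next
      case False
      show ?thesis
      proof (cases "t \<in> {0..1}")
        case True
        then have "t\<^sup>2 < a\<^sup>2 \<or> t\<^sup>2 > b\<^sup>2"
          using False ab by (auto simp: power_strict_mono not_le)
        then have "?\<eta> t = 0" "?\<eta>' t = 0" by (auto simp: bump_def bump'_def)
        then show ?thesis using False by simp
      qed (use False in simp)
    qed
    then show ?thesis
      using Green_weak[OF f ab] by (simp only:)
  qed
  moreover have "(\<integral>t. indicator {a..b} t *\<^sub>R J t \<partial>lborel) = integral {a..b} J"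
    using set_borel_integral_eq_integral(2)[of "{a..b}" J] borel_integrable_atLeastAtMost'[OF contJ]
    by (simp add: set_lebesgue_integral_def)
  ultimately have "(J has_integral 0) {a..b}"
    using integrable_integral[OF integrable_continuous_interval[OF contJ]] by simp
  from has_integral_diff[OF JZ this] have "(Z has_integral 0) {a..b}" by simp
  then have "((\<lambda>t. L r0 * Z t) has_integral 0) {a..b}"
    using has_integral_mult_right[of Z 0 "{a..b}" "L r0"] by simp
  moreover have "0 \<le> L r0 * Z t" if "t \<in> {a..b}" for t
  proof -
    have "L r0 * Z t = ?\<eta> t * (2 / (1 - t\<^sup>2)) * (L r0 * L (R t))" by (simp add: Z_def)
    moreover have "?\<eta> t \<ge> 0" by (simp add: bump_def)
    ultimately show ?thesis using t1[OF that] Lpos[OF Rbd[OF that]] by simp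
  qed
  moreover have t0: "tanh (r0 / 2) \<in> {a..b}"
    using e by (simp add: a_def b_def)
  moreover have "continuous_on {a..b} (\<lambda>t. L r0 * Z t)"
    by (intro continuous_on_mult continuous_on_const contZ)
  ultimately have "L r0 * Z (tanh (r0 / 2)) = 0"
    using has_integral_0_cbox_imp_0[of a b "\<lambda>t. L r0 * Z t" "tanh (r0 / 2)"] ab
    unfolding cbox_interval box_real by auto
  moreover have "R (tanh (r0 / 2)) = r0" by (simp add: R_def artanh_tanh_real)
  moreover have "?\<eta> (tanh (r0 / 2)) > 0"
  proof -
    have "a < tanh (r0 / 2)" "tanh (r0 / 2) < b" using e by (simp_all add: a_def b_def)
    then have "a\<^sup>2 < (tanh (r0 / 2))\<^sup>2" "(tanh (r0 / 2))\<^sup>2 < b\<^sup>2"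
      using ab r0 by (auto intro!: power_strict_mono)
    then show ?thesis by (simp add: bump_def)
  qed
  ultimately show False
    using t1[OF t0] L0 by (simp add: Z_def)
qed

end

end

section \<open>The ball model of a Damek--Ricci space\<close>

locale damek_ricci_space =
  fixes B :: "'a::euclidean_space set" and br :: "'a \<Rightarrow> 'a \<Rightarrow> 'a"
  assumes damek_ricci: "damek_ricci B br"
begin

section \<open>Algebra of Heisenberg type\<close>

abbreviation P :: "'a \<Rightarrow> 'a" where "P \<equiv> X_part B"
abbreviation R :: "'a \<Rightarrow> 'a" where "R \<equiv> Y_part B"

lemma B_Basis: "B \<subseteq> Basis" and fin_B [simp]: "finite B"
  using damek_ricci finite_subset[OF _ finite_Basis] unfolding damek_ricci_def by auto

lemma linear_P: "linear P" and linear_R: "linear R"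
  unfolding X_part_def Y_part_def
  by (auto intro!: linearI simp: inner_add_left scaleR_add_left sum.distrib scaleR_sum_right)

lemmas PR_linear = linear_add[OF linear_P] linear_diff[OF linear_P] linear_cmul[OF linear_P]
  linear_neg[OF linear_P] linear_0[OF linear_P]
  linear_add[OF linear_R] linear_diff[OF linear_R] linear_cmul[OF linear_R]
  linear_neg[OF linear_R] linear_0[OF linear_R]

lemma P_plus_R: "P v + R v = v"
proof -
  have "P v + R v = (\<Sum>b\<in>Basis. (v \<bullet> b) *\<^sub>R b)"
    unfolding X_part_def Y_part_def
    using sum.subset_diff[OF B_Basis finite_Basis, of "\<lambda>b. (v \<bullet> b) *\<^sub>R b"] by (simp add: add.commute)
  then show ?thesis by (simp add: euclidean_representation)
qed

lemma P_inner_Basis: "b \<in> Basis \<Longrightarrow> P v \<bullet> b = (if b \<in> B then v \<bullet> b else 0)"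
  unfolding X_part_def using B_Basis
  by (auto simp: inner_sum_left inner_Basis if_distrib subset_iff sum.If_cases cong: if_cong)

lemma P_Basis: "b \<in> Basis \<Longrightarrow> P b = (if b \<in> B then b else 0)"
  by (rule euclidean_eqI) (auto simp: P_inner_Basis inner_Basis)

lemma R_eq: "R v = v - P v"
  using P_plus_R[of v] by (simp add: algebra_simps)

lemma P_P [simp]: "P (P v) = P v"
  by (rule euclidean_eqI) (simp add: P_inner_Basis)

lemma P_R [simp]: "P (R v) = 0" and R_P [simp]: "R (P v) = 0" and R_R [simp]: "R (R v) = R v"
  by (simp_all add: R_eq linear_diff[OF linear_P])

lemma P_inner_R [simp]: "P v \<bullet> R w = 0"
proof -
  have "(P v \<bullet> b) * (R w \<bullet> b) = 0" if "b \<in> Basis" for b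
    using that by (simp add: R_eq inner_diff_left P_inner_Basis)
  then show ?thesis
    by (subst euclidean_inner) (auto intro!: sum.neutral)
qed

lemma R_inner_P [simp]: "R w \<bullet> P v = 0"
  by (simp add: inner_commute)

lemma P_in_span: "P v \<in> span B"
  unfolding X_part_def by (intro span_sum span_scale span_base)

lemma R_in_span: "R v \<in> span (Basis - B)"
  unfolding Y_part_def by (intro span_sum span_scale span_base)

lemma P_span: "v \<in> span B \<Longrightarrow> P v = v"
  by (induction rule: span_induct_alt)
    (use B_Basis in \<open>auto simp: PR_linear P_Basis subset_iff\<close>)

lemma R_span: "v \<in> span (Basis - B) \<Longrightarrow> R v = v"
  by (induction rule: span_induct_alt) (auto simp: PR_linear R_eq P_Basis)

lemma inner_split: "v \<bullet> w = P v \<bullet> P w + R v \<bullet> R w"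
proof -
  have "v \<bullet> w = (P v + R v) \<bullet> (P w + R w)" by (simp only: P_plus_R)
  then show ?thesis by (simp add: inner_add_left inner_add_right)
qed

lemma bilinear_br: "bilinear br"
  using damek_ricci unfolding damek_ricci_def heisenberg_type_def by blast

lemmas br_simps = bilinear_ladd[OF bilinear_br] bilinear_radd[OF bilinear_br]
  bilinear_lmul[OF bilinear_br] bilinear_rmul[OF bilinear_br]
  bilinear_lneg[OF bilinear_br] bilinear_rneg[OF bilinear_br]
  bilinear_lsub[OF bilinear_br] bilinear_rsub[OF bilinear_br]
  bilinear_lzero[OF bilinear_br] bilinear_rzero[OF bilinear_br]

text \<open>The bracket with both arguments projected to the X-space, so that the values of
  \<open>br\<close> elsewhere never enter.\<close>

definition bk :: "'a \<Rightarrow> 'a \<Rightarrow> 'a" where "bk u w = br (P u) (P w)"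

lemma bk_linear:
  "bk (u + u') w = bk u w + bk u' w" "bk u (w + w') = bk u w + bk u w'"
  "bk (u - u') w = bk u w - bk u' w" "bk u (w - w') = bk u w - bk u w'"
  "bk (c *\<^sub>R u) w = c *\<^sub>R bk u w" "bk u (c *\<^sub>R w) = c *\<^sub>R bk u w"
  "bk (- u) w = - bk u w" "bk u (- w) = - bk u w" "bk 0 w = 0" "bk u 0 = 0"
  by (simp_all add: bk_def br_simps PR_linear)

lemma bk_PR [simp]: "bk (P u) w = bk u w" "bk u (P w) = bk u w" "bk (R u) w = 0" "bk u (R w) = 0"
  by (simp_all add: bk_def br_simps)

lemma R_bk [simp]: "R (bk u w) = bk u w" and P_bk [simp]: "P (bk u w) = 0"
proof -
  have "bk u w \<in> span (Basis - B)"
    using damek_ricci P_in_span unfolding damek_ricci_def heisenberg_type_def bk_def by blast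
  then show "R (bk u w) = bk u w" by (rule R_span)
  then show "P (bk u w) = 0" by (simp add: R_eq)
qed

lemma bk_bk [simp]: "bk u (bk v w) = 0" "bk (bk v w) u = 0"
  using bk_PR(2)[of u "bk v w"] bk_PR(1)[of "bk v w" u] by (simp_all add: bk_linear)

lemma bk_skew: "bk w u = - bk u w"
  using damek_ricci P_in_span unfolding damek_ricci_def heisenberg_type_def bk_def by blast

lemma bk_self [simp]: "bk u u = 0"
  by (rule eq_neg_self_imp_zero) (rule bk_skew)

text \<open>The endomorphism J_Y, recovered from its inner products with the basis of the X-space. A
  formula, in place of the existential in \<open>heisenberg_type\<close>, makes the dependence on
  both arguments visibly bilinear.\<close>

definition J :: "'a \<Rightarrow> 'a \<Rightarrow> 'a" where
  "J Y X = (\<Sum>b\<in>B. (R Y \<bullet> bk X b) *\<^sub>R b)"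

lemma P_J [simp]: "P (J Y X) = J Y X"
  unfolding J_def by (intro P_span span_sum span_scale span_base)

lemma R_J [simp]: "R (J Y X) = 0"
  by (simp add: R_eq)

lemma J_linear:
  "J (Y + Y') X = J Y X + J Y' X" "J Y (X + X') = J Y X + J Y X'"
  "J (Y - Y') X = J Y X - J Y' X" "J Y (X - X') = J Y X - J Y X'"
  "J (c *\<^sub>R Y) X = c *\<^sub>R J Y X" "J Y (c *\<^sub>R X) = c *\<^sub>R J Y X"
  "J (- Y) X = - J Y X" "J Y (- X) = - J Y X" "J 0 X = 0" "J Y 0 = 0"
  unfolding J_def
  by (simp_all add: PR_linear bk_linear inner_simps scaleR_add_left scaleR_diff_left sum.distrib
      sum_subtractf scaleR_sum_right sum_negf)

lemma J_PR [simp]: "J (R Y) X = J Y X" "J Y (P X) = J Y X" "J (P Y) X = 0" "J Y (R X) = 0"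
  unfolding J_def by simp_all

lemma J_inner: "J Y X \<bullet> w = R Y \<bullet> bk X w"
proof -
  have "J Y X \<bullet> w = (\<Sum>b\<in>B. (R Y \<bullet> bk X b) * (w \<bullet> b))"
    unfolding J_def by (simp add: inner_sum_left inner_commute[of w])
  also have "\<dots> = R Y \<bullet> bk X (\<Sum>b\<in>B. (w \<bullet> b) *\<^sub>R b)"
  proof -
    have "bk X (\<Sum>b\<in>B. (w \<bullet> b) *\<^sub>R b) = (\<Sum>b\<in>B. (w \<bullet> b) *\<^sub>R bk X b)"
      by (simp add: linear_sum[OF linearI[of "bk X"]] bk_linear)
    then show ?thesis by (simp add: inner_sum_right mult.commute)
  qed
  finally show ?thesis by (simp add: X_part_def[symmetric])
qed

text \<open>The endomorphism provided by \<open>heisenberg_type\<close> takes values in the X-space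
  and has the same inner products there, so it agrees with \<open>J Y\<close>.\<close>

lemma J_J: "J Y (J Y X) = - ((R Y \<bullet> R Y) *\<^sub>R P X)"
proof -
  obtain K where K: "K ` span B \<subseteq> span B"
    "\<And>X X'. X \<in> span B \<Longrightarrow> X' \<in> span B \<Longrightarrow> K X \<bullet> X' = R Y \<bullet> br X X'"
    "\<And>X. X \<in> span B \<Longrightarrow> K (K X) = - ((norm (R Y))\<^sup>2 *\<^sub>R X)"
    using damek_ricci R_in_span[of Y] unfolding damek_ricci_def heisenberg_type_def by meson
  have KJ: "K (P X) = J Y X" for X
  proof (rule vector_eq_rdot[THEN iffD1], rule allI)
    fix w
    have "K (P X) \<in> span B" using K(1) P_in_span by blast
    then have PK: "P (K (P X)) = K (P X)" by (rule P_span)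
    have "K (P X) \<bullet> w = K (P X) \<bullet> P w"
      using inner_split[of "K (P X)" w] by (simp add: PK R_eq)
    also have "\<dots> = J Y X \<bullet> w"
      using K(2)[OF P_in_span P_in_span] by (simp add: J_inner bk_def)
    finally show "K (P X) \<bullet> w = J Y X \<bullet> w" .
  qed
  have "J Y (J Y X) = K (K (P X))"
    using KJ[of X] KJ[of "J Y X"] by simp
  then show ?thesis
    using K(3)[OF P_in_span] by (simp add: power2_norm_eq_inner)
qed

lemma J_inner_J: "J Y X \<bullet> J Y X = (R Y \<bullet> R Y) * (P X \<bullet> P X)"
proof -
  have "J Y X \<bullet> J Y X = - (R Y \<bullet> bk (J Y X) X)"
    by (simp add: J_inner bk_skew[of "J Y X" X])
  also have "\<dots> = - (J Y (J Y X) \<bullet> X)"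
    by (simp add: J_inner)
  also have "\<dots> = (R Y \<bullet> R Y) * (P X \<bullet> P X)"
    using inner_split[of "P X" X] by (simp add: J_J)
  finally show ?thesis .
qed

lemma J_inner_self [simp]: "J Y X \<bullet> X = 0" "X \<bullet> J Y X = 0" "J Y X \<bullet> P X = 0" "P X \<bullet> J Y X = 0"
  by (simp_all add: J_inner inner_commute[of _ "J Y X"])

lemma J_inner_R [simp]: "J Y X \<bullet> R w = 0" "R w \<bullet> J Y X = 0"
  by (simp_all add: J_inner inner_commute[of _ "J Y X"])

text \<open>Polarizing \<open>J_inner_J\<close> in \<open>Y\<close> gives the inner product of
  \<open>J W X\<close> with \<open>J Y X\<close>, which is that of \<open>W\<close> with the
  bracket.\<close>

lemma bk_J: "bk X (J Y X) = (P X \<bullet> P X) *\<^sub>R R Y"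
proof (rule vector_eq_ldot[THEN iffD1], rule allI)
  fix W
  have "2 * (J W X \<bullet> J Y X) = 2 * ((R W \<bullet> R Y) * (P X \<bullet> P X))"
    using J_inner_J[of "W + Y" X] J_inner_J[of W X] J_inner_J[of Y X]
    by (simp add: J_linear PR_linear inner_simps inner_commute algebra_simps)
  moreover have "W \<bullet> bk X (J Y X) = R W \<bullet> bk X (J Y X)" "W \<bullet> R Y = R W \<bullet> R Y"
    using inner_split[of W "bk X (J Y X)"] inner_split[of W "R Y"] by simp_all
  ultimately show "W \<bullet> bk X (J Y X) = W \<bullet> ((P X \<bullet> P X) *\<^sub>R R Y)"
    by (simp add: J_inner)
qed

lemma bounded_linear_P: "bounded_linear P" and bounded_linear_R: "bounded_linear R"
  using linear_P linear_R by (simp_all add: linear_conv_bounded_linear)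

lemma bounded_bilinear_bk: "bounded_bilinear bk"
  by (simp add: bilinear_conv_bounded_bilinear[symmetric] bilinear_def bk_linear linearI)

lemma bounded_bilinear_J: "bounded_bilinear J"
  by (simp add: bilinear_conv_bounded_bilinear[symmetric] bilinear_def J_linear linearI)

section \<open>Left translations and the left-invariant frame\<close>

definition Dm :: "'a \<times> real \<Rightarrow> 'a \<times> real \<Rightarrow> 'a \<times> real" where
  "Dm p u = (exp (snd p / 2) *\<^sub>R P (fst u) + exp (snd p) *\<^sub>R R (fst u)
      + (exp (snd p / 2) / 2) *\<^sub>R bk (fst p) (fst u), snd u)"

definition Dmi :: "'a \<times> real \<Rightarrow> 'a \<times> real \<Rightarrow> 'a \<times> real" where
  "Dmi p u = (exp (- snd p / 2) *\<^sub>R P (fst u)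
      + exp (- snd p) *\<^sub>R (R (fst u) - (1 / 2) *\<^sub>R bk (fst p) (fst u)), snd u)"

lemma exp_half: "exp (z / 2) * exp (z / 2) = exp z" for z :: real
  by (simp add: exp_add[symmetric])

lemma linear_Dm: "linear (Dm p)" and linear_Dmi: "linear (Dmi p)"
  by (auto intro!: linearI simp: Dm_def Dmi_def PR_linear bk_linear algebra_simps)

lemma Dm_Dmi [simp]: "Dm p (Dmi p u) = u"
proof -
  have "fst (Dm p (Dmi p u)) = P (fst u) + R (fst u)"
    by (simp add: Dm_def Dmi_def PR_linear bk_linear exp_minus exp_add[symmetric] field_simps scaleR_diff_right)
  then show ?thesis
    by (intro prod_eqI) (simp_all add: P_plus_R, simp add: Dm_def Dmi_def)
qed

lemma Dmi_Dm [simp]: "Dmi p (Dm p u) = u"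
proof -
  have "fst (Dmi p (Dm p u)) = P (fst u) + R (fst u)"
    by (simp add: Dm_def Dmi_def PR_linear bk_linear exp_minus exp_add[symmetric] field_simps scaleR_diff_right)
  then show ?thesis
    by (intro prod_eqI) (simp_all add: P_plus_R, simp add: Dm_def Dmi_def)
qed

text \<open>In these coordinates left multiplication is affine, so its linear part
  \<open>Dm p\<close> is its differential everywhere, and the images of the standard basis under
  \<open>Dm p\<close> are the left-invariant frame.\<close>

lemma dr_mult_eq: "dr_mult B br p q = p + Dm p q"
proof -
  have "fst (dr_mult B br p q) = (P (fst p) + R (fst p)) + fst (Dm p q)"
    by (simp add: dr_mult_def Let_def Dm_def bk_def)
  then show ?thesis
    by (intro prod_eqI) (simp_all add: P_plus_R, simp add: dr_mult_def Dm_def Let_def)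
qed

lemma frechet_dr_mult: "frechet_derivative (dr_mult B br p) (at 0) = Dm p"
proof -
  have "((\<lambda>q. p + Dm p q) has_derivative Dm p) (at 0)"
    using linear_Dm[of p] by (auto intro!: derivative_eq_intros bounded_linear_imp_has_derivative simp: linear_conv_bounded_linear)
  then show ?thesis
    unfolding dr_mult_eq[abs_def] by (rule frechet_derivative_at[symmetric])
qed

lemma inv_Dm: "inv (Dm p) = Dmi p"
  by (rule inv_equality) simp_all

lemma dr_metric_eq: "dr_metric B br p u w = Dmi p u \<bullet> Dmi p w"
  by (simp add: dr_metric_def frechet_dr_mult inv_Dm)

text \<open>The chain rule for a product of left translations, since \<open>p + Dm p q\<close> is
  the group product. This left invariance of the frame is what moves the centre of the ball
  model.\<close>

lemma Dm_add: "Dm (p + Dm p q) u = Dm p (Dm q u)"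
  by (rule prod_eqI)
    (simp_all add: Dm_def PR_linear bk_linear exp_add add_divide_distrib
        exp_half[of "snd p", symmetric] exp_half[of "snd q", symmetric] algebra_simps)

end

context damek_ricci_space
begin

lemma prod_Basis_prod_real:
  "(\<Prod>b\<in>(Basis :: ('a \<times> real) set). c b) = (\<Prod>b\<in>Basis. c (b, 0)) * c (0, 1)"
proof -
  have Basis_eq: "(Basis :: ('a \<times> real) set) = insert (0, 1) ((\<lambda>u. (u, 0)) ` Basis)"
    by (auto simp: Basis_prod_def)
  have "inj_on (\<lambda>u::'a. (u, 0::real)) Basis" "(0, 1) \<notin> (\<lambda>u::'a. (u, 0::real)) ` Basis"
    by (auto simp: inj_on_def)
  then show ?thesis
    unfolding Basis_eq by (simp add: prod.reindex mult.commute)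
qed

lemma det_lin_blocks:
  "det_lin (\<lambda>u::'a \<times> real. (\<alpha> *\<^sub>R P (fst u) + \<beta> *\<^sub>R R (fst u), \<gamma> * snd u))
    = \<alpha> ^ card B * \<beta> ^ card (Basis - B) * \<gamma>"
proof -
  define c where "c b = (if b = (0, 1) then \<gamma> else if fst b \<in> B then \<alpha> else \<beta>)" for b :: "'a \<times> real"
  have "0 \<notin> B" using B_Basis nonzero_Basis by blast
  have "det_lin (\<lambda>u::'a \<times> real. (\<alpha> *\<^sub>R P (fst u) + \<beta> *\<^sub>R R (fst u), \<gamma> * snd u)) = (\<Prod>b\<in>Basis. c b)"
    by (rule det_lin_diag) (auto simp: Basis_prod_def c_def P_Basis R_eq PR_linear)
  also have "\<dots> = (\<Prod>b\<in>Basis. if b \<in> B then \<alpha> else \<beta>) * \<gamma>"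
    unfolding prod_Basis_prod_real by (simp add: c_def)
  also have "(\<Prod>b\<in>Basis. if b \<in> B then \<alpha> else \<beta>) = \<alpha> ^ card B * \<beta> ^ card (Basis - B)"
    using B_Basis by (simp add: prod.If_cases Int_absorb1 Diff_eq)
  finally show ?thesis .
qed

text \<open>The homogeneous dimension of the nilpotent part: its dilations scale X by
  \<open>exp (z / 2)\<close> and Y by \<open>exp z\<close>, hence volume by
  \<open>exp (Q * z)\<close>.\<close>

definition Q :: real where "Q = card B / 2 + card (Basis - B)"

text \<open>The bracket term maps the X-space into the Y-space and kills everything else, so the
  determinant is that of the diagonal part. The involution \<open>?S\<close> changes the sign of the
  X-space.\<close>

lemma det_Dmi: "\<bar>det_lin (Dmi p)\<bar> = exp (- (Q * snd p))"
proof -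
  let ?z = "snd p"
  let ?S = "\<lambda>u::'a \<times> real. (R (fst u) - P (fst u), snd u)"
  let ?L = "\<lambda>u::'a \<times> real. (exp (- ?z / 2) *\<^sub>R P (fst u) + exp (- ?z) *\<^sub>R R (fst u), 1 * snd u)"
  let ?N = "\<lambda>u::'a \<times> real. (- (exp (- ?z) / 2) *\<^sub>R bk (fst p) (fst u), 0::real)"
  have injL: "inj ?L"
  proof (rule inj_on_inverseI)
    fix u :: "'a \<times> real"
    show "(\<lambda>u. (exp (?z / 2) *\<^sub>R P (fst u) + exp ?z *\<^sub>R R (fst u), snd u)) (?L u) = u"
      by (intro prod_eqI) (simp_all add: PR_linear exp_add[symmetric] P_plus_R)
  qed
  have "\<bar>det_lin (\<lambda>u. ?L u + ?N u)\<bar> = \<bar>det_lin ?L\<bar>"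
  proof (rule abs_det_lin_block_triangular[where S = ?S])
    show "linear ?S" "linear ?L" "linear ?N"
      by (auto intro!: linearI simp: PR_linear bk_linear algebra_simps)
    show "inj ?L" by (rule injL)
  qed (auto simp: PR_linear bk_linear P_plus_R add.commute)
  moreover have "(\<lambda>u. ?L u + ?N u) = Dmi p"
    by (auto simp: Dmi_def fun_eq_iff algebra_simps)
  ultimately have "\<bar>det_lin (Dmi p)\<bar> = exp (- ?z / 2) ^ card B * exp (- ?z) ^ card (Basis - B)"
    unfolding det_lin_blocks by (simp add: abs_mult)
  also have "\<dots> = exp (- (Q * ?z))"
    by (simp add: Q_def exp_of_nat_mult[symmetric] exp_add[symmetric] algebra_simps)
  finally show ?thesis .
qed

lemma smooth_on_P: "open S \<Longrightarrow> smooth_on S f \<Longrightarrow> smooth_on S (\<lambda>x. P (f x))"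
  and smooth_on_R: "open S \<Longrightarrow> smooth_on S f \<Longrightarrow> smooth_on S (\<lambda>x. R (f x))"
  by (auto intro: smooth_on_bounded_linear_compose bounded_linear_P bounded_linear_R)

lemmas smooth_on_J = smooth_on_bilinear[OF _ bounded_bilinear_J]
lemmas smooth_on_bk = smooth_on_bilinear[OF _ bounded_bilinear_bk]

lemma smooth_on_Dm: "open S \<Longrightarrow> smooth_on S f \<Longrightarrow> smooth_on S h \<Longrightarrow> smooth_on S (\<lambda>x. Dm (f x) (h x))"
  unfolding Dm_def by (intro smooth_intros smooth_on_P smooth_on_R smooth_on_bk) auto

lemma smooth_on_Dmi: "open S \<Longrightarrow> smooth_on S f \<Longrightarrow> smooth_on S h \<Longrightarrow> smooth_on S (\<lambda>x. Dmi (f x) (h x))"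
  unfolding Dmi_def by (intro smooth_intros smooth_on_P smooth_on_R smooth_on_bk) auto

lemma frame_metric_dr: "frame_metric (dr_metric B br) Dm Dmi"
proof (rule frame_metric.intro)
  show "smooth_on UNIV (\<lambda>p. Dm p u)" for u
    by (intro smooth_on_Dm smooth_intros) auto
  show "smooth_on UNIV (\<lambda>p::'a \<times> real. \<bar>det_lin (Dmi p)\<bar>)"
    unfolding det_Dmi by (intro smooth_intros) auto
qed (simp_all add: linear_Dm linear_Dmi dr_metric_eq)

section \<open>The ball model as a Cayley transform\<close>

definition chi :: "'a \<times> real \<Rightarrow> real" where
  "chi v = (1 - snd v)\<^sup>2 + R (fst v) \<bullet> R (fst v)"

text \<open>The Cayley transform of the unit ball onto the Siegel domain of points (X, Y, a) with a
  > |X|^2 / 4, followed by the change of the last coordinate given by exp z = a - |X|^2 / 4.\<close>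

definition \<Phi> :: "'a \<times> real \<Rightarrow> 'a \<times> real" where
  "\<Phi> v = ((2 / chi v) *\<^sub>R ((1 - snd v) *\<^sub>R P (fst v) + J (fst v) (fst v) + R (fst v)),
    ln ((1 - v \<bullet> v) / chi v))"

text \<open>This is 1 + a for the Siegel coordinate a = exp z + |X|^2 / 4. The inverse Cayley
  transform has \<open>df\<close>, that is (1 + a)^2 + |Y|^2, as its denominator.\<close>

definition sf :: "'a \<times> real \<Rightarrow> real" where
  "sf p = 1 + exp (snd p) + P (fst p) \<bullet> P (fst p) / 4"

definition df :: "'a \<times> real \<Rightarrow> real" where
  "df p = (sf p)\<^sup>2 + R (fst p) \<bullet> R (fst p)"

definition \<Phi>i :: "'a \<times> real \<Rightarrow> 'a \<times> real" where
  "\<Phi>i p = ((1 / df p) *\<^sub>R (sf p *\<^sub>R P (fst p) - J (fst p) (fst p) + 2 *\<^sub>R R (fst p)), 1 - 2 * sf p / df p)"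

lemma inner_pair_split: "v \<bullet> v = P (fst v) \<bullet> P (fst v) + R (fst v) \<bullet> R (fst v) + (snd v)\<^sup>2" for v :: "'a \<times> real"
  using inner_split[of "fst v" "fst v"] by (simp add: inner_prod_def power2_eq_square)

lemma ball_iff: "norm v < 1 \<longleftrightarrow> v \<bullet> v < 1" for v :: "'a \<times> real"
  by (simp add: norm_eq_sqrt_inner)

lemma chi_pos:
  assumes "norm v < 1"
  shows "chi v > 0"
proof -
  have "\<bar>snd v\<bar> < 1"
    using norm_snd_le[of "snd v" "fst v"] assms by simp
  then have "(1 - snd v)\<^sup>2 > 0" by simp
  then show ?thesis by (simp add: chi_def add_pos_nonneg)
qed

lemma sf_gt_1: "sf p > 1"
  by (simp add: sf_def add_pos_nonneg add.assoc)

lemma df_pos: "df p > 0"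
  using sf_gt_1[of p] by (simp add: df_def add_pos_nonneg)

lemma P_\<Phi>: "P (fst (\<Phi> v)) = (2 / chi v) *\<^sub>R ((1 - snd v) *\<^sub>R P (fst v) + J (fst v) (fst v))"
  and R_\<Phi>: "R (fst (\<Phi> v)) = (2 / chi v) *\<^sub>R R (fst v)"
  by (simp_all add: \<Phi>_def PR_linear)

text \<open>Because J_Y is skew with J_Y^2 = -|Y|^2, the map (1 - z) + J_Y multiplies squared norms
  on the X-space by \<open>chi v\<close>.\<close>

lemma P_\<Phi>_sq: assumes "norm v < 1" shows "P (fst (\<Phi> v)) \<bullet> P (fst (\<Phi> v)) = 4 * (P (fst v) \<bullet> P (fst v)) / chi v"
proof -
  let ?w = "(1 - snd v) *\<^sub>R P (fst v) + J (fst v) (fst v)"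
  have "?w \<bullet> ?w = chi v * (P (fst v) \<bullet> P (fst v))"
    by (simp add: inner_simps J_inner_J chi_def power2_eq_square algebra_simps)
  then have "P (fst (\<Phi> v)) \<bullet> P (fst (\<Phi> v)) = 2 / chi v * (2 / chi v) * (chi v * (P (fst v) \<bullet> P (fst v)))"
    unfolding P_\<Phi> by simp
  then show ?thesis
    using chi_pos[OF assms] by (simp add: field_simps)
qed

lemma exp_\<Phi>: assumes "norm v < 1" shows "exp (snd (\<Phi> v)) = (1 - v \<bullet> v) / chi v"
  using chi_pos[OF assms] assms by (simp add: \<Phi>_def ball_iff)

lemma sf_\<Phi>: assumes "norm v < 1" shows "sf (\<Phi> v) = (2 - 2 * snd v) / chi v"
  unfolding sf_def exp_\<Phi>[OF assms] P_\<Phi>_sq[OF assms] inner_pair_split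
  using chi_pos[OF assms] by (simp add: field_simps) (simp add: chi_def power2_eq_square algebra_simps)

lemma df_\<Phi>: assumes "norm v < 1" shows "df (\<Phi> v) = 4 / chi v"
  unfolding df_def sf_\<Phi>[OF assms] R_\<Phi>
  using chi_pos[OF assms] by (simp add: field_simps power2_eq_square) (simp add: chi_def power2_eq_square algebra_simps)

lemma J_fst_\<Phi>: "J (fst (\<Phi> v)) (fst (\<Phi> v)) = (4 / (chi v)\<^sup>2) *\<^sub>R
    ((1 - snd v) *\<^sub>R J (fst v) (fst v) - (R (fst v) \<bullet> R (fst v)) *\<^sub>R P (fst v))"
proof -
  have "J (fst (\<Phi> v)) (fst (\<Phi> v)) = J (R (fst (\<Phi> v))) (P (fst (\<Phi> v)))" by simp
  also have "\<dots> = (4 / (chi v)\<^sup>2) *\<^sub>R ((1 - snd v) *\<^sub>R J (fst v) (fst v) - (R (fst v) \<bullet> R (fst v)) *\<^sub>R P (fst v))"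
  proof -
    have "J (fst v) ((1 - snd v) *\<^sub>R P (fst v) + J (fst v) (fst v))
        = (1 - snd v) *\<^sub>R J (fst v) (fst v) - (R (fst v) \<bullet> R (fst v)) *\<^sub>R P (fst v)"
      by (simp add: J_linear J_J)
    moreover have "J (R (fst (\<Phi> v))) (P (fst (\<Phi> v))) =
        (2 / chi v * (2 / chi v)) *\<^sub>R J (fst v) ((1 - snd v) *\<^sub>R P (fst v) + J (fst v) (fst v))"
      unfolding P_\<Phi> R_\<Phi> by (simp only: J_linear(5,6) J_PR scaleR_scaleR)
    ultimately show ?thesis
      by (simp add: power2_eq_square)
  qed
  finally show ?thesis .
qed

lemma \<Phi>i_\<Phi>:
  assumes v: "norm v < 1"
  shows "\<Phi>i (\<Phi> v) = v"
proof (rule prod_eqI)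
  have pos: "chi v > 0" by (rule chi_pos[OF v])
  show "snd (\<Phi>i (\<Phi> v)) = snd v"
    unfolding \<Phi>i_def snd_conv sf_\<Phi>[OF v] df_\<Phi>[OF v] using pos by (simp add: field_simps)
  have chi: "R (fst v) \<bullet> R (fst v) = chi v - (1 - snd v)\<^sup>2" by (simp add: chi_def)
  have "fst (\<Phi>i (\<Phi> v)) = (1 / (4 / chi v)) *\<^sub>R (((2 - 2 * snd v) / chi v) *\<^sub>R
        ((2 / chi v) *\<^sub>R ((1 - snd v) *\<^sub>R P (fst v) + J (fst v) (fst v)))
      - (4 / (chi v)\<^sup>2) *\<^sub>R ((1 - snd v) *\<^sub>R J (fst v) (fst v) - (R (fst v) \<bullet> R (fst v)) *\<^sub>R P (fst v))
      + 2 *\<^sub>R ((2 / chi v) *\<^sub>R R (fst v)))"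
    unfolding \<Phi>i_def fst_conv sf_\<Phi>[OF v] df_\<Phi>[OF v] J_fst_\<Phi> P_\<Phi> R_\<Phi> ..
  \<comment> \<open>Pairing with an arbitrary vector turns the vector identity into a rational
    identity between real numbers.\<close>
  also have "\<dots> = P (fst v) + R (fst v)"
    unfolding chi by (rule vector_eq_rdot[THEN iffD1], rule allI)
      (use pos in \<open>simp add: inner_add_left inner_diff_left field_simps power2_eq_square\<close>)
  finally show "fst (\<Phi>i (\<Phi> v)) = fst v"
    by (simp add: P_plus_R)
qed

lemma P_\<Phi>i: "P (fst (\<Phi>i p)) = (1 / df p) *\<^sub>R (sf p *\<^sub>R P (fst p) - J (fst p) (fst p))"
  and R_\<Phi>i: "R (fst (\<Phi>i p)) = (2 / df p) *\<^sub>R R (fst p)"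
  by (simp_all add: \<Phi>i_def PR_linear)

lemma chi_\<Phi>i: "chi (\<Phi>i p) = 4 / df p"
proof -
  have "chi (\<Phi>i p) = (4 / (df p)\<^sup>2) * ((sf p)\<^sup>2 + R (fst p) \<bullet> R (fst p))"
    unfolding chi_def R_\<Phi>i by (simp add: \<Phi>i_def power2_eq_square algebra_simps add_divide_distrib)
  also have "(sf p)\<^sup>2 + R (fst p) \<bullet> R (fst p) = df p" by (simp add: df_def)
  finally show ?thesis using df_pos[of p] by (simp add: power2_eq_square)
qed

lemma P_\<Phi>i_sq: "P (fst (\<Phi>i p)) \<bullet> P (fst (\<Phi>i p)) = P (fst p) \<bullet> P (fst p) / df p"
proof -
  let ?w = "sf p *\<^sub>R P (fst p) - J (fst p) (fst p)"
  have "?w \<bullet> ?w = df p * (P (fst p) \<bullet> P (fst p))"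
    by (simp add: inner_simps J_inner_J df_def power2_eq_square algebra_simps)
  then have "P (fst (\<Phi>i p)) \<bullet> P (fst (\<Phi>i p)) = 1 / df p * (1 / df p) * (df p * (P (fst p) \<bullet> P (fst p)))"
    unfolding P_\<Phi>i by simp
  then show ?thesis
    using df_pos[of p] by (simp add: field_simps)
qed

lemma one_minus_\<Phi>i: "1 - \<Phi>i p \<bullet> \<Phi>i p = 4 * exp (snd p) / df p"
proof -
  have d: "R (fst p) \<bullet> R (fst p) = df p - (sf p)\<^sup>2" by (simp add: df_def)
  have "\<Phi>i p \<bullet> \<Phi>i p = P (fst p) \<bullet> P (fst p) / df p + 4 * (R (fst p) \<bullet> R (fst p)) / (df p)\<^sup>2 + (1 - 2 * sf p / df p)\<^sup>2"
    unfolding inner_pair_split P_\<Phi>i_sq R_\<Phi>i by (simp add: \<Phi>i_def power2_eq_square)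
  moreover have "4 * (R (fst p) \<bullet> R (fst p)) / (df p)\<^sup>2 + (1 - 2 * sf p / df p)\<^sup>2 = (4 + df p - 4 * sf p) / df p"
    unfolding d using df_pos[of p] by (simp add: field_simps power2_eq_square)
  ultimately have "\<Phi>i p \<bullet> \<Phi>i p = (P (fst p) \<bullet> P (fst p) + (4 + df p - 4 * sf p)) / df p"
    by (simp add: add_divide_distrib)
  then have "1 - \<Phi>i p \<bullet> \<Phi>i p = (4 * sf p - 4 - P (fst p) \<bullet> P (fst p)) / df p"
    using df_pos[of p] by (simp add: field_simps)
  then show ?thesis by (simp add: sf_def)
qed

lemma norm_\<Phi>i: "norm (\<Phi>i p) < 1"
proof -
  have "1 - \<Phi>i p \<bullet> \<Phi>i p > 0"
    unfolding one_minus_\<Phi>i using df_pos[of p] by simp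
  then show ?thesis by (simp add: ball_iff)
qed

lemma \<Phi>_\<Phi>i: "\<Phi> (\<Phi>i p) = p"
proof (rule prod_eqI)
  have pos: "df p > 0" by (rule df_pos)
  show "snd (\<Phi> (\<Phi>i p)) = snd p"
    unfolding \<Phi>_def snd_conv chi_\<Phi>i one_minus_\<Phi>i using pos by simp
  have Jp: "J (fst (\<Phi>i p)) (fst (\<Phi>i p)) = (2 / (df p)\<^sup>2) *\<^sub>R
      (sf p *\<^sub>R J (fst p) (fst p) + (R (fst p) \<bullet> R (fst p)) *\<^sub>R P (fst p))"
  proof -
    have "J (fst (\<Phi>i p)) (fst (\<Phi>i p)) = J (R (fst (\<Phi>i p))) (P (fst (\<Phi>i p)))" by simp
    also have "\<dots> = (1 / df p * (2 / df p)) *\<^sub>R J (fst p) (sf p *\<^sub>R P (fst p) - J (fst p) (fst p))"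
      unfolding P_\<Phi>i R_\<Phi>i by (simp only: J_linear(5,6) J_PR scaleR_scaleR)
    also have "J (fst p) (sf p *\<^sub>R P (fst p) - J (fst p) (fst p)) = sf p *\<^sub>R J (fst p) (fst p) + (R (fst p) \<bullet> R (fst p)) *\<^sub>R P (fst p)"
      by (simp add: J_linear J_J)
    also have "1 / df p * (2 / df p) = 2 / (df p)\<^sup>2" by (simp add: power2_eq_square)
    finally show ?thesis .
  qed
  have sn: "1 - snd (\<Phi>i p) = 2 * sf p / df p" by (simp add: \<Phi>i_def)
  have d: "R (fst p) \<bullet> R (fst p) = df p - (sf p)\<^sup>2" by (simp add: df_def)
  have "fst (\<Phi> (\<Phi>i p)) = (df p / 2) *\<^sub>R ((2 / (df p)\<^sup>2 * (sf p)\<^sup>2) *\<^sub>R P (fst p)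
      + (2 / (df p)\<^sup>2 * (R (fst p) \<bullet> R (fst p))) *\<^sub>R P (fst p) + (2 / df p) *\<^sub>R R (fst p))"
    unfolding \<Phi>_def fst_conv chi_\<Phi>i Jp sn P_\<Phi>i R_\<Phi>i
    by (simp add: algebra_simps power2_eq_square diff_divide_distrib)
  also have "\<dots> = P (fst p) + R (fst p)"
  proof -
    have k: "df p / 2 * (2 / (df p)\<^sup>2 * (sf p)\<^sup>2 + 2 / (df p)\<^sup>2 * (R (fst p) \<bullet> R (fst p))) = 1"
      "df p / 2 * (2 / df p) = 1"
      unfolding d using pos by (simp_all add: field_simps power2_eq_square)
    show ?thesis
      by (simp only: scaleR_add_left[symmetric] scaleR_add_right scaleR_scaleR k scaleR_one)
  qed
  finally show "fst (\<Phi> (\<Phi>i p)) = fst p"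
    by (simp add: P_plus_R)
qed

lemma smooth_on_chi: "open S \<Longrightarrow> smooth_on S f \<Longrightarrow> smooth_on S (\<lambda>x. chi (f x))"
  unfolding chi_def by (intro smooth_intros smooth_on_R) auto

lemma smooth_on_\<Phi>: "smooth_on (ball 0 1) \<Phi>"
  unfolding \<Phi>_def
proof (intro smooth_intros smooth_on_P smooth_on_R smooth_on_J smooth_on_chi)
  show "chi v \<noteq> 0" if "v \<in> ball 0 1" for v using chi_pos[of v] that by simp
  then show "chi v \<noteq> 0" if "v \<in> ball 0 1" for v using that by simp
  show "(1 - v \<bullet> v) / chi v > 0" if "v \<in> ball 0 1" for v :: "'a \<times> real"
    using chi_pos[of v] that by (simp add: ball_iff)
qed auto

lemma smooth_on_\<Phi>i: "smooth_on UNIV \<Phi>i"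
proof -
  have s: "smooth_on UNIV sf"
    unfolding sf_def[abs_def] by (intro smooth_intros smooth_on_P) auto
  have d: "smooth_on UNIV df"
    unfolding df_def[abs_def] by (intro smooth_intros smooth_on_R s) auto
  have nz: "df p \<noteq> 0" for p using df_pos[of p] by simp
  show ?thesis
    unfolding \<Phi>i_def[abs_def]
    by (intro smooth_intros smooth_on_P smooth_on_R smooth_on_J s d nz) auto
qed

end

section \<open>The Gauss lemma for the ball model\<close>

context damek_ricci_space
begin

lemma \<Phi>_has_derivative:
  "norm v < 1 \<Longrightarrow> (\<Phi> has_derivative frechet_derivative \<Phi> (at v)) (at v)"
  using smooth_on_has_derivative[OF smooth_on_\<Phi>, of v] by simp

lemmas PR_has_derivative = bounded_linear.has_derivative[OF bounded_linear_P]
  bounded_linear.has_derivative[OF bounded_linear_R]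

text \<open>\<open>cf p\<close> is $\cosh^2(d/2)$, where $d$ is the distance of \<open>p\<close> from the identity, and
  \<open>nf p\<close> is its gradient in the left-invariant frame.\<close>

definition cf :: "'a \<times> real \<Rightarrow> real" where
  "cf p = df p * exp (- snd p) / 4"

definition nf :: "'a \<times> real \<Rightarrow> 'a \<times> real" where
  "nf p = ((exp (- snd p / 2) / 4) *\<^sub>R (sf p *\<^sub>R P (fst p) + J (fst p) (fst p)) + (1 / 2) *\<^sub>R R (fst p),
    sf p / 2 - cf p)"

lemma cf_\<Phi>:
  assumes v: "norm v < 1"
  shows "cf (\<Phi> v) = 1 / (1 - v \<bullet> v)"
  using chi_pos[OF v] v unfolding cf_def df_\<Phi>[OF v] exp_minus exp_\<Phi>[OF v]
  by (simp add: ball_iff field_simps)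

lemma cf_has_derivative: "(cf has_derivative (\<lambda>w. nf p \<bullet> Dmi p w)) (at p)"
proof -
  let ?d = "\<lambda>w. (2 * sf p * (exp (snd p) * snd w + P (fst p) \<bullet> P (fst w) / 2) + 2 * (R (fst p) \<bullet> R (fst w)))
      * exp (- snd p) / 4 - df p * exp (- snd p) / 4 * snd w"
  have "((\<lambda>p. ((1 + exp (snd p) + P (fst p) \<bullet> P (fst p) / 4)\<^sup>2 + R (fst p) \<bullet> R (fst p)) * exp (- snd p) / 4)
      has_derivative ?d) (at p)"
    by (auto intro!: derivative_eq_intros PR_has_derivative simp: fun_eq_iff sf_def df_def inner_commute power2_eq_square field_simps)
  then have "(cf has_derivative ?d) (at p)"
    by (simp add: cf_def[abs_def] df_def sf_def)
  moreover have "?d (Dm p u) = nf p \<bullet> u" for u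
  proof -
    \<comment> \<open>In terms of \<open>exp (z / 2)\<close> all exponentials are powers of one
      positive number, so the claim becomes a rational identity.\<close>
    define a where "a = exp (snd p / 2)"
    have a: "a > 0" "exp (snd p) = a * a" "exp (- snd p) = 1 / (a * a)" "exp (- (snd p / 2)) = 1 / a"
      by (simp_all add: a_def exp_half exp_minus field_simps)
    have Pu: "P (fst p) \<bullet> fst u = P (fst p) \<bullet> P (fst u)" and Ru: "R (fst p) \<bullet> fst u = R (fst p) \<bullet> R (fst u)"
      using inner_split[of "P (fst p)" "fst u"] inner_split[of "R (fst p)" "fst u"] by simp_all
    have D: "P (fst (Dm p u)) = a *\<^sub>R P (fst u)" "R (fst (Dm p u)) = (a * a) *\<^sub>R R (fst u) + (a / 2) *\<^sub>R bk (fst p) (fst u)"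
      "snd (Dm p u) = snd u"
      by (simp_all add: Dm_def PR_linear a(2) a_def[symmetric])
    have n: "nf p \<bullet> u = 1 / a / 4 * (sf p * (P (fst p) \<bullet> P (fst u)) + R (fst p) \<bullet> bk (fst p) (fst u))
        + (R (fst p) \<bullet> R (fst u)) / 2 + (sf p / 2 - df p * (1 / (a * a)) / 4) * snd u"
      using a(1) by (simp add: nf_def cf_def inner_prod_def inner_add_left J_inner Pu Ru a(3,4) field_simps)
    show ?thesis
      unfolding n D a(2,3) inner_add_right inner_scaleR_right using a(1) by (simp add: field_simps)
  qed
  then have "?d w = nf p \<bullet> Dmi p w" for w
    using Dm_Dmi[of p w] by metis
  ultimately show ?thesis by simp
qed

text \<open>The bracket of X with J_Y X is |X|^2 Y by \<open>bk_J\<close>; it completes the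
  coefficient of Y to \<open>(sf p - 1) / 2\<close>.\<close>

lemma Dm_nf: "Dm p (nf p) = ((1 / 4) *\<^sub>R (sf p *\<^sub>R P (fst p) + J (fst p) (fst p)) + ((sf p - 1) / 2) *\<^sub>R R (fst p),
    sf p / 2 - cf p)"
proof (rule prod_eqI)
  have e: "exp (snd p / 2) * exp (- snd p / 2) = 1"
    by (simp add: exp_add[symmetric])
  have "bk (fst p) (fst (nf p)) = (exp (- snd p / 2) / 4) *\<^sub>R ((P (fst p) \<bullet> P (fst p)) *\<^sub>R R (fst p))"
    by (simp add: nf_def bk_linear bk_J)
  then have "fst (Dm p (nf p)) = (exp (snd p / 2) * exp (- snd p / 2) / 4) *\<^sub>R (sf p *\<^sub>R P (fst p) + J (fst p) (fst p))
      + (exp (snd p) / 2) *\<^sub>R R (fst p)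
      + (exp (snd p / 2) * exp (- snd p / 2) / 8 * (P (fst p) \<bullet> P (fst p))) *\<^sub>R R (fst p)"
    by (simp add: Dm_def nf_def PR_linear)
  also have "\<dots> = (1 / 4) *\<^sub>R (sf p *\<^sub>R P (fst p) + J (fst p) (fst p)) + ((sf p - 1) / 2) *\<^sub>R R (fst p)"
    unfolding e sf_def by (rule vector_eq_rdot[THEN iffD1], rule allI) (simp add: inner_add_left field_simps)
  finally show "fst (Dm p (nf p)) = fst ((1 / 4) *\<^sub>R (sf p *\<^sub>R P (fst p) + J (fst p) (fst p)) + ((sf p - 1) / 2) *\<^sub>R R (fst p),
    sf p / 2 - cf p)"
    by simp
qed (simp add: Dm_def nf_def)

text \<open>The heart of the Gauss lemma: radial vectors are gradients of a function of the radius.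
  The left side is found by differentiating the explicit curve
  \<open>t \<mapsto> \<Phi> (t *\<^sub>R v)\<close> at \<open>t = 1\<close>.\<close>

lemma frechet_\<Phi>_radial:
  assumes v: "norm v < 1"
  shows "frechet_derivative \<Phi> (at v) v = 2 *\<^sub>R Dm (\<Phi> v) (nf (\<Phi> v))"
proof -
  let ?X = "P (fst v)" and ?J = "J (fst v) (fst v)" and ?Y = "R (fst v)" and ?z = "snd v"
  let ?k = "\<lambda>t. (1 - t * ?z)\<^sup>2 + t\<^sup>2 * (?Y \<bullet> ?Y)"
  have pos: "chi v > 0" by (rule chi_pos[OF v])
  have vv: "v \<bullet> v < 1" using v by (simp add: ball_iff)
  have k1: "?k 1 = chi v" by (simp add: chi_def)
  define k' where "k' = 2 * (?Y \<bullet> ?Y) - 2 * ?z * (1 - ?z)"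
  have kk: "2 * chi v = 2 - 2 * ?z + k'"
    by (simp add: chi_def k'_def power2_eq_square algebra_simps)
  have ray: "\<Phi> (t *\<^sub>R v) = ((2 * t * (1 - t * ?z) / ?k t) *\<^sub>R ?X + (2 * t\<^sup>2 / ?k t) *\<^sub>R ?J + (2 * t / ?k t) *\<^sub>R ?Y,
      ln ((1 - t\<^sup>2 * (v \<bullet> v)) / ?k t))" for t
    by (simp add: \<Phi>_def chi_def PR_linear J_linear power2_eq_square scaleR_add_right mult_ac)
  have dk: "(?k has_real_derivative k') (at 1)"
    by (auto intro!: derivative_eq_intros simp: k'_def power2_eq_square algebra_simps)
  have quot: "((\<lambda>t. f t / ?k t) has_real_derivative (f' * chi v - f 1 * k') / (chi v)\<^sup>2) (at 1)"
    if "(f has_real_derivative f') (at 1)" for f f'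
    using DERIV_divide[OF that dk] pos unfolding k1 by (simp add: power2_eq_square)
  have f1: "((\<lambda>t. 2 * t * (1 - t * ?z)) has_real_derivative 2 * (1 - 2 * ?z)) (at 1)"
    and f2: "((\<lambda>t. 2 * t\<^sup>2 :: real) has_real_derivative 4) (at 1)"
    and f3: "((\<lambda>t. 2 * t :: real) has_real_derivative 2) (at 1)"
    by (auto intro!: derivative_eq_intros)
  have d1: "((\<lambda>t. 2 * t * (1 - t * ?z) / ?k t) has_real_derivative
      (2 * (1 - 2 * ?z) * chi v - 2 * (1 - ?z) * k') / (chi v)\<^sup>2) (at 1)"
    and d2: "((\<lambda>t. 2 * t\<^sup>2 / ?k t) has_real_derivative (4 * chi v - 2 * k') / (chi v)\<^sup>2) (at 1)"
    and d3: "((\<lambda>t. 2 * t / ?k t) has_real_derivative (2 * chi v - 2 * k') / (chi v)\<^sup>2) (at 1)"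
    using quot[OF f1] quot[OF f2] quot[OF f3] by simp_all
  have d4: "((\<lambda>t. ln ((1 - t\<^sup>2 * (v \<bullet> v)) / ?k t)) has_real_derivative
      - 2 * (v \<bullet> v) / (1 - v \<bullet> v) - k' / chi v) (at 1)"
  proof -
    have n: "((\<lambda>t. 1 - t\<^sup>2 * (v \<bullet> v)) has_real_derivative - 2 * (v \<bullet> v)) (at 1)"
      by (auto intro!: derivative_eq_intros)
    have q: "((\<lambda>t. (1 - t\<^sup>2 * (v \<bullet> v)) / ?k t) has_real_derivative
        (- 2 * (v \<bullet> v) * chi v - (1 - v \<bullet> v) * k') / (chi v * chi v)) (at 1)"
      by (rule DERIV_cong[OF DERIV_divide[OF n dk]]) (use pos k1 in auto)
    have p: "0 < (1 - 1\<^sup>2 * (v \<bullet> v)) / ?k 1"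
      unfolding k1 using pos vv by simp
    have "((\<lambda>t. ln ((1 - t\<^sup>2 * (v \<bullet> v)) / ?k t)) has_real_derivative
        1 / ((1 - 1\<^sup>2 * (v \<bullet> v)) / ?k 1) * ((- 2 * (v \<bullet> v) * chi v - (1 - v \<bullet> v) * k') / (chi v * chi v))) (at 1)"
      by (rule DERIV_chain2[OF DERIV_ln_divide[OF p] q])
    then show ?thesis
      unfolding k1 by (rule DERIV_cong) (use pos vv in \<open>simp add: field_simps\<close>)
  qed
  have sc: "((\<lambda>t. f t *\<^sub>R X) has_vector_derivative f' *\<^sub>R X) (at 1)"
    if "(f has_real_derivative f') (at 1)" for f f' and X :: 'a
    using has_vector_derivative_scaleR[OF that has_vector_derivative_const[of X]] by simp
  note hv = has_real_derivative_iff_has_vector_derivative[THEN iffD1]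
  have hA: "((\<lambda>t. \<Phi> (t *\<^sub>R v)) has_vector_derivative
      (((2 * (1 - 2 * ?z) * chi v - 2 * (1 - ?z) * k') / (chi v)\<^sup>2) *\<^sub>R ?X
        + ((4 * chi v - 2 * k') / (chi v)\<^sup>2) *\<^sub>R ?J + ((2 * chi v - 2 * k') / (chi v)\<^sup>2) *\<^sub>R ?Y,
       - 2 * (v \<bullet> v) / (1 - v \<bullet> v) - k' / chi v)) (at 1)" (is "(_ has_vector_derivative ?rhs) _")
    unfolding ray
    by (intro has_vector_derivative_Pair has_vector_derivative_add sc[OF d1] sc[OF d2] sc[OF d3] hv[OF d4])
  have hB: "((\<lambda>t. \<Phi> (t *\<^sub>R v)) has_vector_derivative frechet_derivative \<Phi> (at v) v) (at 1)"
  proof -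
    have l: "((\<lambda>t::real. t *\<^sub>R v) has_vector_derivative v) (at 1)"
      by (auto simp: has_vector_derivative_def intro!: derivative_eq_intros)
    have "(\<Phi> has_derivative frechet_derivative \<Phi> (at v)) (at (1 *\<^sub>R v))"
      using \<Phi>_has_derivative[OF v] by simp
    from vector_derivative_diff_chain_within[OF l has_derivative_at_withinI[OF this]] show ?thesis
      by (simp add: o_def)
  qed
  have "frechet_derivative \<Phi> (at v) v = ?rhs"
    by (rule vector_derivative_unique_at[OF hB hA])
  also have "?rhs = 2 *\<^sub>R Dm (\<Phi> v) (nf (\<Phi> v))"
  proof (rule prod_eqI)
    have yy: "?Y \<bullet> ?Y = chi v - (1 - ?z)\<^sup>2" by (simp add: chi_def)
    have k'eq: "k' = 2 * chi v - 2 + 2 * ?z" using kk by simp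
    show "fst ?rhs = fst (2 *\<^sub>R Dm (\<Phi> v) (nf (\<Phi> v)))"
      unfolding Dm_nf sf_\<Phi>[OF v] J_fst_\<Phi> P_\<Phi> R_\<Phi> fst_scaleR fst_conv k'eq yy
      by (rule vector_eq_rdot[THEN iffD1], rule allI)
        (use pos in \<open>simp add: inner_add_left inner_diff_left field_simps power2_eq_square\<close>)
    show "snd ?rhs = snd (2 *\<^sub>R Dm (\<Phi> v) (nf (\<Phi> v)))"
      unfolding Dm_nf sf_\<Phi>[OF v] cf_\<Phi>[OF v] snd_scaleR snd_conv k'eq
      using pos vv by (simp add: field_simps)
  qed
  finally show ?thesis .
qed

text \<open>With the radial vector replaced by twice the gradient of \<open>cf\<close>, the inner
  product is twice the derivative in direction \<open>u\<close> of
  \<open>cf (\<Phi> v) = 1 / (1 - v \<bullet> v)\<close>.\<close>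

lemma gauss_\<Phi>:
  assumes v: "norm v < 1"
  shows "Dmi (\<Phi> v) (frechet_derivative \<Phi> (at v) v) \<bullet> Dmi (\<Phi> v) (frechet_derivative \<Phi> (at v) u)
    = 4 * (v \<bullet> u) / (1 - (norm v)\<^sup>2)\<^sup>2"
proof -
  have vv: "v \<bullet> v < 1" using v by (simp add: ball_iff)
  have "((\<lambda>v. cf (\<Phi> v)) has_derivative (\<lambda>u. nf (\<Phi> v) \<bullet> Dmi (\<Phi> v) (frechet_derivative \<Phi> (at v) u))) (at v)"
    by (rule has_derivative_compose[OF \<Phi>_has_derivative[OF v] cf_has_derivative])
  then have 1: "((\<lambda>v. 1 / (1 - v \<bullet> v)) has_derivative (\<lambda>u. nf (\<Phi> v) \<bullet> Dmi (\<Phi> v) (frechet_derivative \<Phi> (at v) u))) (at v)"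
    by (rule has_derivative_transform_within_open[where s = "ball 0 1"]) (use v cf_\<Phi> in auto)
  have 2: "((\<lambda>v. 1 / (1 - v \<bullet> v)) has_derivative (\<lambda>u. 2 * (v \<bullet> u) / (1 - v \<bullet> v)\<^sup>2)) (at v)"
    using vv by (auto intro!: derivative_eq_intros simp: fun_eq_iff inner_commute power2_eq_square field_simps)
  have "nf (\<Phi> v) \<bullet> Dmi (\<Phi> v) (frechet_derivative \<Phi> (at v) u) = 2 * (v \<bullet> u) / (1 - v \<bullet> v)\<^sup>2"
    using has_derivative_unique[OF 1 2] by metis
  then show ?thesis
    unfolding frechet_\<Phi>_radial[OF v] by (simp add: linear_cmul[OF linear_Dmi] power2_norm_eq_inner)
qed

section \<open>The Jacobian of the ball model\<close>

definition \<Phi>1 :: "'a \<times> real \<Rightarrow> 'a \<times> real" where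
  "\<Phi>1 v = ((2 / chi v) *\<^sub>R ((1 - snd v) *\<^sub>R P (fst v) + J (fst v) (fst v) + R (fst v)),
    2 * (1 - snd v) / chi v - 1)"

definition chi' :: "'a \<times> real \<Rightarrow> 'a \<times> real \<Rightarrow> real" where
  "chi' v u = 2 * (R (fst v) \<bullet> R (fst u)) - 2 * (1 - snd v) * snd u"

text \<open>Since \<open>sf - 1\<close> is the Siegel coordinate, \<open>\<Phi>1\<close> is the
  Cayley transform itself. Being rational, it is easier to differentiate than \<Phi>.\<close>

lemma \<Phi>1_eq: "norm v < 1 \<Longrightarrow> \<Phi>1 v = (fst (\<Phi> v), sf (\<Phi> v) - 1)"
  by (simp add: \<Phi>1_def sf_\<Phi>) (simp add: \<Phi>_def)

text \<open>The diagonal blocks of the derivative of \<open>\<Phi>1\<close> with respect to the splitting into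
  $X$ and $(Y, z)$, and the remaining block.\<close>

definition L\<^sub>0 :: "'a \<times> real \<Rightarrow> 'a \<times> real \<Rightarrow> 'a \<times> real" where
  "L\<^sub>0 v u = ((2 / chi v) *\<^sub>R ((1 - snd v) *\<^sub>R P (fst u) + J (fst v) (fst u)) + (2 / chi v) *\<^sub>R R (fst u)
      - (2 * chi' v u / (chi v)\<^sup>2) *\<^sub>R R (fst v),
    - 2 * snd u / chi v - 2 * (1 - snd v) * chi' v u / (chi v)\<^sup>2)"

definition N\<^sub>0 :: "'a \<times> real \<Rightarrow> 'a \<times> real \<Rightarrow> 'a \<times> real" where
  "N\<^sub>0 v u = ((2 / chi v) *\<^sub>R (J (fst u) (fst v) - snd u *\<^sub>R P (fst v))
      - (2 * chi' v u / (chi v)\<^sup>2) *\<^sub>R ((1 - snd v) *\<^sub>R P (fst v) + J (fst v) (fst v)), 0)"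

lemma \<Phi>1_has_derivative:
  assumes v: "norm v < 1"
  shows "(\<Phi>1 has_derivative (\<lambda>u. L\<^sub>0 v u + N\<^sub>0 v u)) (at v)"
proof -
  have pos: "chi v > 0" by (rule chi_pos[OF v])
  have dchi: "(chi has_derivative chi' v) (at v)"
    unfolding chi_def[abs_def] chi'_def[abs_def]
    by (auto intro!: derivative_eq_intros PR_has_derivative simp: fun_eq_iff inner_commute power2_eq_square algebra_simps)
  have dq: "((\<lambda>v. 2 / chi v) has_derivative (\<lambda>u. - 2 * chi' v u / (chi v)\<^sup>2)) (at v)"
    using pos by (auto intro!: derivative_eq_intros dchi simp: fun_eq_iff power2_eq_square field_simps)
  have dJ: "((\<lambda>v. J (fst v) (fst v)) has_derivative (\<lambda>u. J (fst v) (fst u) + J (fst u) (fst v))) (at v)"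
    by (auto intro!: bounded_bilinear.FDERIV[OF bounded_bilinear_J] derivative_eq_intros)
  have dw: "((\<lambda>v. (1 - snd v) *\<^sub>R P (fst v) + J (fst v) (fst v) + R (fst v)) has_derivative
      (\<lambda>u. (1 - snd v) *\<^sub>R P (fst u) - snd u *\<^sub>R P (fst v) + (J (fst v) (fst u) + J (fst u) (fst v)) + R (fst u))) (at v)"
    by (auto intro!: derivative_eq_intros PR_has_derivative dJ simp: fun_eq_iff)
  have d1: "((\<lambda>v. (2 / chi v) *\<^sub>R ((1 - snd v) *\<^sub>R P (fst v) + J (fst v) (fst v) + R (fst v))) has_derivative
      (\<lambda>u. fst (L\<^sub>0 v u + N\<^sub>0 v u))) (at v)"
    by (rule has_derivative_eq_rhs[OF has_derivative_scaleR[OF dq dw]])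
      (auto simp: fun_eq_iff L\<^sub>0_def N\<^sub>0_def algebra_simps scaleR_diff_right)
  have d2: "((\<lambda>v. (1 - snd v) * (2 / chi v) - 1) has_derivative (\<lambda>u. snd (L\<^sub>0 v u + N\<^sub>0 v u))) (at v)"
  proof -
    have "((\<lambda>v. 1 - snd v) has_derivative (\<lambda>u. - snd u)) (at v)"
      by (auto intro!: derivative_eq_intros)
    from has_derivative_diff[OF has_derivative_mult[OF this dq] has_derivative_const[of 1]] show ?thesis
      by (rule has_derivative_eq_rhs) (auto simp: fun_eq_iff L\<^sub>0_def N\<^sub>0_def algebra_simps)
  qed
  have "((\<lambda>v. ((2 / chi v) *\<^sub>R ((1 - snd v) *\<^sub>R P (fst v) + J (fst v) (fst v) + R (fst v)),
      (1 - snd v) * (2 / chi v) - 1)) has_derivative (\<lambda>u. L\<^sub>0 v u + N\<^sub>0 v u)) (at v)"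
    by (rule has_derivative_eq_rhs[OF has_derivative_Pair[OF d1 d2]]) (simp only: prod.collapse)
  then show ?thesis
    by (simp add: \<Phi>1_def[abs_def] mult.commute)
qed

lemma chi'_linear: "chi' v (a + a', b + b') = chi' v (a, b) + chi' v (a', b')"
  "chi' v (c *\<^sub>R a, c * b) = c * chi' v (a, b)"
  by (simp_all add: chi'_def PR_linear inner_simps algebra_simps)

lemma linear_L\<^sub>0: "linear (L\<^sub>0 v)" and linear_N\<^sub>0: "linear (N\<^sub>0 v)"
  by (auto intro!: linearI simp: L\<^sub>0_def N\<^sub>0_def chi'_linear PR_linear J_linear algebra_simps
      add_divide_distrib diff_divide_distrib)

text \<open>Both diagonal blocks are conformal: (1 - z) + J_Y on the X-space, and on (Y, z) the
  derivative of an inversion centred at (0, 1), up to a reflection and constants.\<close>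

lemma norm_L\<^sub>0:
  assumes v: "norm v < 1"
  shows "L\<^sub>0 v u \<bullet> L\<^sub>0 v u = (2 / sqrt (chi v))\<^sup>2 * (P (fst u) \<bullet> P (fst u))
    + (2 / chi v)\<^sup>2 * (R (fst u) \<bullet> R (fst u) + (snd u)\<^sup>2)"
proof -
  have pos: "chi v > 0" by (rule chi_pos[OF v])
  let ?w = "(1 - snd v) *\<^sub>R P (fst u) + J (fst v) (fst u)"
  let ?y = "R (fst u)" and ?Y = "R (fst v)" and ?c = "chi' v u"
  have w: "?w \<bullet> ?w = chi v * (P (fst u) \<bullet> P (fst u))"
    by (simp add: inner_simps J_inner_J chi_def power2_eq_square algebra_simps)
  have YY: "?Y \<bullet> ?Y = chi v - (1 - snd v)\<^sup>2" by (simp add: chi_def)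
  have Yy: "?Y \<bullet> ?y = ?c / 2 + (1 - snd v) * snd u" by (simp add: chi'_def field_simps)
  let ?b = "(2 / chi v) *\<^sub>R ?y - (2 * ?c / (chi v)\<^sup>2) *\<^sub>R ?Y"
  have "P (fst (L\<^sub>0 v u)) = (2 / chi v) *\<^sub>R ?w" "R (fst (L\<^sub>0 v u)) = ?b"
    by (simp_all add: L\<^sub>0_def PR_linear)
  then have "L\<^sub>0 v u \<bullet> L\<^sub>0 v u = (2 / chi v) * (2 / chi v) * (?w \<bullet> ?w) + ?b \<bullet> ?b
      + (- 2 * snd u / chi v - 2 * (1 - snd v) * ?c / (chi v)\<^sup>2)\<^sup>2"
    unfolding inner_pair_split by (simp add: L\<^sub>0_def)
  also have "?b \<bullet> ?b = 4 / (chi v)\<^sup>2 * (?y \<bullet> ?y) - 8 * ?c / (chi v)^3 * (?c / 2 + (1 - snd v) * snd u)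
      + 4 * ?c\<^sup>2 / (chi v)^4 * (chi v - (1 - snd v)\<^sup>2)"
    using pos unfolding Yy[symmetric] YY[symmetric]
    by (simp add: inner_diff_left inner_diff_right inner_commute[of ?y ?Y] field_simps eval_nat_numeral)
  finally show ?thesis
    unfolding w using pos by (simp add: power_divide) (simp add: field_simps eval_nat_numeral)
qed

text \<open>\<open>N\<^sub>0 v\<close> maps (Y, z) into the X-space and kills the X-space, so the
  determinant is that of \<open>L\<^sub>0 v\<close>. By \<open>norm_L\<^sub>0\<close> the latter can
  be replaced by the diagonal map \<open>?M\<close>.\<close>

lemma det_\<Phi>1:
  assumes v: "norm v < 1"
  shows "\<bar>det_lin (\<lambda>u. L\<^sub>0 v u + N\<^sub>0 v u)\<bar> = (2 / sqrt (chi v)) ^ card B * (2 / chi v) ^ card (Basis - B) * (2 / chi v)"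
proof -
  have pos: "chi v > 0" by (rule chi_pos[OF v])
  let ?S = "\<lambda>u::'a \<times> real. (P (fst u) - R (fst u), - snd u)"
  let ?M = "\<lambda>u::'a \<times> real. ((2 / sqrt (chi v)) *\<^sub>R P (fst u) + (2 / chi v) *\<^sub>R R (fst u), (2 / chi v) * snd u)"
  have linM: "linear ?M"
    by (auto intro!: linearI simp: PR_linear algebra_simps add_divide_distrib)
  have "\<bar>det_lin (\<lambda>u. L\<^sub>0 v u + N\<^sub>0 v u)\<bar> = \<bar>det_lin (L\<^sub>0 v)\<bar>"
  proof (rule abs_det_lin_block_triangular[where S = ?S, OF _ linear_L\<^sub>0 linear_N\<^sub>0])
    show "linear ?S" by (auto intro!: linearI simp: PR_linear algebra_simps)
    show "inj (L\<^sub>0 v)"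
      unfolding linear_injective_0[OF linear_L\<^sub>0]
    proof (intro allI impI)
      fix u assume "L\<^sub>0 v u = 0"
      then have "(2 / sqrt (chi v))\<^sup>2 * (P (fst u) \<bullet> P (fst u)) + (2 / chi v)\<^sup>2 * (R (fst u) \<bullet> R (fst u) + (snd u)\<^sup>2) = 0"
        using norm_L\<^sub>0[OF v, of u] by simp
      then have "P (fst u) = 0 \<and> R (fst u) = 0 \<and> snd u = 0"
        using pos by (simp add: add_nonneg_eq_0_iff)
      then show "u = 0" using P_plus_R[of "fst u"] by (simp add: prod_eq_iff)
    qed
  qed (auto simp: L\<^sub>0_def N\<^sub>0_def chi'_def PR_linear J_linear P_plus_R algebra_simps
      add_divide_distrib diff_divide_distrib)
  also have "\<dots> = \<bar>det_lin ?M\<bar>"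
  proof (rule abs_det_lin_norm_eq[OF linear_L\<^sub>0 linM])
    fix u
    have "L\<^sub>0 v u \<bullet> L\<^sub>0 v u = ?M u \<bullet> ?M u"
      unfolding norm_L\<^sub>0[OF v] inner_pair_split[of "?M u"]
      by (simp add: PR_linear power2_eq_square algebra_simps)
    then show "norm (L\<^sub>0 v u) = norm (?M u)" by (simp add: norm_eq_sqrt_inner)
  qed
  also have "\<dots> = (2 / sqrt (chi v)) ^ card B * (2 / chi v) ^ card (Basis - B) * (2 / chi v)"
    unfolding det_lin_blocks using pos by (simp add: abs_mult)
  finally show ?thesis .
qed

text \<open>\<open>\<Phi>1\<close> is \<Phi> followed by the change from z to exp z + |X|^2 / 4,
  whose triangular derivative has determinant exp z.\<close>

lemma det_\<Phi>:
  assumes v: "norm v < 1"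
  shows "exp (snd (\<Phi> v)) * \<bar>det_lin (frechet_derivative \<Phi> (at v))\<bar> = \<bar>det_lin (\<lambda>u. L\<^sub>0 v u + N\<^sub>0 v u)\<bar>"
proof -
  let ?p = "\<Phi> v"
  let ?G = "\<lambda>p. (fst p, sf p - 1)"
  let ?L = "\<lambda>u::'a \<times> real. (1 *\<^sub>R P (fst u) + 1 *\<^sub>R R (fst u), exp (snd ?p) * snd u)"
  let ?N = "\<lambda>u::'a \<times> real. (0::'a, P (fst ?p) \<bullet> P (fst u) / 2)"
  let ?S = "\<lambda>u::'a \<times> real. (- fst u, snd u)"
  have linL: "linear ?L" and linN: "linear ?N"
    by (auto intro!: linearI simp: PR_linear inner_simps algebra_simps add_divide_distrib)
  have dsf: "(sf has_derivative (\<lambda>u. exp (snd ?p) * snd u + P (fst ?p) \<bullet> P (fst u) / 2)) (at ?p)"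
    unfolding sf_def[abs_def]
    by (auto intro!: derivative_eq_intros PR_has_derivative simp: fun_eq_iff inner_commute)
  have dG: "(?G has_derivative (\<lambda>u. ?L u + ?N u)) (at ?p)"
    by (auto intro!: derivative_eq_intros dsf simp: P_plus_R)
  have "((\<lambda>v. ?G (\<Phi> v)) has_derivative (\<lambda>u. ?L (frechet_derivative \<Phi> (at v) u) + ?N (frechet_derivative \<Phi> (at v) u))) (at v)"
    by (rule has_derivative_compose[OF \<Phi>_has_derivative[OF v] dG])
  then have "(\<Phi>1 has_derivative (\<lambda>u. ?L (frechet_derivative \<Phi> (at v) u) + ?N (frechet_derivative \<Phi> (at v) u))) (at v)"
    by (rule has_derivative_transform_within_open[where s = "ball 0 1"]) (use v \<Phi>1_eq in auto)
  then have "(\<lambda>u. L\<^sub>0 v u + N\<^sub>0 v u) = (\<lambda>u. ?L (frechet_derivative \<Phi> (at v) u) + ?N (frechet_derivative \<Phi> (at v) u))"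
    using has_derivative_unique \<Phi>1_has_derivative[OF v] by blast
  then have "\<bar>det_lin (\<lambda>u. L\<^sub>0 v u + N\<^sub>0 v u)\<bar> = \<bar>det_lin (\<lambda>u. ?L u + ?N u)\<bar> * \<bar>det_lin (frechet_derivative \<Phi> (at v))\<bar>"
    using det_lin_compose[OF linear_compose_add[OF linL linN], of "frechet_derivative \<Phi> (at v)"]
    by (simp add: abs_mult)
  also have "\<bar>det_lin (\<lambda>u. ?L u + ?N u)\<bar> = \<bar>det_lin ?L\<bar>"
  proof (rule abs_det_lin_block_triangular[where S = ?S, OF _ linL linN])
    show "linear ?S" by (auto intro!: linearI simp: algebra_simps)
    show "inj ?L"
      by (rule inj_on_inverseI[of _ "\<lambda>u. (fst u, exp (- snd ?p) * snd u)"])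
        (auto simp: P_plus_R mult.assoc[symmetric] exp_add[symmetric])
  qed (auto simp: PR_linear inner_simps)
  also have "\<bar>det_lin ?L\<bar> = exp (snd ?p)"
    unfolding det_lin_blocks by simp
  finally show ?thesis by simp
qed

text \<open>The powers of \<open>chi v\<close> from the Cayley transform cancel against those from
  exp z = (1 - |v|^2) / \<open>chi v\<close>; both have exponent \<open>Q + 1\<close> in absolute
  value.\<close>

lemma jac_\<Phi>:
  assumes v: "norm v < 1"
  shows "\<bar>det_lin (\<lambda>u. Dmi (\<Phi> v) (frechet_derivative \<Phi> (at v) u))\<bar>
    = 2 ^ DIM('a \<times> real) * (1 - (norm v)\<^sup>2) powr - (Q + 1)"
proof -
  have pos: "chi v > 0" by (rule chi_pos[OF v])
  have vv: "v \<bullet> v < 1" using v by (simp add: ball_iff)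
  let ?m = "card B" and ?k = "card (Basis - B)" and ?z = "snd (\<Phi> v)"
  have dim: "DIM('a \<times> real) = ?m + ?k + 1"
    using card_Diff_subset[OF fin_B B_Basis] card_mono[OF finite_Basis B_Basis] by (simp add: DIM_prod)
  have d: "\<bar>det_lin (frechet_derivative \<Phi> (at v))\<bar> = exp (- ?z) *
      ((2 / sqrt (chi v)) ^ ?m * (2 / chi v) ^ ?k * (2 / chi v))"
    unfolding det_\<Phi>1[OF v, symmetric] det_\<Phi>[OF v, symmetric] by (simp add: mult.assoc[symmetric] exp_add[symmetric])
  have c: "(2 / sqrt (chi v)) ^ ?m * (2 / chi v) ^ ?k * (2 / chi v) = 2 ^ (?m + ?k + 1) * chi v powr - (Q + 1)"
  proof -
    have "sqrt (chi v) ^ ?m = chi v powr (?m / 2)"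
      using pos by (simp add: powr_half_sqrt[symmetric] powr_realpow[symmetric] powr_powr)
    moreover have "chi v ^ ?k = chi v powr ?k"
      using pos by (simp add: powr_realpow)
    ultimately have "chi v powr (Q + 1) = sqrt (chi v) ^ ?m * chi v ^ ?k * chi v"
      using pos by (simp add: Q_def powr_add)
    then have "chi v powr - (Q + 1) = 1 / (sqrt (chi v) ^ ?m * chi v ^ ?k * chi v)"
      by (simp only: powr_minus inverse_eq_divide)
    then show ?thesis
      by (simp only:) (simp add: power_divide power_add)
  qed
  have z: "exp (- (Q * ?z)) * exp (- ?z) = ((1 - v \<bullet> v) / chi v) powr - (Q + 1)"
  proof -
    have "((1 - v \<bullet> v) / chi v) powr - (Q + 1) = exp (- (Q + 1) * ?z)"
      using pos vv exp_\<Phi>[OF v] by (simp add: powr_def \<Phi>_def)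
    then show ?thesis by (simp add: exp_add[symmetric] algebra_simps)
  qed
  have "\<bar>det_lin (\<lambda>u. Dmi (\<Phi> v) (frechet_derivative \<Phi> (at v) u))\<bar>
      = exp (- (Q * ?z)) * exp (- ?z) * (2 ^ (?m + ?k + 1) * chi v powr - (Q + 1))"
    unfolding det_lin_compose[OF linear_Dmi, of "\<Phi> v" "frechet_derivative \<Phi> (at v)"] abs_mult det_Dmi d c
    by simp
  also have "\<dots> = 2 ^ (?m + ?k + 1) * (1 - v \<bullet> v) powr - (Q + 1)"
    unfolding z using pos vv by (simp add: powr_divide)
  finally show ?thesis
    unfolding dim power2_norm_eq_inner .
qed

definition dr_chart :: "'a \<times> real \<Rightarrow> 'a \<times> real \<Rightarrow> 'a \<times> real" where
  "dr_chart x v = x + Dm x (\<Phi> v)"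

definition dr_chart_inv :: "'a \<times> real \<Rightarrow> 'a \<times> real \<Rightarrow> 'a \<times> real" where
  "dr_chart_inv x p = \<Phi>i (Dmi x (p - x))"

lemma \<Phi>_0: "\<Phi> 0 = 0"
  by (simp add: \<Phi>_def chi_def PR_linear J_linear prod_eq_iff)

lemma dr_chart_0: "dr_chart x 0 = x"
  by (simp add: dr_chart_def \<Phi>_0 linear_0[OF linear_Dm])

text \<open>The chart at \<open>x\<close> is the left translate of the one at the identity, and
  \<open>Dm_add\<close> reduces its Gauss and Jacobian identities to those of \<Phi>.\<close>

lemma polar_chart_dr: "polar_chart (dr_metric B br) Dm Dmi (dr_chart x) (dr_chart_inv x) Q"
proof (intro polar_chart.intro frame_metric_dr polar_chart_axioms.intro)
  have der: "frechet_derivative (dr_chart x) (at v) = (\<lambda>u. Dm x (frechet_derivative \<Phi> (at v) u))" if "norm v < 1" for v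
  proof -
    have "((\<lambda>v. x + Dm x (\<Phi> v)) has_derivative (\<lambda>u. Dm x (frechet_derivative \<Phi> (at v) u))) (at v)"
      using linear_Dm[of x] that
      by (auto intro!: derivative_eq_intros bounded_linear.has_derivative[of "Dm x"] \<Phi>_has_derivative
          simp: linear_conv_bounded_linear)
    then show ?thesis
      unfolding dr_chart_def[abs_def] by (rule frechet_derivative_at[symmetric])
  qed
  have T: "Dmi (dr_chart x v) (Dm x w) = Dmi (\<Phi> v) w" for v w
  proof -
    have "Dm x w = Dm (dr_chart x v) (Dmi (\<Phi> v) w)"
      unfolding dr_chart_def Dm_add by simp
    then show ?thesis by simp
  qed
  show "smooth_on (ball 0 1) (dr_chart x)"
    unfolding dr_chart_def[abs_def] by (intro smooth_on_Dm smooth_intros smooth_on_\<Phi>) auto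
  have "smooth_on UNIV (\<lambda>p. Dmi x (p - x))"
    by (intro smooth_on_Dmi smooth_intros) auto
  then show "smooth_on UNIV (dr_chart_inv x)"
    unfolding dr_chart_inv_def[abs_def] by (intro smooth_on_compose[OF _ open_UNIV _ smooth_on_\<Phi>i]) auto
  show "dr_chart_inv x (dr_chart x v) = v" if "norm v < 1" for v
    using that by (simp add: dr_chart_def dr_chart_inv_def \<Phi>i_\<Phi>)
  show "dr_chart x (dr_chart_inv x p) = p" for p
    by (simp add: dr_chart_def dr_chart_inv_def \<Phi>_\<Phi>i)
  show "norm (dr_chart_inv x p) < 1" for p
    by (simp add: dr_chart_inv_def norm_\<Phi>i)
  show "Dmi (dr_chart x v) (frechet_derivative (dr_chart x) (at v) v) \<bullet>
      Dmi (dr_chart x v) (frechet_derivative (dr_chart x) (at v) u) = 4 * (v \<bullet> u) / (1 - (norm v)\<^sup>2)\<^sup>2"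
    if "norm v < 1" for v u
    unfolding der[OF that] T by (rule gauss_\<Phi>[OF that])
  show "\<bar>det_lin (\<lambda>u. Dmi (dr_chart x v) (frechet_derivative (dr_chart x) (at v) u))\<bar>
      = 2 ^ DIM('a \<times> real) * (1 - (norm v)\<^sup>2) powr - (Q + 1)" if "norm v < 1" for v
    unfolding der[OF that] T by (rule jac_\<Phi>[OF that])
  show "Q \<ge> 0" by (simp add: Q_def)
qed

end

section \<open>Double spherical means\<close>

lemma has_derivative_from_partials:
  fixes V V1 V2 :: "real \<times> real \<Rightarrow> real"
  assumes 1: "\<And>r s. ((\<lambda>r. V (r, s)) has_real_derivative V1 (r, s)) (at r)"
    and 2: "\<And>r s. ((\<lambda>s. V (r, s)) has_real_derivative V2 (r, s)) (at s)"
    and cont: "continuous_on UNIV V2"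
  shows "(V has_derivative (\<lambda>h. V1 p * fst h + V2 p * snd h)) (at p)"
proof -
  obtain r s where p: "p = (r, s)" by (cases p)
  have "((\<lambda>(r, s). V (r, s)) has_derivative (\<lambda>(tr, ts). V1 (r, s) * tr + blinfun_mult_right (V2 (r, s)) ts)) (at (r, s) within UNIV \<times> UNIV)"
  proof (rule has_derivative_partialsI)
    show "((\<lambda>x. V (x, s)) has_derivative (\<lambda>t. V1 (r, s) * t)) (at r within UNIV)"
      using 1[of s r] by (simp add: has_field_derivative_def)
    show "((\<lambda>y. V (x, y)) has_derivative blinfun_apply (blinfun_mult_right (V2 (x, y)))) (at y within UNIV)" for x y
      using 2[of x y] by (simp add: has_field_derivative_def)
    have "isCont V2 (r, s)"
      using cont by (simp add: continuous_on_eq_continuous_at)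
    then have "isCont (\<lambda>q. blinfun_mult_right (V2 q)) (r, s)"
      by (rule bounded_linear.isCont[OF bounded_linear_blinfun_mult_right])
    then show "continuous (at (r, s) within UNIV \<times> UNIV) (\<lambda>(x, y). blinfun_mult_right (V2 (x, y)))"
      by (simp add: case_prod_beta')
  qed auto
  then show ?thesis
    by (simp add: p case_prod_beta')
qed

text \<open>Differentiating under the integral sign, in \<open>r\<close>, the integral of
  \<open>V2\<close> from \<open>s\<close> to \<open>t\<close> writes
  \<open>V1 (r, t) - V1 (r, s)\<close> as an integral of \<open>V21\<close>. The derivative of this
  in \<open>t\<close> at \<open>s\<close> is both \<open>V12\<close> and \<open>V21\<close>.\<close>

lemma mixed_partials_eq:
  fixes V V1 V2 V12 V21 :: "real \<times> real \<Rightarrow> real"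
  assumes 1: "\<And>r s. ((\<lambda>r. V (r, s)) has_real_derivative V1 (r, s)) (at r)"
    and 2: "\<And>r s. ((\<lambda>s. V (r, s)) has_real_derivative V2 (r, s)) (at s)"
    and 12: "\<And>r s. ((\<lambda>s. V1 (r, s)) has_real_derivative V12 (r, s)) (at s)"
    and 21: "\<And>r s. ((\<lambda>r. V2 (r, s)) has_real_derivative V21 (r, s)) (at r)"
    and cont: "continuous_on UNIV V2" "continuous_on UNIV V21"
  shows "V12 (r, s) = V21 (r, s)"
proof -
  have c2: "continuous_on S (\<lambda>t. V2 (x, t))" and c21: "continuous_on S (\<lambda>t. V21 (x, t))" for S x
    by (rule continuous_on_compose2[OF cont(1)] continuous_on_compose2[OF cont(2)]; auto intro!: continuous_intros)+
  have F: "integral {s..t} (\<lambda>t. V2 (x, t)) = V (x, t) - V (x, s)" if "s \<le> t" for x t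
    by (rule integral_unique, rule fundamental_theorem_of_calculus[OF that])
      (use 2 in \<open>auto simp: has_real_derivative_iff_has_vector_derivative[symmetric] intro: has_field_derivative_at_within\<close>)
  have I: "integral {s..t} (\<lambda>t. V21 (r, t)) = V1 (r, t) - V1 (r, s)" if "s \<le> t" for t
  proof -
    have "((\<lambda>x. integral (cbox s t) (\<lambda>t. V2 (x, t))) has_field_derivative integral (cbox s t) (\<lambda>t. V21 (r, t))) (at r within UNIV)"
    proof (rule leibniz_rule_field_derivative)
      show "((\<lambda>x. V2 (x, t)) has_field_derivative V21 (x, t)) (at x within UNIV)" for x t
        using 21 by simp
      show "(\<lambda>t. V2 (x, t)) integrable_on cbox s t" for x
        by (intro integrable_continuous c2)
      show "continuous_on (UNIV \<times> cbox s t) (\<lambda>(x, t). V21 (x, t))"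
        using continuous_on_subset[OF cont(2)] by (simp add: case_prod_beta')
    qed auto
    moreover have "((\<lambda>x. V (x, t) - V (x, s)) has_field_derivative V1 (r, t) - V1 (r, s)) (at r)"
      by (intro DERIV_diff 1)
    ultimately show ?thesis
      using F[OF that] DERIV_unique by (force simp: cbox_interval)
  qed
  \<comment> \<open>The derivative is taken at the left end of \<open>{s..s + 1}\<close>, where the
    one-sided derivative is still unique.\<close>
  have "((\<lambda>u. integral {s..u} (\<lambda>t. V21 (r, t))) has_real_derivative V21 (r, s)) (at s within {s..s + 1})"
    by (rule integral_has_real_derivative[OF c21]) auto
  moreover have "((\<lambda>u. V1 (r, u) - V1 (r, s)) has_real_derivative V12 (r, s)) (at s within {s..s + 1})"
    using DERIV_diff[OF has_field_derivative_at_within[OF 12] DERIV_const] by simp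
  then have "((\<lambda>u. integral {s..u} (\<lambda>t. V21 (r, t))) has_real_derivative V12 (r, s)) (at s within {s..s + 1})"
    by (rule has_field_derivative_transform_within[where d = 1]) (auto simp: I)
  ultimately show ?thesis
    using has_field_derivative_unique[of _ _ s "{s..s+1}"]
    by (metis at_within_Icc_at_right trivial_limit_at_right_real less_add_one)
qed

text \<open>Derivative in the parameter alone. As a directional derivative of the joint function it
  is smooth on the same open set, so it can be iterated.\<close>

definition dpar ::
  "'p::real_normed_vector \<Rightarrow> ('p \<times> 'q::real_normed_vector \<Rightarrow> real) \<Rightarrow> 'p \<times> 'q \<Rightarrow> real" where
  "dpar d w q = frechet_derivative w (at q) (d, 0)"

lemma smooth_dpar: "smooth_on S w \<Longrightarrow> smooth_on S (dpar d w)"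
  unfolding dpar_def[abs_def] by (rule smooth_on_frechet_derivative)

lemma dpar_has_derivative:
  assumes smooth: "smooth_on S w" and S: "(p + t *\<^sub>R d, y) \<in> S"
  shows "((\<lambda>t. w (p + t *\<^sub>R d, y)) has_real_derivative dpar d w (p + t *\<^sub>R d, y)) (at t)"
proof -
  have l: "((\<lambda>t. (p + t *\<^sub>R d, y)) has_derivative (\<lambda>h. (h *\<^sub>R d, 0))) (at t)"
    by (auto intro!: derivative_eq_intros)
  let ?D = "frechet_derivative w (at (p + t *\<^sub>R d, y))"
  have D: "(w has_derivative ?D) (at (p + t *\<^sub>R d, y))"
    by (rule smooth_on_has_derivative[OF smooth S])
  have e: "?D (h *\<^sub>R d, 0) = ?D (d, 0) * h" for h
    using linear_cmul[OF has_derivative_linear[OF D], of h "(d, 0)"] by (simp add: mult.commute)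
  show ?thesis
    unfolding has_field_derivative_def dpar_def
    by (rule has_derivative_eq_rhs[OF has_derivative_compose[OF l D]]) (rule ext, rule e)
qed

locale double_mean =
  M: compact_finite_measure M + N: compact_finite_measure N
  for M :: "'y::euclidean_space measure" and N :: "'z::euclidean_space measure"
begin

lemma continuous_on_double_integral:
  fixes w :: "'p::topological_space \<times> 'y \<times> 'z \<Rightarrow> real"
  assumes "continuous_on (T \<times> space M \<times> space N) w"
  shows "continuous_on T (\<lambda>p. \<integral>y. \<integral>z. w (p, y, z) \<partial>N \<partial>M)"
proof (rule M.continuous_on_integral)
  have "continuous_on (T \<times> space M) (\<lambda>q. \<integral>z. w (fst q, snd q, z) \<partial>N)"
  proof (rule N.continuous_on_integral)
    show "continuous_on ((T \<times> space M) \<times> space N) (\<lambda>(q, z). w (fst q, snd q, z))"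
      unfolding case_prod_beta' by (rule continuous_on_compose2[OF assms]) (auto intro!: continuous_intros)
  qed
  then show "continuous_on (T \<times> space M) (\<lambda>(p, y). \<integral>z. w (p, y, z) \<partial>N)"
    by (simp add: case_prod_beta')
qed

lemma double_integral_swap:
  fixes w :: "'y \<times> 'z \<Rightarrow> real"
  assumes "continuous_on (space M \<times> space N) w"
  shows "(\<integral>y. \<integral>z. w (y, z) \<partial>N \<partial>M) = (\<integral>z. \<integral>y. w (y, z) \<partial>M \<partial>N)"
  using assms by (intro Fubini_continuous M.compact_finite_measure_axioms N.compact_finite_measure_axioms)
    (simp add: case_prod_beta')

lemma double_integral_has_derivative:
  fixes w :: "'p::real_normed_vector \<times> 'y \<times> 'z \<Rightarrow> real"
  assumes smooth: "smooth_on S w" and sub: "UNIV \<times> space M \<times> space N \<subseteq> S"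
  shows "((\<lambda>t. \<integral>y. \<integral>z. w (p + t *\<^sub>R d, y, z) \<partial>N \<partial>M) has_real_derivative
    (\<integral>y. \<integral>z. dpar d w (p + t *\<^sub>R d, y, z) \<partial>N \<partial>M)) (at t)"
proof -
  have c: "continuous_on (UNIV \<times> space M \<times> space N) w" "continuous_on (UNIV \<times> space M \<times> space N) (dpar d w)"
    using continuous_on_subset[OF _ sub] smooth_on_imp_continuous_on[OF smooth] smooth_on_imp_continuous_on[OF smooth_dpar[OF smooth]] by blast+
  have inner: "continuous_on (T \<times> space M) (\<lambda>q. \<integral>z. k (p + fst q *\<^sub>R d, snd q, z) \<partial>N)"
    if k: "continuous_on (UNIV \<times> space M \<times> space N) k" for k :: "'p \<times> 'y \<times> 'z \<Rightarrow> real" and T :: "real set"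
  proof (rule N.continuous_on_integral)
    show "continuous_on ((T \<times> space M) \<times> space N) (\<lambda>(q, z). k (p + fst q *\<^sub>R d, snd q, z))"
      unfolding case_prod_beta' by (rule continuous_on_compose2[OF k]) (auto intro!: continuous_intros)
  qed
  show ?thesis
  proof (rule M.has_real_derivative_integral)
    show "continuous_on (space M) (\<lambda>y. \<integral>z. w (p + t *\<^sub>R d, y, z) \<partial>N)" for t
      using continuous_on_compose2[OF inner[OF c(1), of UNIV] continuous_on_Pair[OF continuous_on_const[of _ t] continuous_on_id], of "space M"]
      by (simp add: image_subset_iff)
    show "continuous_on (UNIV \<times> space M) (\<lambda>(t, y). \<integral>z. dpar d w (p + t *\<^sub>R d, y, z) \<partial>N)"
      using inner[OF c(2)] by (simp add: case_prod_beta')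
    fix t y assume y: "y \<in> space M"
    show "((\<lambda>t. \<integral>z. w (p + t *\<^sub>R d, y, z) \<partial>N) has_real_derivative (\<integral>z. dpar d w (p + t *\<^sub>R d, y, z) \<partial>N)) (at t)"
    proof (rule N.has_real_derivative_integral)
      show "continuous_on (space N) (\<lambda>z. w (p + t *\<^sub>R d, y, z))" for t
        by (rule continuous_on_compose2[OF c(1)]) (use y in \<open>auto intro!: continuous_intros\<close>)
      show "continuous_on (UNIV \<times> space N) (\<lambda>(t, z). dpar d w (p + t *\<^sub>R d, y, z))"
        unfolding case_prod_beta' by (rule continuous_on_compose2[OF c(2)]) (use y in \<open>auto intro!: continuous_intros\<close>)
    qed (use y sub in \<open>auto intro!: dpar_has_derivative[OF smooth]\<close>)
  qed
qed

end

context polar_chart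
begin

text \<open>Needed for exchanging the two integrals of the Laplacian of \<open>U\<close> over a pair
  of spheres. The coefficient fields of the divergence are jointly smooth in the point and the
  parameter.\<close>

lemma continuous_on_laplace_beltrami_parameter:
  fixes U :: "('a \<times> real) \<times> 'z::euclidean_space \<Rightarrow> real"
  assumes U: "smooth_on UNIV U"
  shows "continuous_on UNIV (\<lambda>q. laplace_beltrami g (\<lambda>p. U (p, snd q)) (fst q))"
proof -
  define K where "K b q = vol (fst q) *
    (\<Sum>i\<in>Basis. (D (fst q) i \<bullet> b) * (\<Sum>c\<in>Basis. (D (fst q) i \<bullet> c) * frechet_derivative U (at q) (c, 0)))" for b and q :: "('a \<times> real) \<times> 'z"
  have slice: "smooth_on UNIV (\<lambda>p. U (p, z))" for z
    by (rule smooth_on_compose[OF open_UNIV open_UNIV _ U]) (auto intro!: smooth_intros)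
  have par: "frechet_derivative (\<lambda>p. W (p, z)) (at p) u = frechet_derivative W (at (p, z)) (u, 0)"
    if "smooth_on UNIV W" for W :: "('a \<times> real) \<times> 'z \<Rightarrow> real" and p z u
  proof -
    have "((\<lambda>p. (p, z)) has_derivative (\<lambda>u. (u, 0))) (at p)"
      by (auto intro!: derivative_eq_intros)
    from has_derivative_compose[OF this smooth_on_has_derivative[OF that UNIV_I]]
    show ?thesis by (simp add: frechet_derivative_at[symmetric])
  qed
  have lift: "smooth_on UNIV (\<lambda>q::('a \<times> real) \<times> 'z. k (fst q))" if "smooth_on UNIV k" for k :: "'a \<times> real \<Rightarrow> real"
    by (rule smooth_on_compose[OF open_UNIV open_UNIV _ that]) (auto intro!: smooth_intros)
  have liftD: "smooth_on UNIV (\<lambda>q::('a \<times> real) \<times> 'z. D (fst q) i \<bullet> b)" for i b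
    by (rule lift) (intro smooth_intros smooth_D open_UNIV)
  have K: "smooth_on UNIV (K b)" for b
    unfolding K_def[abs_def]
    by (intro smooth_on_mult smooth_on_sum liftD lift[OF smooth_det] smooth_on_frechet_derivative[OF U] open_UNIV)
  have XK: "Xf (\<lambda>p. U (p, z)) b p = K b (p, z)" for z b p
  proof -
    have "frechet_derivative (\<lambda>p. U (p, z)) (at p) (D p i) = (\<Sum>c\<in>Basis. (D p i \<bullet> c) * frechet_derivative U (at (p, z)) (c, 0))" for i
      by (subst linear_Basis_expansion[OF linear_Df[OF slice]]) (simp add: par[OF U])
    then show ?thesis unfolding Xf_def K_def by simp
  qed
  have "laplace_beltrami g (\<lambda>p. U (p, snd q)) (fst q)
      = (1 / vol (fst q)) * (\<Sum>b\<in>Basis. frechet_derivative (K b) (at q) (b, 0))" for q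
    unfolding laplace_beltrami_eq[OF slice] XK[abs_def] par[OF K] by simp
  moreover have "continuous_on UNIV (\<lambda>q. (1 / vol (fst q)) * (\<Sum>b\<in>Basis. frechet_derivative (K b) (at q) (b, 0)))"
    using less_imp_neq[OF vol_pos]
    by (intro continuous_on_mult continuous_on_divide continuous_on_sum continuous_on_const
        smooth_on_imp_continuous_on[OF lift[OF smooth_det]]
        smooth_on_imp_continuous_on[OF smooth_on_frechet_derivative[OF K]]) (metis)
  ultimately show ?thesis by simp
qed

text \<open>Used with the real and the imaginary part, to reduce complex-valued functions to
  real-valued ones.\<close>

lemma laplace_beltrami_bounded_linear:
  fixes f :: "'a \<times> real \<Rightarrow> 'b::real_normed_vector" and L :: "'b \<Rightarrow> 'c::real_normed_vector"
  assumes f: "smooth_on UNIV f" and L: "bounded_linear L"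
  shows "laplace_beltrami g (\<lambda>p. L (f p)) p = L (laplace_beltrami g f p)"
proof -
  interpret L: bounded_linear L by (rule L)
  have fr: "frechet_derivative (\<lambda>p. L (k p)) (at q) u = L (frechet_derivative k (at q) u)"
    if "smooth_on UNIV k" for k :: "'a \<times> real \<Rightarrow> 'b" and q u
    by (rule fun_cong[OF frechet_derivative_at[OF L.has_derivative[OF smooth_on_has_derivative[OF that UNIV_I]]], symmetric])
  define G where "G b q = volume_density g q *\<^sub>R (\<Sum>c\<in>Basis. inverse_metric g q b c *\<^sub>R frechet_derivative f (at q) c)" for b q
  have "smooth_on UNIV (G b)" for b
    unfolding G_def[abs_def] volume_density_eq inverse_metric_eq
    by (intro smooth_intros smooth_det smooth_D f open_UNIV)
  moreover have "volume_density g q *\<^sub>R (\<Sum>c\<in>Basis. inverse_metric g q b c *\<^sub>R frechet_derivative (\<lambda>p. L (f p)) (at q) c) = L (G b q)" for b q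
    by (simp add: G_def fr[OF f] L.scaleR L.sum)
  ultimately show ?thesis
    unfolding laplace_beltrami_def by (simp add: fr L.scaleR L.sum G_def[symmetric])
qed

end

text \<open>Form of \<open>radial_laplacian\<close> in which the derivatives along rays may be given
  by any functions, such as partial derivatives of a function of further variables.\<close>

lemma (in polar_chart) radial_laplacian_mean:
  assumes f: "smooth_on UNIV f" and t: "t > 0"
    and v: "\<And>t \<omega>. norm \<omega> = 1 \<Longrightarrow> ((\<lambda>t. f (ray t \<omega>)) has_real_derivative v1 t \<omega>) (at t)"
    and v1: "\<And>t \<omega>. norm \<omega> = 1 \<Longrightarrow> ((\<lambda>t. v1 t \<omega>) has_real_derivative v2 t \<omega>) (at t)"
  shows "A t * (\<integral>\<omega>. v2 t \<omega> \<partial>sphere_measure) + A' t * (\<integral>\<omega>. v1 t \<omega> \<partial>sphere_measure) =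
    A t * (\<integral>\<omega>. laplace_beltrami g f (ray t \<omega>) \<partial>sphere_measure)"
proof -
  have 1: "ur1 f (t, \<omega>) = v1 t \<omega>" if n: "norm \<omega> = 1" for t \<omega>
  proof -
    have "((\<lambda>t. ur f (t, \<omega>)) has_real_derivative ur1 f (t, \<omega>)) (at t)"
      unfolding ur1_def[OF f] by (rule smooth_on_slice_derivative[OF smooth_ur[OF f]]) (simp add: ray_domain_sphere n)
    then show ?thesis
      using DERIV_unique[OF _ v[OF n]] by (simp add: ur_def[OF f])
  qed
  have 2: "ur2 f (t, \<omega>) = v2 t \<omega>" if n: "norm \<omega> = 1" for t \<omega>
  proof -
    have "((\<lambda>t. ur1 f (t, \<omega>)) has_real_derivative ur2 f (t, \<omega>)) (at t)"
      unfolding ur2_def[OF f] by (rule smooth_on_slice_derivative[OF smooth_ur1[OF f]]) (simp add: ray_domain_sphere n)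
    then show ?thesis
      using DERIV_unique[OF _ v1[OF n]] by (simp add: 1[OF n])
  qed
  have "N1 f t = (\<integral>\<omega>. v1 t \<omega> \<partial>sphere_measure)" "N2 f t = (\<integral>\<omega>. v2 t \<omega> \<partial>sphere_measure)"
    unfolding N1_def[OF f] N2_def[OF f] by (intro Bochner_Integration.integral_cong refl; simp add: 1 2)+
  then show ?thesis
    using radial_laplacian[OF f t] by (simp add: La_def[OF f])
qed

text \<open>Two centres with a common exponent \<open>Q\<close>. The density \<open>A\<close>
  depends on \<open>Q\<close> and the dimension only, so it is the same for both.\<close>

locale two_polar_charts =
  X: polar_chart g D Di E F Q + Y: polar_chart g D Di E' F' Q
  for g :: "('a::euclidean_space \<times> real) metric_tensor" and D Di E F E' F' Q
begin

sublocale double_mean "sphere_measure :: ('a \<times> real) measure" "sphere_measure :: ('a \<times> real) measure" ..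

definition dom :: "((real \<times> real) \<times> ('a \<times> real) \<times> ('a \<times> real)) set" where
  "dom = {q. (fst (fst q), fst (snd q)) \<in> X.ray_domain \<and> (snd (fst q), snd (snd q)) \<in> Y.ray_domain}"

lemma open_dom: "open dom"
proof -
  have e: "dom = (\<lambda>q. (fst (fst q), fst (snd q))) -` X.ray_domain \<inter> (\<lambda>q. (snd (fst q), snd (snd q))) -` Y.ray_domain"
    by (auto simp: dom_def)
  show ?thesis
    unfolding e by (intro open_Int open_vimage X.open_ray_domain Y.open_ray_domain continuous_intros)
qed

lemma sphere_sub_dom: "UNIV \<times> space sphere_measure \<times> space sphere_measure \<subseteq> dom"
  by (auto simp: dom_def X.ray_domain_sphere Y.ray_domain_sphere)

definition Mean ::
  "((real \<times> real) \<times> ('a \<times> real) \<times> ('a \<times> real) \<Rightarrow> real) \<Rightarrow> real \<times> real \<Rightarrow> real" where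
  "Mean w p = (\<integral>\<omega>. \<integral>\<omega>'. w (p, \<omega>, \<omega>') \<partial>sphere_measure \<partial>sphere_measure)"

lemma continuous_on_sphere_dom: "smooth_on dom w \<Longrightarrow> continuous_on (UNIV \<times> sphere 0 1 \<times> sphere 0 1) w"
  using continuous_on_subset[OF smooth_on_imp_continuous_on] sphere_sub_dom by auto

lemma continuous_on_Mean: "smooth_on dom w \<Longrightarrow> continuous_on UNIV (Mean w)"
  unfolding Mean_def[abs_def]
  by (intro continuous_on_double_integral) (simp add: continuous_on_sphere_dom)

lemma Mean_has_derivative:
  assumes w: "smooth_on dom w"
  shows "((\<lambda>r. Mean w (r, s)) has_real_derivative Mean (dpar (1, 0) w) (r, s)) (at r)"
    and "((\<lambda>s. Mean w (r, s)) has_real_derivative Mean (dpar (0, 1) w) (r, s)) (at s)"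
  using double_integral_has_derivative[OF w sphere_sub_dom, of "(0, s)" "(1, 0)" r]
    double_integral_has_derivative[OF w sphere_sub_dom, of "(r, 0)" "(0, 1)" s]
  by (simp_all add: Mean_def)

lemma dpar_partial:
  assumes w: "smooth_on dom w" and \<omega>: "norm \<omega> = 1" "norm \<omega>' = 1"
  shows "((\<lambda>r. w ((r, s), \<omega>, \<omega>')) has_real_derivative dpar (1, 0) w ((r, s), \<omega>, \<omega>')) (at r)"
    and "((\<lambda>s. w ((r, s), \<omega>, \<omega>')) has_real_derivative dpar (0, 1) w ((r, s), \<omega>, \<omega>')) (at s)"
proof -
  have "(p, \<omega>, \<omega>') \<in> dom" for p
    using sphere_sub_dom \<omega> by auto
  then show "((\<lambda>r. w ((r, s), \<omega>, \<omega>')) has_real_derivative dpar (1, 0) w ((r, s), \<omega>, \<omega>')) (at r)"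
    "((\<lambda>s. w ((r, s), \<omega>, \<omega>')) has_real_derivative dpar (0, 1) w ((r, s), \<omega>, \<omega>')) (at s)"
    using dpar_has_derivative[OF w, of "(0, s)" r "(1, 0)" "(\<omega>, \<omega>')"]
      dpar_has_derivative[OF w, of "(r, 0)" s "(0, 1)" "(\<omega>, \<omega>')"] by simp_all
qed

section \<open>The wave equation for double spherical means\<close>

context
  fixes U :: "('a \<times> real) \<times> ('a \<times> real) \<Rightarrow> real"
  assumes U: "smooth_on UNIV U"
begin

definition pull :: "(real \<times> real) \<times> ('a \<times> real) \<times> ('a \<times> real) \<Rightarrow> real" where
  "pull q = U (X.ray (fst (fst q)) (fst (snd q)), Y.ray (snd (fst q)) (snd (snd q)))"

lemma smooth_pull: "smooth_on dom pull"
proof -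
  have "smooth_on dom (\<lambda>q. case (fst (fst q), fst (snd q)) of (r, \<omega>) \<Rightarrow> X.ray r \<omega>)"
    by (rule smooth_on_compose[OF open_dom X.open_ray_domain _ X.smooth_ray])
      (auto simp: dom_def[symmetric] intro!: smooth_intros open_dom, auto simp: dom_def)
  moreover have "smooth_on dom (\<lambda>q. case (snd (fst q), snd (snd q)) of (r, \<omega>) \<Rightarrow> Y.ray r \<omega>)"
    by (rule smooth_on_compose[OF open_dom Y.open_ray_domain _ Y.smooth_ray])
      (auto simp: dom_def[symmetric] intro!: smooth_intros open_dom, auto simp: dom_def)
  ultimately have "smooth_on dom (\<lambda>q. (X.ray (fst (fst q)) (fst (snd q)), Y.ray (snd (fst q)) (snd (snd q))))"
    by (intro smooth_on_Pair open_dom) simp_all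
  from smooth_on_compose[OF open_dom open_UNIV this U]
  show ?thesis unfolding pull_def[abs_def] by simp
qed

lemma smooth_slices: "smooth_on UNIV (\<lambda>p. U (p, p'))" "smooth_on UNIV (\<lambda>p'. U (p, p'))"
  by (rule smooth_on_compose[OF open_UNIV open_UNIV _ U]; auto intro!: smooth_intros)+

lemma continuous_on_slice:
  assumes w: "smooth_on dom w"
  shows "continuous_on (sphere 0 1 \<times> sphere 0 1) (\<lambda>z. w (p, z))"
    and "norm \<omega> = 1 \<Longrightarrow> continuous_on (sphere 0 1) (\<lambda>\<omega>'. w (p, \<omega>, \<omega>'))"
    and "norm \<omega>' = 1 \<Longrightarrow> continuous_on (sphere 0 1) (\<lambda>\<omega>. w (p, \<omega>, \<omega>'))"
  by (rule continuous_on_compose2[OF continuous_on_sphere_dom[OF w]]; auto intro!: continuous_intros)+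

lemma Mean_swap:
  assumes w: "smooth_on dom w"
  shows "Mean w p = (\<integral>\<omega>'. \<integral>\<omega>. w (p, \<omega>, \<omega>') \<partial>sphere_measure \<partial>sphere_measure)"
  unfolding Mean_def by (rule double_integral_swap) (simp add: continuous_on_slice(1)[OF w])

lemma integrable_inner:
  fixes w :: "_ \<Rightarrow> real"
  assumes w: "smooth_on dom w"
  shows "integrable sphere_measure (\<lambda>\<omega>. \<integral>\<omega>'. w (p, \<omega>, \<omega>') \<partial>sphere_measure)"
    and "integrable sphere_measure (\<lambda>\<omega>'. \<integral>\<omega>. w (p, \<omega>, \<omega>') \<partial>sphere_measure)"
proof -
  have "continuous_on (sphere 0 1) (\<lambda>\<omega>. \<integral>\<omega>'. w (p, \<omega>, \<omega>') \<partial>sphere_measure)"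
    by (rule sphere_measure.continuous_on_integral)
      (use continuous_on_slice(1)[OF w, of p] in \<open>simp add: case_prod_beta'\<close>)
  then show "integrable sphere_measure (\<lambda>\<omega>. \<integral>\<omega>'. w (p, \<omega>, \<omega>') \<partial>sphere_measure)"
    by (intro sphere_measure.integrable_continuous) simp
  have "continuous_on (sphere 0 1) (\<lambda>\<omega>'. \<integral>\<omega>. w (p, \<omega>, \<omega>') \<partial>sphere_measure)"
  proof (rule sphere_measure.continuous_on_integral)
    show "continuous_on (sphere 0 1 \<times> space sphere_measure) (\<lambda>(\<omega>', \<omega>). w (p, \<omega>, \<omega>'))"
      unfolding case_prod_beta'
      by (rule continuous_on_compose2[OF continuous_on_slice(1)[OF w, of p]]) (auto intro!: continuous_intros)
  qed
  then show "integrable sphere_measure (\<lambda>\<omega>'. \<integral>\<omega>. w (p, \<omega>, \<omega>') \<partial>sphere_measure)"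
    by (intro sphere_measure.integrable_continuous) simp
qed

text \<open>The radial equation for \<open>U\<close> in its first variable, with the second on the
  sphere around the other centre, integrated over that sphere. The integrals are exchanged so that
  the differentiated variable is innermost.\<close>

lemma wave_left:
  assumes r: "r > 0"
  shows "X.A r * Mean (dpar (1, 0) (dpar (1, 0) pull)) (r, s) + X.A' r * Mean (dpar (1, 0) pull) (r, s) =
    X.A r * (\<integral>\<omega>'. \<integral>\<omega>. laplace_beltrami g (\<lambda>p. U (p, Y.ray s \<omega>')) (X.ray r \<omega>) \<partial>sphere_measure \<partial>sphere_measure)"
proof -
  note sm = smooth_dpar[OF smooth_pull] smooth_dpar[OF smooth_dpar[OF smooth_pull]]
  have "X.A r * Mean (dpar (1, 0) (dpar (1, 0) pull)) (r, s) + X.A' r * Mean (dpar (1, 0) pull) (r, s) =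
     (\<integral>\<omega>'. X.A r * (\<integral>\<omega>. dpar (1, 0) (dpar (1, 0) pull) ((r, s), \<omega>, \<omega>') \<partial>sphere_measure)
       + X.A' r * (\<integral>\<omega>. dpar (1, 0) pull ((r, s), \<omega>, \<omega>') \<partial>sphere_measure) \<partial>sphere_measure)"
    by (simp add: Mean_swap sm integrable_inner(2)[OF sm(1)] integrable_inner(2)[OF sm(2)])
  also have "\<dots> = (\<integral>\<omega>'. X.A r * (\<integral>\<omega>. laplace_beltrami g (\<lambda>p. U (p, Y.ray s \<omega>')) (X.ray r \<omega>) \<partial>sphere_measure) \<partial>sphere_measure)"
  proof (intro Bochner_Integration.integral_cong refl X.radial_laplacian_mean[OF smooth_slices(1) r])
    fix \<omega>' \<omega> :: "'a \<times> real" and t assume \<omega>': "\<omega>' \<in> space sphere_measure" and \<omega>: "norm \<omega> = 1"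
    have n: "norm \<omega>' = 1" using \<omega>' by simp
    show "((\<lambda>t. U (X.ray t \<omega>, Y.ray s \<omega>')) has_real_derivative dpar (1, 0) pull ((t, s), \<omega>, \<omega>')) (at t)"
      using dpar_partial(1)[OF smooth_pull \<omega> n, of s t] by (simp add: pull_def)
    show "((\<lambda>t. dpar (1, 0) pull ((t, s), \<omega>, \<omega>')) has_real_derivative dpar (1, 0) (dpar (1, 0) pull) ((t, s), \<omega>, \<omega>')) (at t)"
      by (rule dpar_partial(1)[OF sm(1) \<omega> n])
  qed
  finally show ?thesis by simp
qed

lemma wave_right:
  assumes s: "s > 0"
  shows "Y.A s * Mean (dpar (0, 1) (dpar (0, 1) pull)) (r, s) + Y.A' s * Mean (dpar (0, 1) pull) (r, s) =
    Y.A s * (\<integral>\<omega>. \<integral>\<omega>'. laplace_beltrami g (\<lambda>p'. U (X.ray r \<omega>, p')) (Y.ray s \<omega>') \<partial>sphere_measure \<partial>sphere_measure)"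
proof -
  note sm = smooth_dpar[OF smooth_pull] smooth_dpar[OF smooth_dpar[OF smooth_pull]]
  have "Y.A s * Mean (dpar (0, 1) (dpar (0, 1) pull)) (r, s) + Y.A' s * Mean (dpar (0, 1) pull) (r, s) =
     (\<integral>\<omega>. Y.A s * (\<integral>\<omega>'. dpar (0, 1) (dpar (0, 1) pull) ((r, s), \<omega>, \<omega>') \<partial>sphere_measure)
       + Y.A' s * (\<integral>\<omega>'. dpar (0, 1) pull ((r, s), \<omega>, \<omega>') \<partial>sphere_measure) \<partial>sphere_measure)"
    by (simp add: Mean_def integrable_inner(1)[OF sm(1)] integrable_inner(1)[OF sm(2)])
  also have "\<dots> = (\<integral>\<omega>. Y.A s * (\<integral>\<omega>'. laplace_beltrami g (\<lambda>p'. U (X.ray r \<omega>, p')) (Y.ray s \<omega>') \<partial>sphere_measure) \<partial>sphere_measure)"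
  proof (intro Bochner_Integration.integral_cong refl Y.radial_laplacian_mean[OF smooth_slices(2) s])
    fix \<omega>' \<omega> :: "'a \<times> real" and t assume \<omega>: "\<omega> \<in> space sphere_measure" and \<omega>': "norm \<omega>' = 1"
    have n: "norm \<omega> = 1" using \<omega> by simp
    show "((\<lambda>t. U (X.ray r \<omega>, Y.ray t \<omega>')) has_real_derivative dpar (0, 1) pull ((r, t), \<omega>, \<omega>')) (at t)"
      using dpar_partial(2)[OF smooth_pull n \<omega>', of r t] by (simp add: pull_def)
    show "((\<lambda>t. dpar (0, 1) pull ((r, t), \<omega>, \<omega>')) has_real_derivative dpar (0, 1) (dpar (0, 1) pull) ((r, t), \<omega>, \<omega>')) (at t)"
      by (rule dpar_partial(2)[OF sm(1) n \<omega>'])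
  qed
  finally show ?thesis by simp
qed

text \<open>The difference \<open>W\<close> is antisymmetric in the radii, so it vanishes on the
  diagonal and only \<open>s \<le> r\<close> has to be treated. Because \<open>A\<close> is the same
  for both centres, exchanging the radii preserves the wave equation.\<close>

lemma Mean_pull_symmetric:
  assumes lap: "\<And>p p'. laplace_beltrami g (\<lambda>p. U (p, p')) p = laplace_beltrami g (\<lambda>p'. U (p, p')) p'"
    and r: "r > 0" and s: "s > 0"
  shows "Mean pull (r, s) = Mean pull (s, r)"
proof -
  define V1 V2 V11 V12 V22 where V: "V1 = Mean (dpar (1, 0) pull)" "V2 = Mean (dpar (0, 1) pull)"
    "V11 = Mean (dpar (1, 0) (dpar (1, 0) pull))" "V12 = Mean (dpar (0, 1) (dpar (1, 0) pull))"
    "V22 = Mean (dpar (0, 1) (dpar (0, 1) pull))"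
  note sm = smooth_pull smooth_dpar[OF smooth_pull] smooth_dpar[OF smooth_dpar[OF smooth_pull]]
  note cont = continuous_on_Mean[OF sm(1)] continuous_on_Mean[OF sm(2)] continuous_on_Mean[OF sm(3)]
  \<comment> \<open>The energy argument works with a single mixed derivative.\<close>
  have V21: "Mean (dpar (1, 0) (dpar (0, 1) pull)) = V12"
    unfolding V using mixed_partials_eq[OF Mean_has_derivative[OF sm(1)] Mean_has_derivative(2)[OF sm(2)]
        Mean_has_derivative(1)[OF sm(2)] cont(2) cont(3)] by auto
  have d: "(Mean pull has_derivative (\<lambda>h. V1 p * fst h + V2 p * snd h)) (at p)"
    "(V1 has_derivative (\<lambda>h. V11 p * fst h + V12 p * snd h)) (at p)"
    "(V2 has_derivative (\<lambda>h. V12 p * fst h + V22 p * snd h)) (at p)" for p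
    unfolding V21[symmetric]
    subgoal unfolding V by (rule has_derivative_from_partials[OF Mean_has_derivative[OF sm(1)] cont(2)])
    subgoal unfolding V21 unfolding V by (rule has_derivative_from_partials[OF Mean_has_derivative[OF sm(2)] cont(3)])
    subgoal unfolding V by (rule has_derivative_from_partials[OF Mean_has_derivative[OF sm(2)] cont(3)])
    done
  have c: "continuous_on UNIV V11" "continuous_on UNIV V12" "continuous_on UNIV V22"
    unfolding V by (rule cont(3))+
  have wave: "V11 (r, s) + X.A' r / X.A r * V1 (r, s) = V22 (r, s) + X.A' s / X.A s * V2 (r, s)"
    if "r > 0" "s > 0" for r s
  proof -
    let ?L = "\<lambda>q. laplace_beltrami g (\<lambda>p. U (p, snd q)) (fst q)"
    have cr: "continuous_on (sphere 0 1) (X.ray r)" "continuous_on (sphere 0 1) (Y.ray s)"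
      by (rule X.continuous_on_ray_sphere Y.continuous_on_ray_sphere)+
    \<comment> \<open>\<open>wave_left\<close> and \<open>wave_right\<close> integrate the Laplacian
      in opposite orders; continuity on the product of the spheres reconciles them.\<close>
    have "continuous_on (sphere 0 1 \<times> sphere 0 1) (\<lambda>z. ?L (X.ray r (fst z), Y.ray s (snd z)))"
      by (rule continuous_on_compose2[OF X.continuous_on_laplace_beltrami_parameter[OF U]])
        (auto intro!: continuous_intros continuous_on_compose2[OF cr(1)] continuous_on_compose2[OF cr(2)])
    then have "(\<integral>\<omega>. \<integral>\<omega>'. ?L (X.ray r \<omega>, Y.ray s \<omega>') \<partial>sphere_measure \<partial>sphere_measure)
        = (\<integral>\<omega>'. \<integral>\<omega>. ?L (X.ray r \<omega>, Y.ray s \<omega>') \<partial>sphere_measure \<partial>sphere_measure)"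
      using double_integral_swap[of "\<lambda>z. ?L (X.ray r (fst z), Y.ray s (snd z))"] by simp
    moreover have "X.A r > 0" "X.A s > 0"
      using that X.A_pos by auto
    ultimately show ?thesis
      using wave_left[OF that(1), of s] wave_right[OF that(2), of r]
      by (simp add: V lap field_simps)
  qed
  define W W1 W2 W11 W12 W22 where W: "W p = Mean pull p - Mean pull (prod.swap p)"
    "W1 p = V1 p - V2 (prod.swap p)" "W2 p = V2 p - V1 (prod.swap p)"
    "W11 p = V11 p - V22 (prod.swap p)" "W12 p = V12 p - V12 (prod.swap p)"
    "W22 p = V22 p - V11 (prod.swap p)" for p
  have ds: "((\<lambda>p. v (prod.swap p)) has_derivative (\<lambda>h. v2 (prod.swap p) * fst h + v1 (prod.swap p) * snd h)) (at p)"
    if "\<And>p. (v has_derivative (\<lambda>h. v1 p * fst h + v2 p * snd h)) (at p)" for v v1 v2 :: "real \<times> real \<Rightarrow> real" and p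
  proof -
    have "(prod.swap has_derivative prod.swap) (at p)"
      unfolding prod.swap_def[abs_def] by (auto intro!: derivative_eq_intros)
    from has_derivative_compose[OF this that] show ?thesis
      by (rule has_derivative_eq_rhs) (simp add: fun_eq_iff)
  qed
  have cs: "continuous_on UNIV (\<lambda>p. v (prod.swap p))" if "continuous_on UNIV v" for v :: "real \<times> real \<Rightarrow> real"
    by (rule continuous_on_compose2[OF that]) (auto intro!: continuous_intros)
  have zero: "W (r, s) = 0" if "0 < s" "s \<le> r" for r s
  proof (rule antisymmetric_hyperbolic_zero[where ?W1.0 = W1 and ?W2.0 = W2 and ?W11.0 = W11 and ?W12.0 = W12 and ?W22.0 = W22
        and A = X.A and A' = X.A'])
    show "(W has_derivative (\<lambda>h. W1 p * fst h + W2 p * snd h)) (at p)" for p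
      unfolding W by (rule has_derivative_eq_rhs[OF has_derivative_diff[OF d(1) ds[OF d(1)]]]) (auto simp: algebra_simps)
    show "(W1 has_derivative (\<lambda>h. W11 p * fst h + W12 p * snd h)) (at p)" for p
      unfolding W by (rule has_derivative_eq_rhs[OF has_derivative_diff[OF d(2) ds[OF d(3)]]]) (auto simp: algebra_simps)
    show "(W2 has_derivative (\<lambda>h. W12 p * fst h + W22 p * snd h)) (at p)" for p
      unfolding W by (rule has_derivative_eq_rhs[OF has_derivative_diff[OF d(3) ds[OF d(2)]]]) (auto simp: algebra_simps)
    show "continuous_on UNIV W11" "continuous_on UNIV W12" "continuous_on UNIV W22"
      unfolding W by (intro continuous_intros c cs)+
    show "W11 (r, s) + X.A' r / X.A r * W1 (r, s) = W22 (r, s) + X.A' s / X.A s * W2 (r, s)" if "r > 0" "s > 0" for r s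
      using wave[OF that] wave[OF that(2) that(1)] unfolding W prod.swap_def by (simp add: algebra_simps diff_divide_distrib)
  qed (use that X.A_has_derivative X.continuous_on_A' X.A_0 X.A_pos X.A'_nonneg in \<open>auto simp: W\<close>)
  show ?thesis
  proof (cases "s \<le> r")
    case True
    then show ?thesis using zero[OF s] by (simp add: W)
  next
    case False
    then show ?thesis using zero[OF r, of s] by (simp add: W)
  qed
qed

text \<open>The factor \<open>X.A r * X.A s\<close> is symmetric in the radii, so the claim reduces
  to the symmetry of \<open>Mean pull\<close>. Continuity of the inner integral allows the outer one
  to be written over directions.\<close>

lemma sphere_integral_double:
  assumes r: "r > 0" and s: "s > 0"
  shows "continuous_on UNIV (\<lambda>p. sphere_integral g (E' 0) s (\<lambda>p'. U (p, p')))"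
    and "sphere_integral g (E 0) r (\<lambda>p. sphere_integral g (E' 0) s (\<lambda>p'. U (p, p'))) = X.A r * X.A s * Mean pull (r, s)"
proof -
  have cU: "continuous_on UNIV U" by (rule smooth_on_imp_continuous_on[OF U])
  have inner: "sphere_integral g (E' 0) s (\<lambda>p'. U (p, p')) = X.A s * (\<integral>\<omega>'. U (p, Y.ray s \<omega>') \<partial>sphere_measure)" for p
    using Y.sphere_integral_eq[OF s smooth_on_imp_continuous_on[OF smooth_slices(2)]] by simp
  have "continuous_on UNIV (\<lambda>p. \<integral>\<omega>'. U (p, Y.ray s \<omega>') \<partial>sphere_measure)"
  proof (rule sphere_measure.continuous_on_integral)
    show "continuous_on (UNIV \<times> space sphere_measure) (\<lambda>(p, \<omega>'). U (p, Y.ray s \<omega>'))"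
      unfolding case_prod_beta'
      by (rule continuous_on_compose2[OF cU]) (auto intro!: continuous_intros continuous_on_compose2[OF Y.continuous_on_ray_sphere])
  qed
  then show c: "continuous_on UNIV (\<lambda>p. sphere_integral g (E' 0) s (\<lambda>p'. U (p, p')))"
    unfolding inner by (intro continuous_intros)
  show "sphere_integral g (E 0) r (\<lambda>p. sphere_integral g (E' 0) s (\<lambda>p'. U (p, p'))) = X.A r * X.A s * Mean pull (r, s)"
    unfolding X.sphere_integral_eq[OF r c] unfolding inner by (simp add: Mean_def pull_def)
qed

lemma sphere_integral_symmetric_real:
  assumes lap: "\<And>p p'. laplace_beltrami g (\<lambda>p. U (p, p')) p = laplace_beltrami g (\<lambda>p'. U (p, p')) p'"
    and r: "r > 0" and s: "s > 0"
  shows "sphere_integral g (E 0) r (\<lambda>p. sphere_integral g (E' 0) s (\<lambda>p'. U (p, p'))) =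
    sphere_integral g (E 0) s (\<lambda>p. sphere_integral g (E' 0) r (\<lambda>p'. U (p, p')))"
  unfolding sphere_integral_double(2)[OF r s] sphere_integral_double(2)[OF s r]
  using Mean_pull_symmetric[OF lap r s] by simp

end

end

section \<open>Complex-valued functions\<close>

lemma (in polar_chart) sphere_integral_bounded_linear:
  fixes f :: "'a \<times> real \<Rightarrow> 'b::{banach, second_countable_topology}" and L :: "'b \<Rightarrow> 'c::{banach, second_countable_topology}"
  assumes L: "bounded_linear L" and f: "continuous_on UNIV f" and r: "r > 0"
  shows "sphere_integral g (E 0) r (\<lambda>p. L (f p)) = L (sphere_integral g (E 0) r f)"
proof -
  have "continuous_on UNIV (\<lambda>p. L (f p))"
    using bounded_linear.continuous_on[OF L f] .
  moreover have i: "integrable sphere_measure (\<lambda>\<omega>. f (ray r \<omega>))"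
    by (rule sphere_measure.integrable_continuous)
      (auto intro!: continuous_on_compose2[OF f] continuous_on_ray_sphere)
  ultimately show ?thesis
    using sphere_integral_eq[OF r f] sphere_integral_eq[OF r, of "\<lambda>p. L (f p)"] integral_bounded_linear[OF L i]
    by (simp add: linear_cmul[OF bounded_linear.linear[OF L]])
qed

text \<open>Real and imaginary parts commute with the Laplacian and with sphere integrals, so the
  real case applies to each of them.\<close>

lemma (in two_polar_charts) sphere_integral_symmetric:
  fixes U :: "('a \<times> real) \<times> ('a \<times> real) \<Rightarrow> complex"
  assumes U: "smooth_on UNIV U"
    and lap: "\<And>p p'. laplace_beltrami g (\<lambda>p. U (p, p')) p = laplace_beltrami g (\<lambda>p'. U (p, p')) p'"
    and r: "r > 0" and s: "s > 0"
  shows "sphere_integral g (E 0) r (\<lambda>p. sphere_integral g (E' 0) s (\<lambda>p'. U (p, p'))) =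
    sphere_integral g (E 0) s (\<lambda>p. sphere_integral g (E' 0) r (\<lambda>p'. U (p, p')))"
proof -
  have sl: "smooth_on UNIV (\<lambda>p. U (p, p'))" "smooth_on UNIV (\<lambda>p'. U (p, p'))" for p p'
    by (rule smooth_on_compose[OF open_UNIV open_UNIV _ U]; auto intro!: smooth_intros)+
  have inner: "sphere_integral g (E' 0) t (\<lambda>p'. L (U (p, p'))) = L (sphere_integral g (E' 0) t (\<lambda>p'. U (p, p')))"
    if "bounded_linear L" "t > 0" for L :: "complex \<Rightarrow> real" and t p
    by (rule Y.sphere_integral_bounded_linear[OF that(1) smooth_on_imp_continuous_on[OF sl(2)] that(2)])
  have part: "smooth_on UNIV (\<lambda>q. L (U q))"
    "laplace_beltrami g (\<lambda>p. L (U (p, p'))) p = laplace_beltrami g (\<lambda>p'. L (U (p, p'))) p'"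
    if L: "bounded_linear L" for L :: "complex \<Rightarrow> real" and p p'
    using smooth_on_bounded_linear_compose[OF open_UNIV L U]
    by (simp_all add: X.laplace_beltrami_bounded_linear[OF sl(1) L] X.laplace_beltrami_bounded_linear[OF sl(2) L] lap)
  have cont: "continuous_on UNIV (\<lambda>p. sphere_integral g (E' 0) t (\<lambda>p'. U (p, p')))" if t: "t > 0" for t
  proof -
    have "continuous_on UNIV (\<lambda>p. L (sphere_integral g (E' 0) t (\<lambda>p'. U (p, p'))))"
      if L: "bounded_linear L" for L :: "complex \<Rightarrow> real"
      using sphere_integral_double(1)[OF part(1)[OF L] t t] by (simp add: inner[OF L t])
    from continuous_on_Complex[OF this[OF bounded_linear_Re] this[OF bounded_linear_Im]]
    show ?thesis by simp
  qed
  have eq: "L (sphere_integral g (E 0) r (\<lambda>p. sphere_integral g (E' 0) s (\<lambda>p'. U (p, p')))) =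
      L (sphere_integral g (E 0) s (\<lambda>p. sphere_integral g (E' 0) r (\<lambda>p'. U (p, p'))))"
    if L: "bounded_linear L" for L :: "complex \<Rightarrow> real"
    using sphere_integral_symmetric_real[OF part(1)[OF L] part(2)[OF L] r s]
      X.sphere_integral_bounded_linear[OF L cont[OF s] r] X.sphere_integral_bounded_linear[OF L cont[OF r] s]
    by (simp add: inner[OF L s] inner[OF L r])
  show ?thesis
    by (rule complex_eqI[OF eq[OF bounded_linear_Re] eq[OF bounded_linear_Im]])
qed

theorem theorem3p1:
  fixes B :: "'a::euclidean_space set"
    and br :: "'a \<Rightarrow> 'a \<Rightarrow> 'a"
    and U :: "('a \<times> real) \<times> ('a \<times> real) \<Rightarrow> complex"
    and x y :: "'a \<times> real"
    and r s :: real
  assumes "damek_ricci B br"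
    and "smooth_on UNIV U"
    and "\<forall>x y. laplace_beltrami (dr_metric B br) (\<lambda>x'. U (x', y)) x =
               laplace_beltrami (dr_metric B br) (\<lambda>y'. U (x, y')) y"
    and "r > 0" and "s > 0"
  shows "sphere_integral (dr_metric B br) x r (\<lambda>x'.
           sphere_integral (dr_metric B br) y s (\<lambda>y'. U (x', y'))) =
         sphere_integral (dr_metric B br) x s (\<lambda>x'.
           sphere_integral (dr_metric B br) y r (\<lambda>y'. U (x', y')))"
proof -
  interpret damek_ricci_space B br
    by (rule damek_ricci_space.intro[OF assms(1)])
  interpret charts: two_polar_charts "dr_metric B br" Dm Dmi "dr_chart x" "dr_chart_inv x" "dr_chart y" "dr_chart_inv y" Q
    by (intro two_polar_charts.intro polar_chart_dr)
  show ?thesis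
    using charts.sphere_integral_symmetric[OF assms(2) assms(3)[rule_format] assms(4,5)]
    by (simp add: dr_chart_0)
qed

end
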